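(* Let $U:[0,T]\times\mathbb{T}\times\mathcal{P}(\mathbb{T})\to\mathbb{R}$ be a classical solution to the continuous master equation and, for each $n$, let $U^n:[0,T]\times S^n\times\mathcal{P}(S^n)\to\mathbb{R}$ be a classical solution to the discrete master equation (both equations are recalled in the context). Let $V^n(t,x,m):=U\big(t,x,\sum_{j=1}^n m_j\delta_{x_j^n}\big)$ for $t\in[0,T]$, $x\in S^n$, $m\in\mathcal{P}(S^n)$, and let $\omega$ be a modulus of continuity of $\partial_xU$, $\partial_{xx}U$, $\frac{\delta U}{\delta m}$, $\partial_y\frac{\delta U}{\delta m}$ and $\partial_{yy}\frac{\delta U}{\delta m}$. Then there exists a constant $C$, independent of $n$, such that $$|U^n(t,x,m)-V^n(t,x,m)|\le C\,\omega\!\left(\tfrac1n\right)\qquad\forall t\in[0,T],\ x\in S^n,\ m\in\mathcal{P}(S^n),$$ $$\mathbb{E}\int_0^T|\Delta^n_+(U^n-V^n)(t,X^n_t,\mathrm{Law}(X^n_t))|^2+|\Delta^n_-(U^n-V^n)(t,X^n_t,\mathrm{Law}(X^n_t))|^2\,dt\le C\,\omega^2\!\left(\tfrac1n\right),$$ where $X^n$ is the optimal process of the discrete mean field game, started at time $0$ from any initial distribution in $\mathcal{P}(S^n)$.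
   Context: Notation. $\mathbb{T}$ is the unit circle (one-dimensional torus $\mathbb{R}/\mathbb{Z}$). $\mathcal{P}(E)$, $\mathcal{M}(E)$ are the sets of probability measures and of (finite) Borel measures on $E$; $W_1$ is the 1-Wasserstein distance on $\mathcal{P}$. For $U:\mathcal{P}(\mathbb{T})\to\mathbb{R}$, when defined, $\frac{\delta U}{\delta m}(m,x)=\lim_{\theta\to0}\frac{U((1-\theta)m+\theta\delta_x)-U(m)}{\theta}$. Standing assumptions. $\sigma>0$, $T>0$ is arbitrary but fixed. $L(x,a)$ is a cost function (Lagrangian), smooth and uniformly convex in $a$ on compact sets, with $H(x,p)=\sup_{a\in\mathbb{R}}\{-ap-L(x,a)\}$; the Hamiltonian $H(x,p)$ is $\mathcal{C}^2$ and uniformly convex in $p$ on all compact sets. For some $\gamma\in(0,1)$, $f,g:\mathcal{M}(\mathbb{T})\to\mathcal{C}^\gamma(\mathbb{T})$, written $f(m)(x)=f(x,m)$, are monotone, i.e. $\int_{\mathbb{T}}(f(x,m)-f(x,\tilde m))(m-\tilde m)(dx)\ge0$ for all $m,\tilde m\in\mathcal{M}(\mathbb{T})$ and likewise for $g$; both are $W_1$-Lipschitz in $m$ uniformly in $x$; $f$ is Lipschitz in $x$ uniformly in $m$; $g$ is valued and bounded in $\mathcal{C}^{2+\gamma}(\mathbb{T})$ uniformly in $m$. Continuous master equation: $$-\partial_tU-\sigma\partial_{xx}U+H(x,\partial_xU)-\Big\langle\sigma\partial_{xx}m+\partial_x(\partial_pH(\cdot,\partial_xU)m),\tfrac{\delta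 U}{\delta m}(t,x,m,\cdot)\Big\rangle=f(m)(x),\qquad U(T,x,m)=g(m)(x),$$ where after integration by parts the bracket term (with its minus sign) is $-\sigma\int_{\mathbb{T}}\partial_{yy}\frac{\delta U}{\delta m}(t,x,m,y)m(dy)+\int_{\mathbb{T}}\partial_pH(y,\partial_xU(t,y,m))\partial_y\frac{\delta U}{\delta m}(t,x,m,y)m(dy)$. A classical solution is a function $U$ satisfying the equation such that $U$ and all derivatives appearing in the equation (in particular $\partial_xU,\partial_{xx}U,\frac{\delta U}{\delta m},\partial_y\frac{\delta U}{\delta m},\partial_{yy}\frac{\delta U}{\delta m}$) are continuous in their arguments, $\mathcal{P}(\mathbb{T})$ being equipped with $W_1$. Discrete model. $S^n=\{x_1^n,\dots,x_n^n\}=\{1/n,\dots,1=0\}\subset\mathbb{T}$, $\Delta x_n=1/n$, indices modulo $n$. A measure $m=(m_x)_{x\in S^n}\in\mathcal{P}(S^n)$ is identified with $\sum_jm_j\delta_{x_j^n}\in\mathcal{P}(\mathbb{T})$. For $u:S^n\to\mathbb{R}$: $\Delta^n_\pm u(x)=\frac{u(x\pm\Delta x_n)-u(x)}{\Delta x_n}$, $\Delta^n_2u(x)=\frac{u(x+\Delta x_n)-2u(x)+u(x-\Delta x_n)}{\Delta x_n^2}$; on functions of $(t,x,m)$ these act in $x$. Set $H_\uparrow(x,p)=-\inf_{\alpha\ge0}\{L(x,\alpha)+\alpha p\}$, $H_\downarrow(x,p)=-\inf_{\alpha\ge0}\{L(x,-\alpha)-\alpha p\}+L(x,0)$; these are $\mathcal{C}^1$,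 and they and their $p$-derivatives are locally Lipschitz. $\partial_{m_y}$ denotes the derivative in the direction of $e_y$ (only differences $\partial_{m_{y'}}-\partial_{m_y}$, i.e. derivatives tangent to the simplex, are used). Discrete master equation, for $t\in[0,T],x\in S^n,m\in\mathcal{P}(S^n)$, with $U^n(T,x,m)=g(m)(x)$: $$-\partial_tU^n+H_\uparrow(x,\Delta^n_+U^n)+H_\downarrow(x,-\Delta^n_-U^n)-\sigma\Delta_2^nU^n-f(m)(x)$$ $$-\sum_{y\in S^n}m_y\Big(\tfrac{-\partial_pH_\uparrow(y,\Delta_+^nU^n(t,y,m))}{\Delta x_n}+\tfrac{\sigma}{\Delta x_n^2}\Big)\big(\partial_{m_{y+\Delta x_n}}U^n(t,x,m)-\partial_{m_y}U^n(t,x,m)\big)$$ $$-\sum_{y\in S^n}m_y\Big(\tfrac{\partial_pH_\downarrow(y,-\Delta_-^nU^n(t,y,m))}{\Delta x_n}+\tfrac{\sigma}{\Delta x_n^2}\Big)\big(\partial_{m_{y-\Delta x_n}}U^n(t,x,m)-\partial_{m_y}U^n(t,x,m)\big)=0.$$ A classical solution is a function in $\mathcal{C}^1([0,T]\times\mathcal{P}(S^n);\mathbb{R}^n)$ solving it. The optimal process $X^n$ of the discrete mean field game is the continuous-time Markov chain on $S^n$ which at time $t$ jumps from $x$ to $x+\Delta x_n$ at rate $\frac{\alpha^n_+(t,x)}{\Delta x_n}+\frac{\sigma}{\Delta x_n^2}$ and from $x$ to $x-\Delta x_n$ at rate $\frac{\alpha^n_-(t,x)}{\Delta x_n}+\frac{\sigma}{\Delta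 x_n^2}$, with $\alpha^n_+(t,x)=-\partial_pH_\uparrow(x,\Delta^n_+U^n(t,x,\mathrm{Law}(X^n_t)))$ and $\alpha^n_-(t,x)=\partial_pH_\downarrow(x,-\Delta^n_-U^n(t,x,\mathrm{Law}(X^n_t)))$. *)

theory Defs
  imports "HOL-Probability.Probability"
begin

section \<open>The torus\<close>

quotient_type torus = real / "\<lambda>x y :: real. x - y \<in> \<int>"
  morphisms rep_torus to_torus
proof (rule equivpI)
  show "reflp (\<lambda>x y :: real. x - y \<in> \<int>)"
    by (simp add: reflp_def)
  show "symp (\<lambda>x y :: real. x - y \<in> \<int>)"
    by (metis (no_types, lifting) Ints_minus minus_diff_eq sympI)
  show "transp (\<lambda>x y :: real. x - y \<in> \<int>)"
    by (rule transpI) (metis (no_types, lifting) Ints_add diff_add_cancel add_diff_eq)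
qed

instantiation torus :: ab_group_add
begin

lift_definition zero_torus :: torus is "0 :: real" .

lift_definition plus_torus :: "torus \<Rightarrow> torus \<Rightarrow> torus" is "(+)"
  by (metis (no_types, lifting) Ints_add add_diff_add)

lift_definition uminus_torus :: "torus \<Rightarrow> torus" is "uminus"
  by (metis (no_types, lifting) Ints_minus minus_diff_minus)

lift_definition minus_torus :: "torus \<Rightarrow> torus \<Rightarrow> torus" is "(-)"
proof -
  fix a b c d :: real
  assume "a - b \<in> \<int>" "c - d \<in> \<int>"
  then have "(a - b) - (c - d) \<in> \<int>" by (rule Ints_diff)
  then show "a - c - (b - d) \<in> \<int>" by (simp add: algebra_simps)
qed

instance
  by standard (transfer; simp add: algebra_simps)+

end

lemma round_add_of_int: "round (x + of_int k) = round (x :: real) + k"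
proof -
  have "x + of_int k + 1 / 2 = (x + 1 / 2) + of_int k" by simp
  then show ?thesis unfolding round_def by (metis floor_add_int)
qed

instantiation torus :: metric_space
begin

lift_definition dist_torus :: "torus \<Rightarrow> torus \<Rightarrow> real"
  is "\<lambda>x y :: real. \<bar>x - y - of_int (round (x - y))\<bar>"
proof -
  fix a b c d :: real
  assume "a - b \<in> \<int>" "c - d \<in> \<int>"
  then have "(a - b) - (c - d) \<in> \<int>" by (rule Ints_diff)
  then obtain k where "(a - b) - (c - d) = of_int k" by (auto elim: Ints_cases)
  then have "a - c = (b - d) + of_int k" by simp
  then show "\<bar>a - c - of_int (round (a - c))\<bar> = \<bar>b - d - of_int (round (b - d))\<bar>"
    by (simp add: round_add_of_int)
qed

definition uniformity_torus :: "(torus \<times> torus) filter"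
  where "uniformity_torus = (INF e\<in>{0<..}. principal {(x, y). dist x y < e})"

definition open_torus :: "torus set \<Rightarrow> bool"
  where "open_torus U \<longleftrightarrow> (\<forall>x\<in>U. eventually (\<lambda>(x', y). x' = x \<longrightarrow> y \<in> U) uniformity)"

instance
proof
  show "uniformity = (INF e\<in>{0<..}. principal {(x :: torus, y). dist x y < e})"
    by (rule uniformity_torus_def)
  show "open U \<longleftrightarrow> (\<forall>x\<in>U. eventually (\<lambda>(x', y). x' = x \<longrightarrow> y \<in> U) uniformity)"
    for U :: "torus set"
    by (rule open_torus_def)
  show "dist x y = 0 \<longleftrightarrow> x = y" for x y :: torus
  proof transfer
    fix x y :: real
    have "x - y = of_int (round (x - y))" if "x - y \<in> \<int>"
      using that by (auto elim!: Ints_cases)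
    moreover have "x - y \<in> \<int>" if "x - y = of_int (round (x - y))"
      using that by (metis Ints_of_int)
    ultimately show "(\<bar>x - y - of_int (round (x - y))\<bar> = 0) = (x - y \<in> \<int>)"
      by auto
  qed
  show "dist x y \<le> dist x z + dist y z" for x y z :: torus
  proof transfer
    fix x y z :: real
    have "\<bar>x - y - of_int (round (x - y))\<bar>
        \<le> \<bar>x - y - of_int (round (x - z) - round (y - z))\<bar>"
      by (rule round_diff_minimal)
    then show "\<bar>x - y - of_int (round (x - y))\<bar>
        \<le> \<bar>x - z - of_int (round (x - z))\<bar> + \<bar>y - z - of_int (round (y - z))\<bar>"
      by (simp add: algebra_simps)
  qed
qed

end

text \<open>Derivatives of functions on the torus. The operator \<open>ddx\<close> is total;
  the existence of the derivative is expressed by \<open>differentiable_torus\<close>.\<close>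

definition ddx :: "(torus \<Rightarrow> real) \<Rightarrow> torus \<Rightarrow> real"
  where "ddx u x = deriv (\<lambda>h. u (x + to_torus h)) 0"

definition differentiable_torus :: "(torus \<Rightarrow> real) \<Rightarrow> bool"
  where "differentiable_torus u \<longleftrightarrow>
    (\<forall>x. ((\<lambda>h. u (x + to_torus h)) has_real_derivative ddx u x) (at 0))"

definition holder_torus :: "real \<Rightarrow> real \<Rightarrow> (torus \<Rightarrow> real) \<Rightarrow> bool"
  where "holder_torus \<gamma> K u \<longleftrightarrow> (\<forall>x y. \<bar>u x - u y\<bar> \<le> K * dist x y powr \<gamma>)"

text \<open>The norm of \<open>u\<close> in the Hoelder space of order \<open>2 + \<gamma>\<close> is controlled by \<open>K\<close>.\<close>

definition C2_holder_torus :: "real \<Rightarrow> real \<Rightarrow> (torus \<Rightarrow> real) \<Rightarrow> bool"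
  where "C2_holder_torus \<gamma> K u \<longleftrightarrow>
    differentiable_torus u \<and> differentiable_torus (ddx u) \<and>
    (\<forall>x. \<bar>u x\<bar> \<le> K \<and> \<bar>ddx u x\<bar> \<le> K \<and> \<bar>ddx (ddx u) x\<bar> \<le> K) \<and>
    holder_torus \<gamma> K (ddx (ddx u))"

text \<open>Functions of class \<open>C\<^sup>k\<close> on the product of the torus and the real line:
  \<open>D i j\<close> is the partial derivative of order \<open>i\<close> in the first and \<open>j\<close> in the second variable.\<close>

definition C_k :: "nat \<Rightarrow> (torus \<Rightarrow> real \<Rightarrow> real) \<Rightarrow> bool"
  where "C_k k F \<longleftrightarrow> (\<exists>D :: nat \<Rightarrow> nat \<Rightarrow> torus \<Rightarrow> real \<Rightarrow> real. D 0 0 = F \<and>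
    (\<forall>i j. i + j \<le> k \<longrightarrow> continuous_on UNIV (\<lambda>(x, p). D i j x p)) \<and>
    (\<forall>i j x p. i + j < k \<longrightarrow>
       ((\<lambda>h. D i j (x + to_torus h) p) has_real_derivative D (Suc i) j x p) (at 0) \<and>
       (D i j x has_real_derivative D i (Suc j) x p) (at p)))"

definition ddp :: "(torus \<Rightarrow> real \<Rightarrow> real) \<Rightarrow> torus \<Rightarrow> real \<Rightarrow> real"
  where "ddp F x p = deriv (F x) p"

text \<open>Since the torus is compact, compact subsets of the product may be replaced by products of
  the torus with compact intervals.\<close>

definition uniformly_convex_on_compacts :: "(torus \<Rightarrow> real \<Rightarrow> real) \<Rightarrow> bool"
  where "uniformly_convex_on_compacts F \<longleftrightarrow>
    (\<forall>R. \<exists>c>0. \<forall>x. \<forall>a\<in>{-R..R}. \<forall>b\<in>{-R..R}. \<forall>\<theta>\<in>{0..1}.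
       F x (\<theta> * a + (1 - \<theta>) * b) \<le>
         \<theta> * F x a + (1 - \<theta>) * F x b - c / 2 * \<theta> * (1 - \<theta>) * (a - b)\<^sup>2)"

definition locally_lipschitz :: "(torus \<Rightarrow> real \<Rightarrow> real) \<Rightarrow> bool"
  where "locally_lipschitz F \<longleftrightarrow>
    (\<forall>R. \<exists>K. lipschitz_on K (UNIV \<times> {-R..R}) (\<lambda>(x, p). F x p))"


section \<open>Measures on the torus\<close>

definition finite_measures :: "torus measure set"
  where "finite_measures = {m. finite_measure m \<and> sets m = sets borel}"

definition prob_measures :: "torus measure set"
  where "prob_measures = {m. prob_space m \<and> sets m = sets borel}"

definition couplings :: "'a::metric_space measure \<Rightarrow> 'a measure \<Rightarrow> ('a \<times> 'a) measure set"
  where "couplings \<mu> \<nu> = {\<pi>. sets \<pi> = sets borel \<and>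
    distr \<pi> borel fst = \<mu> \<and> distr \<pi> borel snd = \<nu>}"

definition W1 :: "'a::metric_space measure \<Rightarrow> 'a measure \<Rightarrow> real"
  where "W1 \<mu> \<nu> = (INF \<pi>\<in>couplings \<mu> \<nu>. \<integral>z. dist (fst z) (snd z) \<partial>\<pi>)"

definition mixture :: "real \<Rightarrow> torus measure \<Rightarrow> torus measure \<Rightarrow> torus measure"
  where "mixture \<theta> \<mu> \<nu> = measure_of UNIV (sets borel)
    (\<lambda>A. ennreal (1 - \<theta>) * emeasure \<mu> A + ennreal \<theta> * emeasure \<nu> A)"

lemma emeasure_mixture:
  assumes "sets \<mu> = sets borel" "sets \<nu> = sets borel" "A \<in> sets borel"
  shows "emeasure (mixture \<theta> \<mu> \<nu>) A =
    ennreal (1 - \<theta>) * emeasure \<mu> A + ennreal \<theta> * emeasure \<nu> A"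
  unfolding mixture_def
proof (rule emeasure_measure_of_sigma)
  show "sigma_algebra UNIV (sets (borel :: torus measure))"
    using sets.sigma_algebra_axioms[of "borel :: torus measure"] by simp
  show "countably_additive (sets borel)
      (\<lambda>A. ennreal (1 - \<theta>) * emeasure \<mu> A + ennreal \<theta> * emeasure \<nu> A)"
    using assms
    by (auto simp: countably_additive_def suminf_add[symmetric] ennreal_suminf_cmult suminf_emeasure)
qed (use assms in \<open>auto simp: positive_def\<close>)

text \<open>The quotient in the definition of the flat derivative \<open>\<delta>U/\<delta>m\<close>; it is only considered
  for \<open>0 < \<theta> < 1\<close>, where the mixture is again a probability measure.\<close>

definition flat_quotient :: "(torus measure \<Rightarrow> real) \<Rightarrow> torus measure \<Rightarrow> torus \<Rightarrow> real \<Rightarrow> real"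
  where "flat_quotient F m x \<theta> = (F (mixture \<theta> m (return borel x)) - F m) / \<theta>"

definition flat_deriv :: "(torus measure \<Rightarrow> real) \<Rightarrow> torus measure \<Rightarrow> torus \<Rightarrow> real"
  where "flat_deriv F m x = Lim (at_right 0) (flat_quotient F m x)"

definition flat_differentiable_at :: "(torus measure \<Rightarrow> real) \<Rightarrow> torus measure \<Rightarrow> bool"
  where "flat_differentiable_at F m \<longleftrightarrow>
    (\<forall>x. (flat_quotient F m x \<longlongrightarrow> flat_deriv F m x) (at_right 0))"


section \<open>Lagrangian, Hamiltonian and costs\<close>

definition hamiltonian :: "(torus \<Rightarrow> real \<Rightarrow> real) \<Rightarrow> torus \<Rightarrow> real \<Rightarrow> real"
  where "hamiltonian L x p = (SUP a. - a * p - L x a)"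

definition ham_up :: "(torus \<Rightarrow> real \<Rightarrow> real) \<Rightarrow> torus \<Rightarrow> real \<Rightarrow> real"
  where "ham_up L x p = - (INF \<alpha>\<in>{0..}. L x \<alpha> + \<alpha> * p)"

definition ham_down :: "(torus \<Rightarrow> real \<Rightarrow> real) \<Rightarrow> torus \<Rightarrow> real \<Rightarrow> real"
  where "ham_down L x p = - (INF \<alpha>\<in>{0..}. L x (- \<alpha>) - \<alpha> * p) + L x 0"

text \<open>The boundedness condition says that the supremum defining the Hamiltonian is finite, hence
  that all the suprema and infima of real numbers above are genuine.\<close>

definition admissible_lagrangian :: "(torus \<Rightarrow> real \<Rightarrow> real) \<Rightarrow> bool"
  where "admissible_lagrangian L \<longleftrightarrow>
    (\<forall>k. C_k k L) \<and> uniformly_convex_on_compacts L \<and>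
    (\<forall>x p. bdd_above (range (\<lambda>a. - a * p - L x a))) \<and>
    C_k 2 (hamiltonian L) \<and> uniformly_convex_on_compacts (hamiltonian L) \<and>
    C_k 1 (ham_up L) \<and> locally_lipschitz (ham_up L) \<and> locally_lipschitz (ddp (ham_up L)) \<and>
    C_k 1 (ham_down L) \<and> locally_lipschitz (ham_down L) \<and> locally_lipschitz (ddp (ham_down L))"

definition monotone_cost :: "(torus measure \<Rightarrow> torus \<Rightarrow> real) \<Rightarrow> bool"
  where "monotone_cost f \<longleftrightarrow> (\<forall>m\<in>finite_measures. \<forall>m'\<in>finite_measures.
    (\<integral>x. f m x - f m' x \<partial>m) - (\<integral>x. f m x - f m' x \<partial>m') \<ge> 0)"

definition W1_lipschitz :: "(torus measure \<Rightarrow> torus \<Rightarrow> real) \<Rightarrow> bool"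
  where "W1_lipschitz f \<longleftrightarrow>
    (\<exists>K. \<forall>m\<in>prob_measures. \<forall>m'\<in>prob_measures. \<forall>x. \<bar>f m x - f m' x\<bar> \<le> K * W1 m m')"

text \<open>Uniformity in the measure is understood on probability measures, the domain of \<open>W1\<close>:
  a nonzero cost which is linear in the measure is not bounded on all finite measures.\<close>

definition admissible_running_cost :: "real \<Rightarrow> (torus measure \<Rightarrow> torus \<Rightarrow> real) \<Rightarrow> bool"
  where "admissible_running_cost \<gamma> f \<longleftrightarrow>
    (\<forall>m\<in>finite_measures. \<exists>K. holder_torus \<gamma> K (f m)) \<and>
    monotone_cost f \<and> W1_lipschitz f \<and>
    (\<exists>K. \<forall>m\<in>prob_measures. lipschitz_on K UNIV (f m))"

definition admissible_terminal_cost :: "real \<Rightarrow> (torus measure \<Rightarrow> torus \<Rightarrow> real) \<Rightarrow> bool"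
  where "admissible_terminal_cost \<gamma> g \<longleftrightarrow>
    (\<forall>m\<in>finite_measures. \<exists>K. C2_holder_torus \<gamma> K (g m)) \<and>
    monotone_cost g \<and> W1_lipschitz g \<and>
    (\<exists>K. \<forall>m\<in>prob_measures. C2_holder_torus \<gamma> K (g m))"


section \<open>The continuous master equation\<close>

text \<open>Continuity with respect to an explicitly given distance; it is needed because the distances
  on spaces of measures do not come from a type class.\<close>

definition continuous_wrt :: "('a \<Rightarrow> 'a \<Rightarrow> real) \<Rightarrow> 'a set \<Rightarrow> ('a \<Rightarrow> real) \<Rightarrow> bool"
  where "continuous_wrt d S F \<longleftrightarrow>
    (\<forall>a\<in>S. \<forall>\<epsilon>>0. \<exists>\<delta>>0. \<forall>b\<in>S. d a b < \<delta> \<longrightarrow> \<bar>F a - F b\<bar> < \<epsilon>)"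

definition modulus_wrt :: "('a \<Rightarrow> 'a \<Rightarrow> real) \<Rightarrow> 'a set \<Rightarrow> ('a \<Rightarrow> real) \<Rightarrow> (real \<Rightarrow> real) \<Rightarrow> bool"
  where "modulus_wrt d S F \<omega> \<longleftrightarrow> (\<forall>a\<in>S. \<forall>b\<in>S. \<bar>F a - F b\<bar> \<le> \<omega> (d a b))"

definition modulus_function :: "(real \<Rightarrow> real) \<Rightarrow> bool"
  where "modulus_function \<omega> \<longleftrightarrow>
    mono_on {0..} \<omega> \<and> \<omega> 0 = 0 \<and> (\<omega> \<longlongrightarrow> 0) (at_right 0)"

definition dist_txm :: "real \<times> torus \<times> torus measure \<Rightarrow> real \<times> torus \<times> torus measure \<Rightarrow> real"
  where "dist_txm = (\<lambda>(t, x, m) (t', x', m'). \<bar>t - t'\<bar> + dist x x' + W1 m m')"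

definition dist_txmy ::
    "real \<times> torus \<times> torus measure \<times> torus \<Rightarrow> real \<times> torus \<times> torus measure \<times> torus \<Rightarrow> real"
  where "dist_txmy = (\<lambda>(t, x, m, y) (t', x', m', y').
    \<bar>t - t'\<bar> + dist x x' + W1 m m' + dist y y')"

definition dom_txm :: "real \<Rightarrow> (real \<times> torus \<times> torus measure) set"
  where "dom_txm T = {0..T} \<times> UNIV \<times> prob_measures"

definition dom_txmy :: "real \<Rightarrow> (real \<times> torus \<times> torus measure \<times> torus) set"
  where "dom_txmy T = {0..T} \<times> UNIV \<times> prob_measures \<times> UNIV"

type_synonym value_fun = "real \<Rightarrow> torus \<Rightarrow> torus measure \<Rightarrow> real"

definition U_x :: "value_fun \<Rightarrow> real \<Rightarrow> torus \<Rightarrow> torus measure \<Rightarrow> real"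
  where "U_x U t x m = ddx (\<lambda>z. U t z m) x"

definition U_xx :: "value_fun \<Rightarrow> real \<Rightarrow> torus \<Rightarrow> torus measure \<Rightarrow> real"
  where "U_xx U t x m = ddx (\<lambda>z. U_x U t z m) x"

definition U_m :: "value_fun \<Rightarrow> real \<Rightarrow> torus \<Rightarrow> torus measure \<Rightarrow> torus \<Rightarrow> real"
  where "U_m U t x m y = flat_deriv (U t x) m y"

definition U_my :: "value_fun \<Rightarrow> real \<Rightarrow> torus \<Rightarrow> torus measure \<Rightarrow> torus \<Rightarrow> real"
  where "U_my U t x m y = ddx (U_m U t x m) y"

definition U_myy :: "value_fun \<Rightarrow> real \<Rightarrow> torus \<Rightarrow> torus measure \<Rightarrow> torus \<Rightarrow> real"
  where "U_myy U t x m y = ddx (U_my U t x m) y"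

text \<open>The equation is stated after integration by parts of the measure term. The time derivative
  \<open>U_t\<close> is one-sided at the end points of the time interval.\<close>

definition master_classical_solution ::
    "real \<Rightarrow> real \<Rightarrow> (torus \<Rightarrow> real \<Rightarrow> real) \<Rightarrow> (torus measure \<Rightarrow> torus \<Rightarrow> real) \<Rightarrow>
     (torus measure \<Rightarrow> torus \<Rightarrow> real) \<Rightarrow> value_fun \<Rightarrow> bool"
  where "master_classical_solution \<sigma> T L f g U \<longleftrightarrow> (\<exists>U_t.
    (\<forall>t\<in>{0..T}. \<forall>x. \<forall>m\<in>prob_measures.
       ((\<lambda>s. U s x m) has_real_derivative U_t t x m) (at t within {0..T}) \<and>
       differentiable_torus (\<lambda>z. U t z m) \<and>
       differentiable_torus (\<lambda>z. U_x U t z m) \<and>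
       flat_differentiable_at (U t x) m \<and>
       differentiable_torus (U_m U t x m) \<and>
       differentiable_torus (U_my U t x m)) \<and>
    continuous_wrt dist_txm (dom_txm T) (\<lambda>(t, x, m). U t x m) \<and>
    continuous_wrt dist_txm (dom_txm T) (\<lambda>(t, x, m). U_t t x m) \<and>
    continuous_wrt dist_txm (dom_txm T) (\<lambda>(t, x, m). U_x U t x m) \<and>
    continuous_wrt dist_txm (dom_txm T) (\<lambda>(t, x, m). U_xx U t x m) \<and>
    continuous_wrt dist_txmy (dom_txmy T) (\<lambda>(t, x, m, y). U_m U t x m y) \<and>
    continuous_wrt dist_txmy (dom_txmy T) (\<lambda>(t, x, m, y). U_my U t x m y) \<and>
    continuous_wrt dist_txmy (dom_txmy T) (\<lambda>(t, x, m, y). U_myy U t x m y) \<and>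
    (\<forall>t\<in>{0..T}. \<forall>x. \<forall>m\<in>prob_measures.
       - U_t t x m - \<sigma> * U_xx U t x m + hamiltonian L x (U_x U t x m)
       - \<sigma> * (\<integral>y. U_myy U t x m y \<partial>m)
       + (\<integral>y. ddp (hamiltonian L) y (U_x U t y m) * U_my U t x m y \<partial>m)
       = f m x) \<and>
    (\<forall>x. \<forall>m\<in>prob_measures. U T x m = g m x))"

definition common_modulus :: "real \<Rightarrow> value_fun \<Rightarrow> (real \<Rightarrow> real) \<Rightarrow> bool"
  where "common_modulus T U \<omega> \<longleftrightarrow>
    modulus_function \<omega> \<and>
    modulus_wrt dist_txm (dom_txm T) (\<lambda>(t, x, m). U_x U t x m) \<omega> \<and>
    modulus_wrt dist_txm (dom_txm T) (\<lambda>(t, x, m). U_xx U t x m) \<omega> \<and>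
    modulus_wrt dist_txmy (dom_txmy T) (\<lambda>(t, x, m, y). U_m U t x m y) \<omega> \<and>
    modulus_wrt dist_txmy (dom_txmy T) (\<lambda>(t, x, m, y). U_my U t x m y) \<omega> \<and>
    modulus_wrt dist_txmy (dom_txmy T) (\<lambda>(t, x, m, y). U_myy U t x m y) \<omega>"


section \<open>The discrete master equation\<close>

definition mesh :: "nat \<Rightarrow> real"
  where "mesh n = 1 / real n"

definition grid :: "nat \<Rightarrow> torus set"
  where "grid n = (\<lambda>j. to_torus (real j / real n)) ` {1..n}"

text \<open>Elements of the simplex are weight functions on the torus vanishing off the grid.
  Neighbours of grid points are obtained with the group structure of the torus, which takes
  care of the indices modulo \<open>n\<close>.\<close>

definition grid_prob :: "nat \<Rightarrow> (torus \<Rightarrow> real) set"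
  where "grid_prob n = {m. (\<forall>x. 0 \<le> m x) \<and> (\<forall>x. x \<notin> grid n \<longrightarrow> m x = 0) \<and>
    (\<Sum>x\<in>grid n. m x) = 1}"

definition grid_measure :: "nat \<Rightarrow> (torus \<Rightarrow> real) \<Rightarrow> torus measure"
  where "grid_measure n m = measure_of UNIV (sets borel)
    (\<lambda>A. \<Sum>x\<in>grid n. ennreal (m x) * emeasure (return borel x) A)"

lemma emeasure_grid_measure:
  assumes "A \<in> sets borel"
  shows "emeasure (grid_measure n m) A =
    (\<Sum>x\<in>grid n. ennreal (m x) * emeasure (return borel x) A)"
  unfolding grid_measure_def
proof (rule emeasure_measure_of_sigma)
  show "sigma_algebra UNIV (sets (borel :: torus measure))"
    using sets.sigma_algebra_axioms[of "borel :: torus measure"] by simp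
  show "countably_additive (sets borel)
      (\<lambda>A. \<Sum>x\<in>grid n. ennreal (m x) * emeasure (return borel x) A)"
    by (auto simp: countably_additive_def suminf_sum ennreal_suminf_cmult suminf_emeasure
        simp del: emeasure_return)
qed (use assms in \<open>auto simp: positive_def\<close>)

definition diff_fwd :: "nat \<Rightarrow> (torus \<Rightarrow> real) \<Rightarrow> torus \<Rightarrow> real"
  where "diff_fwd n u x = (u (x + to_torus (mesh n)) - u x) / mesh n"

definition diff_bwd :: "nat \<Rightarrow> (torus \<Rightarrow> real) \<Rightarrow> torus \<Rightarrow> real"
  where "diff_bwd n u x = (u (x - to_torus (mesh n)) - u x) / mesh n"

definition diff_snd :: "nat \<Rightarrow> (torus \<Rightarrow> real) \<Rightarrow> torus \<Rightarrow> real"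
  where "diff_snd n u x =
    (u (x + to_torus (mesh n)) - 2 * u x + u (x - to_torus (mesh n))) / (mesh n)\<^sup>2"

type_synonym grid_value_fun = "real \<Rightarrow> torus \<Rightarrow> (torus \<Rightarrow> real) \<Rightarrow> real"

definition dist_tm :: "nat \<Rightarrow> real \<times> (torus \<Rightarrow> real) \<Rightarrow> real \<times> (torus \<Rightarrow> real) \<Rightarrow> real"
  where "dist_tm n = (\<lambda>(t, m) (t', m'). \<bar>t - t'\<bar> + (\<Sum>y\<in>grid n. \<bar>m y - m' y\<bar>))"

text \<open>\<open>F\<close> is continuously differentiable on \<open>[0,T]\<close> times the closed simplex, with time derivative
  \<open>Ft\<close> and partial derivatives \<open>Fm t m y\<close> in the directions \<open>e\<^sub>y\<close>. Increments stay in the simplex,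
  so \<open>Fm\<close> is determined up to a constant independent of \<open>y\<close>, i.e. its differences in \<open>y\<close>,
  the derivatives tangent to the simplex, are unique.\<close>

definition C1_with_derivs ::
    "nat \<Rightarrow> real \<Rightarrow> (real \<Rightarrow> (torus \<Rightarrow> real) \<Rightarrow> real) \<Rightarrow> (real \<Rightarrow> (torus \<Rightarrow> real) \<Rightarrow> real) \<Rightarrow>
     (real \<Rightarrow> (torus \<Rightarrow> real) \<Rightarrow> torus \<Rightarrow> real) \<Rightarrow> bool"
  where "C1_with_derivs n T F Ft Fm \<longleftrightarrow>
    (\<forall>t\<in>{0..T}. \<forall>m\<in>grid_prob n. \<forall>\<epsilon>>0. \<exists>\<delta>>0. \<forall>t'\<in>{0..T}. \<forall>m'\<in>grid_prob n.
       dist_tm n (t, m) (t', m') < \<delta> \<longrightarrow>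
       \<bar>F t' m' - F t m - Ft t m * (t' - t) - (\<Sum>y\<in>grid n. Fm t m y * (m' y - m y))\<bar>
         \<le> \<epsilon> * dist_tm n (t, m) (t', m')) \<and>
    continuous_wrt (dist_tm n) ({0..T} \<times> grid_prob n) (\<lambda>(t, m). Ft t m) \<and>
    (\<forall>y\<in>grid n. continuous_wrt (dist_tm n) ({0..T} \<times> grid_prob n) (\<lambda>(t, m). Fm t m y))"

definition control_up ::
    "nat \<Rightarrow> (torus \<Rightarrow> real \<Rightarrow> real) \<Rightarrow> grid_value_fun \<Rightarrow> real \<Rightarrow> torus \<Rightarrow> (torus \<Rightarrow> real) \<Rightarrow> real"
  where "control_up n L u t y m = - ddp (ham_up L) y (diff_fwd n (\<lambda>z. u t z m) y)"

definition control_down ::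
    "nat \<Rightarrow> (torus \<Rightarrow> real \<Rightarrow> real) \<Rightarrow> grid_value_fun \<Rightarrow> real \<Rightarrow> torus \<Rightarrow> (torus \<Rightarrow> real) \<Rightarrow> real"
  where "control_down n L u t y m = ddp (ham_down L) y (- diff_bwd n (\<lambda>z. u t z m) y)"

definition discrete_master_classical_solution ::
    "nat \<Rightarrow> real \<Rightarrow> real \<Rightarrow> (torus \<Rightarrow> real \<Rightarrow> real) \<Rightarrow> (torus measure \<Rightarrow> torus \<Rightarrow> real) \<Rightarrow>
     (torus measure \<Rightarrow> torus \<Rightarrow> real) \<Rightarrow> grid_value_fun \<Rightarrow> bool"
  where "discrete_master_classical_solution n \<sigma> T L f g u \<longleftrightarrow> (\<exists>u_t u_m.
    (\<forall>x\<in>grid n. C1_with_derivs n T (\<lambda>t m. u t x m) (\<lambda>t m. u_t t x m) (\<lambda>t m. u_m t x m)) \<and>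
    (\<forall>t\<in>{0..T}. \<forall>x\<in>grid n. \<forall>m\<in>grid_prob n.
       - u_t t x m
       + ham_up L x (diff_fwd n (\<lambda>z. u t z m) x)
       + ham_down L x (- diff_bwd n (\<lambda>z. u t z m) x)
       - \<sigma> * diff_snd n (\<lambda>z. u t z m) x
       - f (grid_measure n m) x
       - (\<Sum>y\<in>grid n. m y * (control_up n L u t y m / mesh n + \<sigma> / (mesh n)\<^sup>2) *
            (u_m t x m (y + to_torus (mesh n)) - u_m t x m y))
       - (\<Sum>y\<in>grid n. m y * (control_down n L u t y m / mesh n + \<sigma> / (mesh n)\<^sup>2) *
            (u_m t x m (y - to_torus (mesh n)) - u_m t x m y))
       = 0) \<and>
    (\<forall>x\<in>grid n. \<forall>m\<in>grid_prob n. u T x m = g (grid_measure n m) x))"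

definition restrict_to_grid :: "nat \<Rightarrow> value_fun \<Rightarrow> grid_value_fun"
  where "restrict_to_grid n U t x m = U t x (grid_measure n m)"


section \<open>The optimal process\<close>

text \<open>A continuous-time Markov chain on \<open>[0,T]\<close> with finite state space \<open>S\<close> and time-dependent
  jump rates \<open>q t x y\<close>: right-continuous paths with left limits, and the Markov property with the
  transition function \<open>p s t x y\<close> which solves the Kolmogorov forward equation. The diagonal
  \<open>q t x x\<close> cancels in that equation and may be arbitrary.\<close>

definition markov_jump_process ::
    "'w measure \<Rightarrow> (real \<Rightarrow> 'w \<Rightarrow> 's) \<Rightarrow> real \<Rightarrow> 's set \<Rightarrow> (real \<Rightarrow> 's \<Rightarrow> 's \<Rightarrow> real) \<Rightarrow> bool"
  where "markov_jump_process \<Omega> X T S q \<longleftrightarrow>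
    prob_space \<Omega> \<and>
    (\<forall>t\<in>{0..T}. X t \<in> measurable \<Omega> (count_space S)) \<and>
    (\<forall>w\<in>space \<Omega>. \<forall>t\<in>{0..<T}. eventually (\<lambda>s. X s w = X t w) (at_right t)) \<and>
    (\<forall>w\<in>space \<Omega>. \<forall>t\<in>{0<..T}. \<exists>x. eventually (\<lambda>s. X s w = x) (at_left t)) \<and>
    (\<exists>p :: real \<Rightarrow> real \<Rightarrow> 's \<Rightarrow> 's \<Rightarrow> real.
       (\<forall>s\<in>{0..T}. \<forall>x\<in>S. \<forall>y\<in>S.
          p s s x y = (if x = y then 1 else 0) \<and>
          (\<forall>t\<in>{s..T}. ((\<lambda>t. p s t x y) has_real_derivative
             (\<Sum>z\<in>S. p s t x z * q t z y) - p s t x y * (\<Sum>z\<in>S. q t y z)) (at t within {s..T}))) \<and>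
       (\<forall>k. \<forall>\<tau> :: nat \<Rightarrow> real. \<forall>\<xi> :: nat \<Rightarrow> 's. \<forall>t y.
          (\<forall>i<k. \<tau> i \<le> \<tau> (Suc i)) \<and> 0 \<le> \<tau> 0 \<and> \<tau> k \<le> t \<and> t \<le> T \<and> (\<forall>i\<le>k. \<xi> i \<in> S) \<and> y \<in> S \<longrightarrow>
          measure \<Omega> {w\<in>space \<Omega>. (\<forall>i\<le>k. X (\<tau> i) w = \<xi> i) \<and> X t w = y} =
          measure \<Omega> {w\<in>space \<Omega>. \<forall>i\<le>k. X (\<tau> i) w = \<xi> i} * p (\<tau> k) t (\<xi> k) y))"

definition law :: "'w measure \<Rightarrow> ('w \<Rightarrow> 's) \<Rightarrow> 's \<Rightarrow> real"
  where "law \<Omega> Y x = measure \<Omega> {w\<in>space \<Omega>. Y w = x}"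

text \<open>The two contributions are added because the two neighbours of a point coincide if \<open>n \<le> 2\<close>.\<close>

definition optimal_rate ::
    "nat \<Rightarrow> real \<Rightarrow> (torus \<Rightarrow> real \<Rightarrow> real) \<Rightarrow> grid_value_fun \<Rightarrow> (real \<Rightarrow> torus \<Rightarrow> real) \<Rightarrow>
     real \<Rightarrow> torus \<Rightarrow> torus \<Rightarrow> real"
  where "optimal_rate n \<sigma> L u \<mu> t x y =
    (if y = x + to_torus (mesh n)
     then control_up n L u t x (\<mu> t) / mesh n + \<sigma> / (mesh n)\<^sup>2 else 0) +
    (if y = x - to_torus (mesh n)
     then control_down n L u t x (\<mu> t) / mesh n + \<sigma> / (mesh n)\<^sup>2 else 0)"

definition optimal_process ::
    "nat \<Rightarrow> real \<Rightarrow> real \<Rightarrow> (torus \<Rightarrow> real \<Rightarrow> real) \<Rightarrow> grid_value_fun \<Rightarrow> (torus \<Rightarrow> real) \<Rightarrow>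
     'w measure \<Rightarrow> (real \<Rightarrow> 'w \<Rightarrow> torus) \<Rightarrow> bool"
  where "optimal_process n \<sigma> T L u \<mu>0 \<Omega> X \<longleftrightarrow>
    markov_jump_process \<Omega> X T (grid n) (optimal_rate n \<sigma> L u (\<lambda>t. law \<Omega> (X t))) \<and>
    law \<Omega> (X 0) = \<mu>0"

end

theory Submission
  imports Defs
begin

text \<open>Let \<open>w = u - V\<close>, a function of time, of a grid point and of a point of the simplex. As
  \<open>V\<close> solves the discrete master equation up to \<open>O(\<omega>(1/n))\<close>, \<open>w\<close> solves a linearised discrete
  master equation with a source of size \<open>O(\<omega>(1/n) + G(t))\<close>, \<open>G(t)\<close> being the supremum of the
  difference quotients of \<open>w\<close> at time \<open>t\<close>. The transport term in the measure variable differentiates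
  along a vector field pointing into the simplex, so it has a sign at maximum points and the maximum
  principle holds on the product of the time interval, the grid and the simplex. It is applied
  simultaneously to the barriers \<open>|w| < A \<epsilon> e\<^bsup>\<mu>(T - t)\<^esup>\<close> and, by doubling the space variable,
  \<open>|w(x + s) - w(x)| < \<epsilon> e\<^bsup>\<mu>(T - t)\<^esup> (s - Q s\<^sup>2 / 2)\<close> for small \<open>s\<close>, where \<open>\<epsilon>\<close> is slightly larger than
  \<open>\<omega>(1/n)\<close>: the concavity of the second barrier and the diffusion absorb the source. For large \<open>n\<close> the
  barriers themselves keep the gradients of \<open>u\<close> in a fixed compact set, so that the local
  Lipschitz bounds of the Hamiltonians are uniform in \<open>n\<close>. Hence the differences of \<open>w\<close> are
  \<open>O(\<omega>(1/n))\<close> pointwise, which implies the integral estimate along any process with values in the grid.\<close>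

section \<open>Calculus on the torus and on the grid\<close>

text \<open>The obstacle is that the source contains the difference quotients of \<open>w\<close>
  themselves. A barrier for |w| alone would have to bound them by 2 n sup |w|, and its exponent
  would grow with \<open>n\<close>; a barrier for increments alone would fail at large distances.
  The doubled barrier needs only the size of the source: at the two points of contact its curvature
  makes the diffusion contribute 2 \<sigma> Q, which beats the sources at both. It is used up to the
  distance 2 l only, and A = l / 8 is small enough to exclude a contact at distances between l and 2
  l. The linearisation is arranged so that the measure derivative of \<open>u\<close>, for which no
  bound uniform in \<open>n\<close> is at hand, occurs only inside the transport term: the
  differences of the jump rates multiply increments of \<open>U_m\<close>. Its gradient and that of
  \<open>U\<close> are at most \<omega> 1, because a derivative along a closed circle has mean zero.
  The number \<epsilon> lies strictly above \<omega>(1/n) since \<omega>(1/n) may vanish, while the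
  barriers must be positive at time T, where w = 0. For the finitely many small \<open>n\<close> the
  exponent growing with \<open>n\<close> does no harm.\<close>

lemma to_torus_add: "to_torus (a + b) = to_torus a + to_torus b"
  by (simp add: plus_torus.abs_eq)

lemma to_torus_minus: "to_torus (- a) = - to_torus a"
  by (simp add: uminus_torus.abs_eq)

lemma to_torus_diff: "to_torus (a - b) = to_torus a - to_torus b"
  by (simp add: minus_torus.abs_eq)

lemma to_torus_zero [simp]: "to_torus 0 = 0"
  by (simp add: zero_torus_def)

lemma to_torus_of_nat [simp]: "to_torus (real k) = 0"
  unfolding zero_torus_def torus.abs_eq_iff by simp

lemma dist_torus_shift: "dist (x + to_torus s) x \<le> \<bar>s\<bar>"
proof (induction x rule: torus.abs_induct)
  case (1 a)
  have "\<bar>s - of_int (round s)\<bar> \<le> \<bar>s - of_int 0\<bar>"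
    by (rule round_diff_minimal)
  then show ?case
    by (simp add: to_torus_add [symmetric] dist_torus.abs_eq)
qed

lemma dist_torus_le_1: "dist x (y :: torus) \<le> 1"
proof (induction x rule: torus.abs_induct)
  case (1 a)
  show ?case
  proof (induction y rule: torus.abs_induct)
    case (1 b)
    show ?case
      using of_int_round_abs_le [of "a - b"] by (simp add: dist_torus.abs_eq abs_minus_commute)
  qed
qed

lemma differentiable_torusD:
  assumes "differentiable_torus u"
  shows "((\<lambda>h. u (x + to_torus h)) has_real_derivative ddx u (x + to_torus s)) (at s)"
proof -
  have "((\<lambda>h. u (x + to_torus s + to_torus h)) has_real_derivative ddx u (x + to_torus s)) (at 0)"
    using assms by (auto simp: differentiable_torus_def)
  then have "((\<lambda>h. u (x + to_torus (h + s))) has_real_derivative ddx u (x + to_torus s)) (at 0)"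
    by (simp add: to_torus_add add_ac)
  then show ?thesis
    using DERIV_shift [of "\<lambda>h. u (x + to_torus h)" "ddx u (x + to_torus s)" 0 s] by simp
qed

lemma torus_mvt:
  assumes "differentiable_torus u" "0 < h"
  obtains s where "\<bar>s\<bar> \<le> h" "u (x + to_torus h) - u x = h * ddx u (x + to_torus s)"
proof -
  obtain z where "0 < z" "z < h"
    "u (x + to_torus h) - u (x + to_torus 0) = (h - 0) * ddx u (x + to_torus z)"
    using MVT2 [OF assms(2), of "\<lambda>s. u (x + to_torus s)" "\<lambda>s. ddx u (x + to_torus s)"]
      differentiable_torusD [OF assms(1)] by auto
  then show thesis
    using that [of z] by auto
qed

context
  fixes u :: "torus \<Rightarrow> real" and b h :: real
  assumes u: "differentiable_torus u" and h: "0 < h"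
begin

lemma fwd_difference_error:
  assumes "\<And>s. \<bar>s\<bar> \<le> h \<Longrightarrow> \<bar>ddx u (x + to_torus s) - ddx u x\<bar> \<le> b"
  shows "\<bar>(u (x + to_torus h) - u x) / h - ddx u x\<bar> \<le> b"
proof -
  obtain s where "\<bar>s\<bar> \<le> h" "u (x + to_torus h) - u x = h * ddx u (x + to_torus s)"
    using torus_mvt [OF u h] .
  then show ?thesis
    using assms h by simp
qed

lemma bwd_difference_error:
  assumes "\<And>s. \<bar>s\<bar> \<le> h \<Longrightarrow> \<bar>ddx u (x + to_torus s) - ddx u x\<bar> \<le> b"
  shows "\<bar>(u (x - to_torus h) - u x) / h + ddx u x\<bar> \<le> b"
proof -
  obtain s where s: "\<bar>s\<bar> \<le> h" "u (x - to_torus h + to_torus h) - u (x - to_torus h)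
      = h * ddx u (x - to_torus h + to_torus s)"
    using torus_mvt [OF u h] .
  \<comment> \<open>The mean value theorem is applied on [-h, 0], so that the intermediate point
    lies within \<open>h\<close> of \<open>x\<close> itself.\<close>
  obtain z where "0 < z" "z < h"
    "u (x + to_torus (- 0)) - u (x + to_torus (- h)) = h * ddx u (x + to_torus (- z))"
  proof -
    have "\<exists>z>-h. z < 0 \<and> u (x + to_torus 0) - u (x + to_torus (-h)) = (0 - (-h)) * ddx u (x + to_torus z)"
      using h differentiable_torusD [OF u] by (intro MVT2) auto
    then obtain z where "-h < z" "z < 0"
      "u (x + to_torus 0) - u (x + to_torus (-h)) = h * ddx u (x + to_torus z)" by auto
    then show ?thesis using that [of "-z"] by simp
  qed
  then have "(u (x - to_torus h) - u x) / h = - ddx u (x + to_torus (- z))" "\<bar>- z\<bar> \<le> h"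
    using h by (auto simp: to_torus_minus field_simps)
  then show ?thesis
    using assms [of "- z"] by (simp add: abs_minus_commute)
qed

text \<open>Taylor's formula of order two on both sides of \<open>x\<close>, with Lagrange
  remainders, turns the quotient into the average of two nearby values of the second derivative; its
  modulus alone then measures the error.\<close>

lemma second_difference_error:
  assumes u': "differentiable_torus (ddx u)"
    and b: "\<And>s. \<bar>s\<bar> \<le> h \<Longrightarrow> \<bar>ddx (ddx u) (x + to_torus s) - ddx (ddx u) x\<bar> \<le> b"
  shows "\<bar>(u (x + to_torus h) - 2 * u x + u (x - to_torus h)) / h\<^sup>2 - ddx (ddx u) x\<bar> \<le> b"
proof -
  \<comment> \<open>The successive derivatives along the line through \<open>x\<close>, in the form
    required by Maclaurin's formula; only orders up to 2 matter.\<close>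
  define D where "D = (\<lambda>(k :: nat) s. (if k = 0 then u else if k = 1 then ddx u else ddx (ddx u)) (x + to_torus s))"
  have D: "DERIV (D k) t :> D (Suc k) t" if "k < 2" for k t
    using that differentiable_torusD [OF u] differentiable_torusD [OF u']
    by (cases "k = 0"; cases "k = 1") (auto simp: D_def)
  have "\<exists>t>0. t < h \<and> D 0 h = (\<Sum>m<2. D m 0 / fact m * h ^ m) + D 2 t / fact 2 * h ^ 2"
    by (rule Maclaurin) (use h D in auto)
  then obtain p where p: "0 < p" "p < h" "D 0 h = D 0 0 + D 1 0 * h + D 2 p / 2 * h\<^sup>2"
    by (auto simp: numeral_2_eq_2)
  have "\<exists>t. - h < t \<and> t < 0 \<and> D 0 (- h) = (\<Sum>m<2. D m 0 / fact m * (- h) ^ m) + D 2 t / fact 2 * (- h) ^ 2"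
    by (rule Maclaurin_minus) (use h D in auto)
  then obtain q where q: "- h < q" "q < 0" "D 0 (- h) = D 0 0 - D 1 0 * h + D 2 q / 2 * h\<^sup>2"
    by (auto simp: numeral_2_eq_2)
  have "u (x + to_torus h) - 2 * u x + u (x - to_torus h) = D 0 h - 2 * D 0 0 + D 0 (- h)"
    by (simp add: D_def to_torus_minus)
  also have "\<dots> = (D 2 p + D 2 q) / 2 * h\<^sup>2"
    unfolding p(3) q(3) by (simp add: algebra_simps)
  finally have eq: "(u (x + to_torus h) - 2 * u x + u (x - to_torus h)) / h\<^sup>2 = (D 2 p + D 2 q) / 2"
    using h by simp
  have "\<bar>D 2 p - D 2 0\<bar> \<le> b" "\<bar>D 2 q - D 2 0\<bar> \<le> b"
    using b [of p] b [of q] p q by (auto simp: D_def)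
  moreover have "\<bar>(a + c) / 2 - d\<bar> \<le> b" if "\<bar>a - d\<bar> \<le> b" "\<bar>c - d\<bar> \<le> b" for a c d :: real
    using that by (simp add: abs_le_iff field_simps)
  ultimately have "\<bar>(D 2 p + D 2 q) / 2 - D 2 0\<bar> \<le> b"
    by blast
  moreover have "ddx (ddx u) x = D 2 0"
    by (simp add: D_def)
  ultimately show ?thesis
    using eq by (simp only:)
qed

end

text \<open>A full turn around the circle has increment zero, so the forward quotient with step 1
  vanishes. The oscillation of the derivative therefore bounds the derivative itself; this is the
  origin of the constant \<open>\<omega> 1\<close> below.\<close>

lemma ddx_bound:
  assumes "differentiable_torus u" "\<And>s. \<bar>s\<bar> \<le> 1 \<Longrightarrow> \<bar>ddx u (x + to_torus s) - ddx u x\<bar> \<le> b"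
  shows "\<bar>ddx u x\<bar> \<le> b"
proof -
  have "to_torus 1 = 0"
    using to_torus_of_nat [of 1] by simp
  moreover have "\<bar>(u (x + to_torus 1) - u x) / 1 - ddx u x\<bar> \<le> b"
    by (rule fwd_difference_error) (use assms in auto)
  ultimately show ?thesis
    by simp
qed

section \<open>The grid as a cyclic subgroup of the torus\<close>

lemma finite_grid [simp]: "finite (grid n)"
  by (simp add: grid_def)

lemma mesh_pos: "1 \<le> n \<Longrightarrow> 0 < mesh n"
  by (simp add: mesh_def)

text \<open>With all integer multiples of the mesh allowed, invariance under shifts is evident and
  no index has to be reduced modulo \<open>n\<close> again.\<close>

lemma grid_eq_range: 
  assumes "1 \<le> n"
  shows "grid n = range (\<lambda>j :: int. to_torus (real_of_int j * mesh n))"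
proof (intro equalityI subsetI)
  fix x assume "x \<in> grid n"
  then obtain j where "x = to_torus (real j / real n)" by (auto simp: grid_def)
  then have "x = to_torus (real_of_int (int j) * mesh n)" by (simp add: mesh_def)
  then show "x \<in> range (\<lambda>j :: int. to_torus (real_of_int j * mesh n))" by blast
next
  fix x assume "x \<in> range (\<lambda>j :: int. to_torus (real_of_int j * mesh n))"
  then obtain j :: int where x: "x = to_torus (real_of_int j * mesh n)" by blast
  \<comment> \<open>Indices in \<open>grid\<close> run from 1 to \<open>n\<close>, hence the shift
    by one before and after the reduction.\<close>
  define r where "r = (j - 1) mod int n"
  define k where "k = nat (r + 1)"
  have r: "0 \<le> r" "r < int n" using assms by (auto simp: r_def)
  have kr: "int k = r + 1" and k: "k \<in> {1..n}" using r by (auto simp: k_def)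
  have "j - 1 = int n * ((j - 1) div int n) + r" by (simp add: r_def)
  then have jk: "j = int k + int n * ((j - 1) div int n)" by (simp add: kr)
  define q where "q = (j - 1) div int n"
  have "real_of_int j = real_of_int (int k + int n * q)"
    using jk unfolding q_def by (rule arg_cong)
  then have "real_of_int j * mesh n = real k / real n + real_of_int q"
    using assms by (simp add: mesh_def distrib_right add_divide_distrib)
  then have "real_of_int j * mesh n - real k / real n \<in> \<int>"
    by simp
  then have "x = to_torus (real k / real n)"
    unfolding x by (simp add: torus.abs_eq_iff)
  then show "x \<in> grid n" using k by (auto simp: grid_def)
qed

lemma grid_shift:
  assumes "1 \<le> n" "x \<in> grid n"
  shows "x + to_torus (mesh n) \<in> grid n" "x - to_torus (mesh n) \<in> grid n"
proof -
  obtain j :: int where x: "x = to_torus (real_of_int j * mesh n)"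
    using assms by (auto simp: grid_eq_range)
  have "x + to_torus (mesh n) = to_torus (real_of_int (j + 1) * mesh n)"
    by (simp add: x distrib_right to_torus_add)
  moreover have "x - to_torus (mesh n) = to_torus (real_of_int (j - 1) * mesh n)"
    by (simp add: x left_diff_distrib to_torus_add [symmetric] minus_torus.abs_eq)
  ultimately show "x + to_torus (mesh n) \<in> grid n" "x - to_torus (mesh n) \<in> grid n"
    unfolding grid_eq_range [OF assms(1)] by blast+
qed

lemma grid_shift_nat:
  assumes "1 \<le> n" "x \<in> grid n"
  shows "x + to_torus (real d * mesh n) \<in> grid n"
proof (induction d)
  case (Suc d)
  have "x + to_torus (real (Suc d) * mesh n) = x + to_torus (real d * mesh n) + to_torus (mesh n)"
    by (simp add: distrib_right to_torus_add add_ac)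
  then show ?case by (simp only: grid_shift [OF assms(1) Suc])
qed (use assms in simp)

section \<open>Measures on the grid\<close>

text \<open>The mass common to \<open>p\<close> and \<open>q\<close> stays in place, and the surplus
  of \<open>p\<close> is spread over the deficit of \<open>q\<close> by a normalised product. Only
  the surplus moves, over a distance of at most 1.\<close>

lemma transport_plan_exists:
  fixes p q :: "'a :: metric_space \<Rightarrow> real"
  assumes A: "finite A" and p: "\<And>x. 0 \<le> p x" "sum p A = 1" and q: "\<And>x. 0 \<le> q x" "sum q A = 1"
    and dist: "\<And>x y :: 'a. dist x y \<le> 1"
  obtains c where "\<And>x y. 0 \<le> c x y"
    "\<And>x. x \<in> A \<Longrightarrow> (\<Sum>y\<in>A. c x y) = p x" "\<And>y. y \<in> A \<Longrightarrow> (\<Sum>x\<in>A. c x y) = q y"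
    "(\<Sum>x\<in>A. \<Sum>y\<in>A. c x y * dist x y) \<le> (\<Sum>x\<in>A. \<bar>p x - q x\<bar>)"
proof -
  define p' where "p' = (\<lambda>x. p x - min (p x) (q x))"
  define q' where "q' = (\<lambda>x. q x - min (p x) (q x))"
  define R where "R = sum p' A"
  have pq': "0 \<le> p' x" "0 \<le> q' x" for x
    by (auto simp: p'_def q'_def)
  have R0: "0 \<le> R"
    unfolding R_def using pq' by (intro sum_nonneg)
  have Rq: "R = sum q' A"
    by (simp add: R_def p'_def q'_def sum_subtractf p q)
  define c where "c = (\<lambda>x y. (if x = y then min (p x) (q x) else 0) + p' x * q' y / R)"
  \<comment> \<open>If \<open>R = 0\<close>, then \<open>p'\<close> and \<open>q'\<close> vanish on
    \<open>A\<close>, and division by zero yields the correct value 0.\<close>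
  have pR: "p' x * R / R = p' x" if "x \<in> A" for x
    using that sum_nonneg_eq_0_iff [OF A, of p'] pq' by (cases "R = 0") (auto simp: R_def)
  have qR: "R * q' x / R = q' x" if "x \<in> A" for x
    using that sum_nonneg_eq_0_iff [OF A, of q'] pq' by (cases "R = 0") (auto simp: Rq)
  show thesis
  proof
    show "0 \<le> c x y" for x y
      using p q pq' R0 by (simp add: c_def)
    show "(\<Sum>y\<in>A. c x y) = p x" if "x \<in> A" for x
    proof -
      have "(\<Sum>y\<in>A. c x y) = min (p x) (q x) + p' x * R / R"
        using A that unfolding Rq c_def sum.distrib sum_divide_distrib sum_distrib_left by simp
      then show ?thesis using pR [OF that] by (simp add: p'_def)
    qed
    show "(\<Sum>x\<in>A. c x y) = q y" if "y \<in> A" for y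
    proof -
      have "(\<Sum>x\<in>A. c x y) = (\<Sum>x\<in>A. if x = y then min (p y) (q y) else 0) + R * q' y / R"
        unfolding R_def c_def sum.distrib sum_divide_distrib sum_distrib_right
        by (intro arg_cong2 [where f = "(+)"] sum.cong) auto
      also have "\<dots> = min (p y) (q y) + q' y"
        using A that qR by simp
      finally show ?thesis by (simp add: q'_def)
    qed
    have "(\<Sum>x\<in>A. \<Sum>y\<in>A. c x y * dist x y) \<le> (\<Sum>x\<in>A. \<Sum>y\<in>A. p' x * q' y / R)"
    proof (intro sum_mono)
      fix x y
      have "p' x * q' y / R * dist x y \<le> p' x * q' y / R * 1"
        using pq' R0 dist by (intro mult_left_mono) auto
      then show "c x y * dist x y \<le> p' x * q' y / R"
        using pq' R0 by (simp add: c_def distrib_right)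
    qed
    also have "\<dots> = (\<Sum>x\<in>A. p' x * R / R)"
      unfolding Rq by (simp add: sum_divide_distrib sum_distrib_left)
    also have "\<dots> = (\<Sum>x\<in>A. p' x)"
      using pR by (intro sum.cong) auto
    also have "\<dots> \<le> (\<Sum>x\<in>A. \<bar>p x - q x\<bar>)"
      by (intro sum_mono) (auto simp: p'_def)
    finally show "(\<Sum>x\<in>A. \<Sum>y\<in>A. c x y * dist x y) \<le> (\<Sum>x\<in>A. \<bar>p x - q x\<bar>)" .
  qed
qed

lemma sets_grid_measure [simp]: "sets (grid_measure n m) = sets borel"
  using sets.sigma_sets_eq [of "borel :: torus measure"] by (simp add: grid_measure_def)

lemma space_grid_measure [simp]: "space (grid_measure n m) = UNIV"
  by (simp add: grid_measure_def)

text \<open>Integrals against a \<open>point_measure\<close> on a finite set are finite sums; this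
  identity carries that over to the grid measures.\<close>

lemma grid_measure_eq_distr:
  "grid_measure n m = distr (point_measure (grid n) (\<lambda>x. ennreal (m x))) borel (\<lambda>x. x)"
proof (rule measure_eqI)
  fix A assume "A \<in> sets (grid_measure n m)"
  then have A: "A \<in> sets borel" by simp
  have "emeasure (distr (point_measure (grid n) (\<lambda>x. ennreal (m x))) borel (\<lambda>x. x)) A =
    (\<Sum>x\<in>A \<inter> grid n. ennreal (m x))"
    using A by (subst emeasure_distr) (auto simp: space_point_measure emeasure_point_measure_finite)
  also have "\<dots> = (\<Sum>x\<in>grid n. ennreal (m x) * indicator A x)"
    by (auto simp: indicator_def sum.If_cases Int_commute intro!: sum.mono_neutral_cong_left)
  finally show "emeasure (grid_measure n m) A =
      emeasure (distr (point_measure (grid n) (\<lambda>x. ennreal (m x))) borel (\<lambda>x. x)) A"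
    using A by (simp add: emeasure_grid_measure)
qed simp

lemma integral_grid_measure:
  fixes g :: "torus \<Rightarrow> real"
  assumes "g \<in> borel_measurable borel" "\<And>x. 0 \<le> m x"
  shows "(\<integral>x. g x \<partial>grid_measure n m) = (\<Sum>x\<in>grid n. m x * g x)"
  unfolding grid_measure_eq_distr using assms
  by (subst integral_distr) (auto simp: lebesgue_integral_point_measure_finite)

lemma grid_measure_prob:
  assumes "m \<in> grid_prob n"
  shows "grid_measure n m \<in> prob_measures"
proof -
  have "emeasure (grid_measure n m) UNIV = ennreal (sum m (grid n))"
    using assms by (simp add: emeasure_grid_measure grid_prob_def)
  then show ?thesis
    using assms by (auto simp: prob_measures_def grid_prob_def intro!: prob_spaceI)
qed

lemma mixture_grid_measure:
  assumes "\<And>x. 0 \<le> m x" "y \<in> grid n" "0 \<le> \<theta>" "\<theta> \<le> 1"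
  shows "mixture \<theta> (grid_measure n m) (return borel y) =
    grid_measure n (\<lambda>x. (1 - \<theta>) * m x + (if x = y then \<theta> else 0))"
proof (rule measure_eqI)
  show "sets (mixture \<theta> (grid_measure n m) (return borel y)) =
    sets (grid_measure n (\<lambda>x. (1 - \<theta>) * m x + (if x = y then \<theta> else 0)))"
    using sets.sigma_sets_eq [of "borel :: torus measure"] by (simp add: mixture_def)
  fix A assume "A \<in> sets (mixture \<theta> (grid_measure n m) (return borel y))"
  then have A: "A \<in> sets borel"
    using sets.sigma_sets_eq [of "borel :: torus measure"] by (simp add: mixture_def)
  have "(\<Sum>x\<in>grid n. ennreal ((1 - \<theta>) * m x + (if x = y then \<theta> else 0)) * indicator A x) =
    (\<Sum>x\<in>grid n. ennreal (1 - \<theta>) * (ennreal (m x) * indicator A x) + (if x = y then ennreal \<theta> * indicator A y else 0))"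
    using assms by (intro sum.cong) (auto simp: ennreal_plus ennreal_mult' distrib_left distrib_right mult_ac)
  also have "\<dots> = ennreal (1 - \<theta>) * (\<Sum>x\<in>grid n. ennreal (m x) * indicator A x) + ennreal \<theta> * indicator A y"
    using assms(2) unfolding sum.distrib sum_distrib_left by simp
  finally show "emeasure (mixture \<theta> (grid_measure n m) (return borel y)) A =
    emeasure (grid_measure n (\<lambda>x. (1 - \<theta>) * m x + (if x = y then \<theta> else 0))) A"
    using A by (simp add: emeasure_mixture emeasure_grid_measure)
qed

text \<open>An infimum over the empty set would be an arbitrary real number;
  \<open>grid_coupling\<close> provides the couplings.\<close>

lemma W1_nonneg:
  assumes "couplings \<mu> \<nu> \<noteq> {}"
  shows "0 \<le> W1 \<mu> \<nu>"
  unfolding W1_def using assms by (intro cINF_greatest) auto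

lemma grid_coupling:
  assumes m: "m \<in> grid_prob n" and m': "m' \<in> grid_prob n"
  obtains \<pi> where "\<pi> \<in> couplings (grid_measure n m) (grid_measure n m')"
    "(\<integral>z. dist (fst z) (snd z) \<partial>\<pi>) \<le> (\<Sum>x\<in>grid n. \<bar>m x - m' x\<bar>)"
proof -
  obtain c where c: "\<And>x y. 0 \<le> c x y"
    "\<And>x. x \<in> grid n \<Longrightarrow> (\<Sum>y\<in>grid n. c x y) = m x" "\<And>y. y \<in> grid n \<Longrightarrow> (\<Sum>x\<in>grid n. c x y) = m' y"
    "(\<Sum>x\<in>grid n. \<Sum>y\<in>grid n. c x y * dist x y) \<le> (\<Sum>x\<in>grid n. \<bar>m x - m' x\<bar>)"
    by (rule transport_plan_exists [of "grid n" m m'])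
      (use m m' dist_torus_le_1 in \<open>auto simp: grid_prob_def\<close>)
  define P where "P = point_measure (grid n \<times> grid n) (\<lambda>z. ennreal (c (fst z) (snd z)))"
  define \<pi> where "\<pi> = distr P borel (\<lambda>z. z)"
  have fst: "fst \<in> measurable (borel :: (torus \<times> torus) measure) borel"
    and snd: "snd \<in> measurable (borel :: (torus \<times> torus) measure) borel"
    by (intro borel_measurable_continuous_onI continuous_intros)+
  have meas: "h \<in> measurable P borel" for h :: "torus \<times> torus \<Rightarrow> 'z :: topological_space"
    by (simp add: P_def)
  have P: "emeasure P X = (\<Sum>z\<in>X. ennreal (c (fst z) (snd z)))" if "X \<subseteq> grid n \<times> grid n" for X
    using that by (simp add: P_def emeasure_point_measure_finite)
  have sp: "space P = grid n \<times> grid n" by (simp add: P_def space_point_measure)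
  have pi_fst: "distr \<pi> borel fst = grid_measure n m"
  proof (rule measure_eqI)
    fix A assume "A \<in> sets (distr \<pi> borel fst)"
    then have A: "A \<in> sets borel" by simp
    have "emeasure (distr \<pi> borel fst) A = emeasure P ((A \<inter> grid n) \<times> grid n)"
      unfolding \<pi>_def using A
      by (subst distr_distr [OF fst meas], subst emeasure_distr [OF meas]) (auto simp: sp intro!: arg_cong [of _ _ "emeasure P"])
    also have "\<dots> = (\<Sum>x\<in>A \<inter> grid n. \<Sum>y\<in>grid n. ennreal (c x y))"
      by (subst P) (auto simp: sum.cartesian_product split_beta)
    also have "\<dots> = (\<Sum>x\<in>A \<inter> grid n. ennreal (m x))"
      using c by (intro sum.cong) auto
    also have "\<dots> = (\<Sum>x\<in>grid n. ennreal (m x) * indicator A x)"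
      by (auto simp: indicator_def sum.If_cases Int_commute intro!: sum.mono_neutral_cong_left)
    finally show "emeasure (distr \<pi> borel fst) A = emeasure (grid_measure n m) A"
      using A by (simp add: emeasure_grid_measure)
  qed simp
  have pi_snd: "distr \<pi> borel snd = grid_measure n m'"
  proof (rule measure_eqI)
    fix A assume "A \<in> sets (distr \<pi> borel snd)"
    then have A: "A \<in> sets borel" by simp
    have "emeasure (distr \<pi> borel snd) A = emeasure P (grid n \<times> (A \<inter> grid n))"
      unfolding \<pi>_def using A
      by (subst distr_distr [OF snd meas], subst emeasure_distr [OF meas]) (auto simp: sp intro!: arg_cong [of _ _ "emeasure P"])
    also have "\<dots> = (\<Sum>x\<in>grid n. \<Sum>y\<in>A \<inter> grid n. ennreal (c x y))"
      by (subst P) (auto simp: sum.cartesian_product split_beta)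
    also have "\<dots> = (\<Sum>y\<in>A \<inter> grid n. \<Sum>x\<in>grid n. ennreal (c x y))"
      by (rule sum.swap)
    also have "\<dots> = (\<Sum>y\<in>A \<inter> grid n. ennreal (m' y))"
      using c by (intro sum.cong) auto
    also have "\<dots> = (\<Sum>x\<in>grid n. ennreal (m' x) * indicator A x)"
      by (auto simp: indicator_def sum.If_cases Int_commute intro!: sum.mono_neutral_cong_left)
    finally show "emeasure (distr \<pi> borel snd) A = emeasure (grid_measure n m') A"
      using A by (simp add: emeasure_grid_measure)
  qed simp
  have d: "(\<lambda>z :: torus \<times> torus. dist (fst z) (snd z)) \<in> borel_measurable borel"
    by (intro borel_measurable_continuous_onI continuous_intros)
  have "(\<integral>z. dist (fst z) (snd z) \<partial>\<pi>) = (\<integral>z. dist (fst z) (snd z) \<partial>P)"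
    unfolding \<pi>_def by (rule integral_distr [OF meas d])
  also have "\<dots> = (\<Sum>x\<in>grid n. \<Sum>y\<in>grid n. c x y * dist x y)"
    unfolding P_def using c(1)
    by (subst lebesgue_integral_point_measure_finite) (auto simp: sum.cartesian_product split_beta)
  also note c(4)
  finally show thesis
    using that [of \<pi>] pi_fst pi_snd by (simp add: couplings_def \<pi>_def)
qed

text \<open>Through this bound, continuity with respect to \<open>W1\<close> becomes continuity in
  the weights. The constant is 1 because the torus has diameter at most 1.\<close>

lemma W1_grid_le:
  assumes "m \<in> grid_prob n" "m' \<in> grid_prob n"
  shows "W1 (grid_measure n m) (grid_measure n m') \<le> (\<Sum>x\<in>grid n. \<bar>m x - m' x\<bar>)"
proof -
  obtain \<pi> where \<pi>: "\<pi> \<in> couplings (grid_measure n m) (grid_measure n m')"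
    "(\<integral>z. dist (fst z) (snd z) \<partial>\<pi>) \<le> (\<Sum>x\<in>grid n. \<bar>m x - m' x\<bar>)"
    using grid_coupling [OF assms] .
  have "W1 (grid_measure n m) (grid_measure n m') \<le> (\<integral>z. dist (fst z) (snd z) \<partial>\<pi>)"
    unfolding W1_def using \<pi>(1) by (intro cINF_lower bdd_belowI2 [of _ 0]) auto
  with \<pi>(2) show ?thesis by linarith
qed

lemma W1_grid_nonneg:
  assumes "m \<in> grid_prob n" "m' \<in> grid_prob n"
  shows "0 \<le> W1 (grid_measure n m) (grid_measure n m')"
  using grid_coupling [OF assms] W1_nonneg by blast

lemma W1_grid_self:
  assumes "m \<in> grid_prob n"
  shows "W1 (grid_measure n m) (grid_measure n m) = 0"
  using W1_grid_le [OF assms assms] W1_grid_nonneg [OF assms assms] by simp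

section \<open>Hamiltonians\<close>

text \<open>The convexity modulus depends on a compact interval. Choosing the interval after
  \<open>a\<close> and \<open>b\<close> and dropping the quadratic gain leaves plain convexity on
  the whole line.\<close>

lemma convex_inequality:
  assumes "uniformly_convex_on_compacts F" "0 \<le> \<theta>" "\<theta> \<le> 1"
  shows "F x (\<theta> * a + (1 - \<theta>) * b) \<le> \<theta> * F x a + (1 - \<theta>) * F x b"
proof -
  define R where "R = max \<bar>a\<bar> \<bar>b\<bar>"
  obtain c where "c > 0" and c: "\<And>x a b \<theta>. a \<in> {-R..R} \<Longrightarrow> b \<in> {-R..R} \<Longrightarrow> \<theta> \<in> {0..1} \<Longrightarrow>
    F x (\<theta> * a + (1 - \<theta>) * b) \<le> \<theta> * F x a + (1 - \<theta>) * F x b - c / 2 * \<theta> * (1 - \<theta>) * (a - b)\<^sup>2"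
    using assms(1) unfolding uniformly_convex_on_compacts_def by metis
  have "F x (\<theta> * a + (1 - \<theta>) * b) \<le> \<theta> * F x a + (1 - \<theta>) * F x b - c / 2 * \<theta> * (1 - \<theta>) * (a - b)\<^sup>2"
    using assms by (intro c) (auto simp: R_def)
  moreover have "0 \<le> c / 2 * \<theta> * (1 - \<theta>) * (a - b)\<^sup>2"
    using \<open>c > 0\<close> assms by simp
  ultimately show ?thesis by linarith
qed

lemma C_k_DERIV:
  assumes "C_k k F" "1 \<le> k"
  shows "(F x has_real_derivative ddp F x p) (at p)"
    and "continuous_on UNIV (\<lambda>(x, p). ddp F x p)"
proof -
  obtain D :: "nat \<Rightarrow> nat \<Rightarrow> torus \<Rightarrow> real \<Rightarrow> real" where D0: "D 0 0 = F"
    and cont: "\<And>i j. i + j \<le> k \<Longrightarrow> continuous_on UNIV (\<lambda>(x, p). D i j x p)"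
    and deriv: "\<And>i j x p. i + j < k \<Longrightarrow> (D i j x has_real_derivative D i (Suc j) x p) (at p)"
    using assms(1) unfolding C_k_def by metis
  have F': "(F x has_real_derivative D 0 1 x p) (at p)" for x p
    using deriv [of 0 0 x p] D0 assms(2) by simp
  then have eq: "ddp F x p = D 0 1 x p" for x p
    unfolding ddp_def by (rule DERIV_imp_deriv)
  show "(F x has_real_derivative ddp F x p) (at p)"
    using F' by (simp add: eq)
  show "continuous_on UNIV (\<lambda>(x, p). ddp F x p)"
    using cont [of 0 1] assms(2) by (simp add: eq)
qed

context
  fixes L :: "torus \<Rightarrow> real \<Rightarrow> real"
  assumes L: "admissible_lagrangian L"
begin

lemma lagrangian_bdd_below: "bdd_below ((\<lambda>a. L x a + a * p) ` A)"
proof -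
  have "bdd_above (range (\<lambda>a. - a * p - L x a))"
    using L by (auto simp: admissible_lagrangian_def)
  then obtain B where B: "\<And>a. - a * p - L x a \<le> B"
    by (auto simp: bdd_above_def)
  have "- B \<le> L x a + a * p" for a
    using B [of a] by simp
  then show ?thesis by (intro bdd_belowI2)
qed

lemma lagrangian_bdd_below':
  "bdd_below ((\<lambda>a. L x (- a) - a * p) ` A)"
proof -
  have "(\<lambda>a. L x (- a) - a * p) ` A = (\<lambda>a. L x a + a * p) ` (uminus ` A)"
    by (simp add: image_image)
  then show ?thesis by (simp only: lagrangian_bdd_below)
qed

text \<open>Among the best costs over \<open>\<alpha> \<ge> 0\<close> and over \<open>\<alpha> \<le> 0\<close>, convexity forces the larger one to be
  attained at \<open>\<alpha> = 0\<close>.\<close>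

lemma hamiltonian_split: "hamiltonian L x p = ham_up L x p + ham_down L x p"
proof -
  define \<psi> where "\<psi> = (\<lambda>a. L x a + a * p)"
  define I where "I = (INF a\<in>{0..}. \<psi> a)"
  define J where "J = (INF a\<in>{0..}. \<psi> (- a))"
  have bI: "bdd_below (\<psi> ` A)" for A
    unfolding \<psi>_def by (rule lagrangian_bdd_below)
  have bJ: "bdd_below ((\<lambda>a. \<psi> (- a)) ` A)" for A
    using bI [of "uminus ` A"] by (simp add: image_image)
  have I: "I \<le> \<psi> a" if "0 \<le> a" for a
    unfolding I_def using that by (intro cINF_lower bI) auto
  have J: "J \<le> \<psi> a" if "a \<le> 0" for a
    unfolding J_def using that cINF_lower [OF bJ [of "{0..}"], of "- a"] by auto
  have conv: "\<psi> (\<theta> * a + (1 - \<theta>) * b) \<le> \<theta> * \<psi> a + (1 - \<theta>) * \<psi> b" if "0 \<le> \<theta>" "\<theta> \<le> 1" for \<theta> a b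
    using convex_inequality [of L \<theta> x a b] that L
    by (simp add: \<psi>_def admissible_lagrangian_def algebra_simps)
  have max: "I = \<psi> 0 \<or> J = \<psi> 0"
  proof (rule ccontr)
    assume "\<not> ?thesis"
    then have "I < \<psi> 0" "J < \<psi> 0" using I [of 0] J [of 0] by auto
    then obtain a b where ab: "0 \<le> a" "\<psi> a < \<psi> 0" "0 \<le> b" "\<psi> (- b) < \<psi> 0"
      unfolding I_def J_def using cINF_less_iff [OF _ bI, of "{0..}"] cINF_less_iff [OF _ bJ, of "{0..}"]
      by auto
    then have pos: "0 < a" "0 < b" by (auto simp: order_le_less)
    \<comment> \<open>The weight for which 0 is the convex combination of \<open>a\<close> and
      \<open>- b\<close>.\<close>
    define \<theta> where "\<theta> = b / (a + b)"
    have \<theta>: "0 < \<theta>" "\<theta> < 1" using pos by (auto simp: \<theta>_def field_simps)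
    have "\<theta> * a + (1 - \<theta>) * (- b) = 0"
      using pos by (simp add: \<theta>_def field_simps)
    then have "\<psi> 0 \<le> \<theta> * \<psi> a + (1 - \<theta>) * \<psi> (- b)"
      using conv [of \<theta> a "- b"] \<theta> by simp
    also have "\<dots> < \<theta> * \<psi> 0 + (1 - \<theta>) * \<psi> 0"
      using ab \<theta> by (intro add_strict_mono mult_strict_left_mono) auto
    finally show False by (simp add: algebra_simps)
  qed
  have "hamiltonian L x p = (SUP a. - \<psi> a)"
    unfolding hamiltonian_def \<psi>_def by (intro SUP_cong) auto
  also have "\<dots> = - min I J"
  proof (intro antisym)
    show "(SUP a. - \<psi> a) \<le> - min I J"
    proof (rule cSUP_least)
      show "- \<psi> a \<le> - min I J" for a
        using I [of a] J [of a] by (cases "0 \<le> a") auto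
    qed simp
    have "bdd_above (range (\<lambda>a. - \<psi> a))"
      using bI [of UNIV] by (auto simp: bdd_above_def bdd_below_def) (metis neg_le_iff_le)
    then have "- \<psi> a \<le> (SUP a. - \<psi> a)" for a
      by (intro cSUP_upper) auto
    then have "- (SUP a. - \<psi> a) \<le> \<psi> a" for a
      by (metis minus_le_iff)
    then have "- (SUP a. - \<psi> a) \<le> I" "- (SUP a. - \<psi> a) \<le> J"
      unfolding I_def J_def by (intro cINF_greatest; auto)+
    then show "- min I J \<le> (SUP a. - \<psi> a)" by linarith
  qed
  \<comment> \<open>One of \<open>I\<close>, \<open>J\<close> equals \<open>\<psi> 0\<close> and the
    other is at most \<open>\<psi> 0\<close>; the spare \<open>\<psi> 0\<close> is the term
    \<open>L x 0\<close> in \<open>ham_down\<close>.\<close>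
  also have "\<dots> = - I - J + \<psi> 0"
    using max I [of 0] J [of 0] by (auto simp: min_def)
  finally show ?thesis
    by (simp add: ham_up_def ham_down_def I_def J_def \<psi>_def)
qed

text \<open>For nonnegative \<alpha> every competitor \<open>L x \<alpha> + \<alpha> * p\<close> is
  nondecreasing in \<open>p\<close>. Together with its counterpart for \<open>ham_down\<close> this
  makes the scheme monotone and its jump rates nonnegative.\<close>

lemma ham_up_antimono: "p \<le> q \<Longrightarrow> ham_up L x q \<le> ham_up L x p"
  unfolding ham_up_def using lagrangian_bdd_below
  by (auto intro!: cINF_mono bexI add_left_mono mult_left_mono)

lemma ham_down_mono: "p \<le> q \<Longrightarrow> ham_down L x p \<le> ham_down L x q"
  unfolding ham_down_def using lagrangian_bdd_below'
  by (auto intro!: cINF_mono bexI diff_left_mono mult_left_mono)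

lemma DERIV_ham_up: "(ham_up L x has_real_derivative ddp (ham_up L) x p) (at p)"
  using L by (intro C_k_DERIV [of 1]) (auto simp: admissible_lagrangian_def)

lemma DERIV_ham_down: "(ham_down L x has_real_derivative ddp (ham_down L) x p) (at p)"
  using L by (intro C_k_DERIV [of 1]) (auto simp: admissible_lagrangian_def)

text \<open>The net drift of the two one-sided controls is thus minus the derivative of the full
  Hamiltonian, which is what the consistency of the transport terms rests on.\<close>

lemma ddp_hamiltonian_split: "ddp (hamiltonian L) x p = ddp (ham_up L) x p + ddp (ham_down L) x p"
proof -
  have "hamiltonian L x = (\<lambda>p. ham_up L x p + ham_down L x p)"
    using hamiltonian_split by blast
  then show ?thesis
    unfolding ddp_def [of "hamiltonian L"]
    using DERIV_add [OF DERIV_ham_up DERIV_ham_down] by (metis DERIV_imp_deriv)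
qed

lemma ddp_ham_up_nonpos: "ddp (ham_up L) x p \<le> 0"
proof -
  have "mono (\<lambda>p. - ham_up L x p)"
    using ham_up_antimono by (auto intro!: monoI)
  then have "0 \<le> - ddp (ham_up L) x p"
    by (rule mono_on_imp_deriv_nonneg [OF _ DERIV_minus [OF DERIV_ham_up]]) simp
  then show ?thesis by simp
qed

lemma ddp_ham_down_nonneg: "0 \<le> ddp (ham_down L) x p"
proof -
  have "mono (ham_down L x)"
    using ham_down_mono by (auto intro!: monoI)
  then show ?thesis
    by (rule mono_on_imp_deriv_nonneg [OF _ DERIV_ham_down]) simp
qed

lemma continuous_ddp_hamiltonian: "continuous_on UNIV (\<lambda>(x, p). ddp (hamiltonian L) x p)"
  using L by (intro C_k_DERIV [of 2]) (auto simp: admissible_lagrangian_def)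

lemma ham_lipschitz:
  obtains K where "0 \<le> K"
    "\<And>x p q. \<bar>p\<bar> \<le> R \<Longrightarrow> \<bar>q\<bar> \<le> R \<Longrightarrow> \<bar>ham_up L x p - ham_up L x q\<bar> \<le> K * \<bar>p - q\<bar>"
    "\<And>x p q. \<bar>p\<bar> \<le> R \<Longrightarrow> \<bar>q\<bar> \<le> R \<Longrightarrow> \<bar>ham_down L x p - ham_down L x q\<bar> \<le> K * \<bar>p - q\<bar>"
    "\<And>x p q. \<bar>p\<bar> \<le> R \<Longrightarrow> \<bar>q\<bar> \<le> R \<Longrightarrow> \<bar>ddp (ham_up L) x p - ddp (ham_up L) x q\<bar> \<le> K * \<bar>p - q\<bar>"
    "\<And>x p q. \<bar>p\<bar> \<le> R \<Longrightarrow> \<bar>q\<bar> \<le> R \<Longrightarrow> \<bar>ddp (ham_down L) x p - ddp (ham_down L) x q\<bar> \<le> K * \<bar>p - q\<bar>"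
proof -
  have *: "\<exists>K\<ge>0. \<forall>x p q. \<bar>p\<bar> \<le> R \<longrightarrow> \<bar>q\<bar> \<le> R \<longrightarrow> \<bar>F x p - F x q\<bar> \<le> K * \<bar>p - q\<bar>"
    if "locally_lipschitz F" for F
  proof -
    obtain K where K: "lipschitz_on K (UNIV \<times> {-R..R}) (\<lambda>(x, p). F x p)"
      using \<open>locally_lipschitz F\<close> by (auto simp: locally_lipschitz_def)
    have "\<bar>F x p - F x q\<bar> \<le> K * \<bar>p - q\<bar>" if "\<bar>p\<bar> \<le> R" "\<bar>q\<bar> \<le> R" for x p q
      using lipschitz_onD [OF K, of "(x, p)" "(x, q)"] that
      by (auto simp: dist_Pair_Pair dist_real_def abs_le_iff)
    then show ?thesis using lipschitz_on_nonneg [OF K] by blast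
  qed
  have lip: "locally_lipschitz (ham_up L)" "locally_lipschitz (ham_down L)"
    "locally_lipschitz (ddp (ham_up L))" "locally_lipschitz (ddp (ham_down L))"
    using L by (auto simp: admissible_lagrangian_def)
  obtain K1 where K1: "0 \<le> K1" "\<And>x p q. \<bar>p\<bar> \<le> R \<Longrightarrow> \<bar>q\<bar> \<le> R \<Longrightarrow> \<bar>ham_up L x p - ham_up L x q\<bar> \<le> K1 * \<bar>p - q\<bar>"
    using * [OF lip(1)] by blast
  obtain K2 where K2: "0 \<le> K2" "\<And>x p q. \<bar>p\<bar> \<le> R \<Longrightarrow> \<bar>q\<bar> \<le> R \<Longrightarrow> \<bar>ham_down L x p - ham_down L x q\<bar> \<le> K2 * \<bar>p - q\<bar>"
    using * [OF lip(2)] by blast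
  obtain K3 where K3: "0 \<le> K3" "\<And>x p q. \<bar>p\<bar> \<le> R \<Longrightarrow> \<bar>q\<bar> \<le> R \<Longrightarrow> \<bar>ddp (ham_up L) x p - ddp (ham_up L) x q\<bar> \<le> K3 * \<bar>p - q\<bar>"
    using * [OF lip(3)] by blast
  obtain K4 where K4: "0 \<le> K4" "\<And>x p q. \<bar>p\<bar> \<le> R \<Longrightarrow> \<bar>q\<bar> \<le> R \<Longrightarrow> \<bar>ddp (ham_down L) x p - ddp (ham_down L) x q\<bar> \<le> K4 * \<bar>p - q\<bar>"
    using * [OF lip(4)] by blast
  have le: "a \<le> (K1 + K2 + K3 + K4) * \<bar>p - q\<bar>" if "a \<le> k * \<bar>p - q\<bar>" "k \<le> K1 + K2 + K3 + K4" for a k p q :: real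
    by (rule order_trans [OF that(1) mult_right_mono [OF that(2)]]) simp
  show thesis
  proof (rule that [of "K1 + K2 + K3 + K4"])
    show "0 \<le> K1 + K2 + K3 + K4"
      using K1(1) K2(1) K3(1) K4(1) by simp
  next
    fix x p q assume pq: "\<bar>p\<bar> \<le> R" "\<bar>q\<bar> \<le> R"
    show "\<bar>ham_up L x p - ham_up L x q\<bar> \<le> (K1 + K2 + K3 + K4) * \<bar>p - q\<bar>"
      by (rule le [OF K1(2) [OF pq]]) (use K2(1) K3(1) K4(1) in simp)
    show "\<bar>ham_down L x p - ham_down L x q\<bar> \<le> (K1 + K2 + K3 + K4) * \<bar>p - q\<bar>"
      by (rule le [OF K2(2) [OF pq]]) (use K1(1) K3(1) K4(1) in simp)
    show "\<bar>ddp (ham_up L) x p - ddp (ham_up L) x q\<bar> \<le> (K1 + K2 + K3 + K4) * \<bar>p - q\<bar>"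
      by (rule le [OF K3(2) [OF pq]]) (use K1(1) K2(1) K4(1) in simp)
    show "\<bar>ddp (ham_down L) x p - ddp (ham_down L) x q\<bar> \<le> (K1 + K2 + K3 + K4) * \<bar>p - q\<bar>"
      by (rule le [OF K4(2) [OF pq]]) (use K1(1) K2(1) K3(1) in simp)
  qed
qed

end

section \<open>Directional derivatives on the simplex\<close>

text \<open>Flat derivatives yield derivatives from the right only, so the usual mean value theorem
  is not applicable. For a slope \<open>k > K\<close> the last point at which \<open>\<phi>\<close>
  lies below the line of slope \<open>k\<close> through its initial value must be \<open>b\<close>,
  because a right derivative below \<open>k\<close> always allows a further step.\<close>

lemma right_derivative_upper_bound:
  fixes \<phi> :: "real \<Rightarrow> real"
  assumes b: "0 \<le> b" and cont: "continuous_on {0..b} \<phi>"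
    and D: "\<And>s. 0 \<le> s \<Longrightarrow> s < b \<Longrightarrow> ((\<lambda>h. (\<phi> (s + h) - \<phi> s) / h) \<longlongrightarrow> D s) (at_right 0)"
    and K: "\<And>s. 0 \<le> s \<Longrightarrow> s < b \<Longrightarrow> D s \<le> K"
  shows "\<phi> b - \<phi> 0 \<le> K * b"
proof (rule field_le_epsilon)
  fix e :: real assume e: "0 < e"
  \<comment> \<open>The excess over \<open>K\<close> costs e b / (b + 1), hence at most
    \<open>e\<close>, over the whole interval.\<close>
  define k where "k = K + e / (b + 1)"
  have kK: "K < k" using e b by (simp add: k_def)
  define Z where "Z = {s \<in> {0..b}. \<phi> s - k * s \<le> \<phi> 0}"
  have "closedin (top_of_set {0..b}) ({0..b} \<inter> (\<lambda>s. \<phi> s - k * s) -` {..\<phi> 0})"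
    by (intro continuous_closedin_preimage continuous_intros cont closed_atMost)
  moreover have "{0..b} \<inter> (\<lambda>s. \<phi> s - k * s) -` {..\<phi> 0} = Z"
    by (auto simp: Z_def)
  ultimately have "compact Z"
    using closedin_compact [of "{0..b}" Z] by simp
  moreover have "0 \<in> Z" using b by (simp add: Z_def)
  ultimately obtain s where s: "s \<in> Z" and max: "\<And>r. r \<in> Z \<Longrightarrow> r \<le> s"
    using compact_attains_sup [of Z] by blast
  have "s = b"
  proof (rule ccontr)
    assume "s \<noteq> b"
    with s have sb: "0 \<le> s" "s < b" by (auto simp: Z_def)
    have "eventually (\<lambda>h. (\<phi> (s + h) - \<phi> s) / h < k) (at_right 0)"
      using order_tendstoD(2) [OF D [OF sb]] K [OF sb] kK by auto
    moreover have "eventually (\<lambda>h. h \<in> {0<..<b - s}) (at_right 0)"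
      using sb by (intro eventually_at_right_real) auto
    ultimately have "eventually (\<lambda>h. 0 < h \<and> h < b - s \<and> (\<phi> (s + h) - \<phi> s) / h < k) (at_right 0)"
      by eventually_elim auto
    then obtain h where h: "0 < h" "h < b - s" "(\<phi> (s + h) - \<phi> s) / h < k"
      using eventually_happens' [of "at_right (0 :: real)"] by auto
    then have "\<phi> (s + h) - \<phi> s < k * h" by (simp add: pos_divide_less_eq)
    then have "s + h \<in> Z" using s h sb by (auto simp: Z_def distrib_left)
    then show False using max [of "s + h"] h by simp
  qed
  then have "\<phi> b - \<phi> 0 \<le> k * b" using s by (simp add: Z_def)
  also have "\<dots> = K * b + e * (b / (b + 1))" by (simp add: k_def distrib_right)
  also have "\<dots> \<le> K * b + e"
    using e b by (intro add_left_mono mult_left_le) auto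
  finally show "\<phi> b - \<phi> 0 \<le> K * b + e" .
qed

lemma right_derivative_bound:
  fixes \<phi> :: "real \<Rightarrow> real"
  assumes b: "0 \<le> b" and cont: "continuous_on {0..b} \<phi>"
    and D: "\<And>s. 0 \<le> s \<Longrightarrow> s < b \<Longrightarrow> ((\<lambda>h. (\<phi> (s + h) - \<phi> s) / h) \<longlongrightarrow> D s) (at_right 0)"
    and K: "\<And>s. 0 \<le> s \<Longrightarrow> s < b \<Longrightarrow> \<bar>D s - c\<bar> \<le> e"
  shows "\<bar>\<phi> b - \<phi> 0 - c * b\<bar> \<le> e * b"
proof -
  have "\<phi> b - \<phi> 0 \<le> (c + e) * b"
    by (rule right_derivative_upper_bound [OF b cont D]) (use K in \<open>auto simp: abs_le_iff algebra_simps\<close>)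
  moreover have "(- \<phi> b) - (- \<phi> 0) \<le> (e - c) * b"
  proof (rule right_derivative_upper_bound [OF b, where D = "\<lambda>s. - D s"])
    show "((\<lambda>h. (- \<phi> (s + h) - - \<phi> s) / h) \<longlongrightarrow> - D s) (at_right 0)" if "0 \<le> s" "s < b" for s
      using tendsto_minus [OF D [OF that]] by (simp add: minus_divide_left)
  qed (use K in \<open>auto simp: abs_le_iff algebra_simps intro!: continuous_intros cont\<close>)
  ultimately show ?thesis by (simp add: abs_le_iff algebra_simps)
qed

section \<open>Paths in the simplex: mixtures with a Dirac mass and transfers of mass\<close>

definition mix_weights :: "('a \<Rightarrow> real) \<Rightarrow> 'a \<Rightarrow> real \<Rightarrow> 'a \<Rightarrow> real"
  where "mix_weights m y \<theta> = (\<lambda>x. (1 - \<theta>) * m x + (if x = y then \<theta> else 0))"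

text \<open>These are the moves tangent to the simplex that occur in the discrete equation; they
  stay inside the simplex as long as \<open>\<theta> \<le> m y\<close>.\<close>

definition transfer_mass :: "('a \<Rightarrow> real) \<Rightarrow> 'a \<Rightarrow> 'a \<Rightarrow> real \<Rightarrow> 'a \<Rightarrow> real"
  where "transfer_mass m y z \<theta> = (\<lambda>x. m x + (if x = z then \<theta> else 0) - (if x = y then \<theta> else 0))"

definition weight_dist :: "nat \<Rightarrow> (torus \<Rightarrow> real) \<Rightarrow> (torus \<Rightarrow> real) \<Rightarrow> real"
  where "weight_dist n m m' = (\<Sum>y\<in>grid n. \<bar>m y - m' y\<bar>)"

lemma mix_weights_grid_prob:
  assumes "m \<in> grid_prob n" "y \<in> grid n" "0 \<le> \<theta>" "\<theta> \<le> 1"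
  shows "mix_weights m y \<theta> \<in> grid_prob n"
  using assms by (auto simp: grid_prob_def mix_weights_def sum.distrib simp flip: sum_distrib_left)

lemma transfer_mass_grid_prob:
  assumes "m \<in> grid_prob n" "y \<in> grid n" "z \<in> grid n" "0 \<le> \<theta>" "\<theta> \<le> m y"
  shows "transfer_mass m y z \<theta> \<in> grid_prob n"
  using assms by (auto simp: grid_prob_def transfer_mass_def sum.distrib sum_subtractf)

lemma weight_dist_mix:
  assumes "m \<in> grid_prob n" "y \<in> grid n" "0 \<le> \<theta>"
  shows "weight_dist n m (mix_weights m y \<theta>) \<le> 2 * \<theta>"
proof -
  have "weight_dist n m (mix_weights m y \<theta>) \<le> (\<Sum>x\<in>grid n. \<theta> * m x + (if x = y then \<theta> else 0))"
    unfolding weight_dist_def using assms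
    by (intro sum_mono) (auto simp: mix_weights_def grid_prob_def algebra_simps abs_le_iff)
  also have "\<dots> = 2 * \<theta>"
    using assms by (simp add: sum.distrib grid_prob_def flip: sum_distrib_left)
  finally show ?thesis .
qed

lemma weight_dist_transfer:
  assumes "y \<in> grid n" "z \<in> grid n" "0 \<le> \<theta>"
  shows "weight_dist n m (transfer_mass m y z \<theta>) \<le> 2 * \<theta>"
proof -
  have "weight_dist n m (transfer_mass m y z \<theta>) \<le>
      (\<Sum>x\<in>grid n. (if x = z then \<theta> else 0) + (if x = y then \<theta> else 0))"
    unfolding weight_dist_def using assms
    by (intro sum_mono) (auto simp: transfer_mass_def)
  also have "\<dots> = 2 * \<theta>"
    using assms by (simp add: sum.distrib)
  finally show ?thesis .
qed

lemma weight_dist_triangle: "weight_dist n m m'' \<le> weight_dist n m m' + weight_dist n m' m''"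
  unfolding weight_dist_def sum.distrib [symmetric] by (intro sum_mono) auto

text \<open>With k = h / (1 - s) the parameter advances from s to s + h. This reparametrisation is
  the origin of the factor 1 / (1 - s) in the derivative along a path of mixtures.\<close>

lemma mix_weights_mix:
  "mix_weights (mix_weights m y s) y k = mix_weights m y (s + k * (1 - s))"
  by (auto simp: mix_weights_def algebra_simps)

text \<open>Both sides are (m + \<theta> e_z) / (1 + \<theta>), since the mass \<theta> given back
  to \<open>y\<close> cancels the mass taken away.\<close>

lemma mix_transfer:
  assumes "0 < \<theta>"
  shows "mix_weights (transfer_mass m y z \<theta>) y (\<theta> / (1 + \<theta>)) = mix_weights m z (\<theta> / (1 + \<theta>))"
proof
  fix x
  have "1 - \<theta> / (1 + \<theta>) = 1 / (1 + \<theta>)" using assms by (simp add: field_simps)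
  then show "mix_weights (transfer_mass m y z \<theta>) y (\<theta> / (1 + \<theta>)) x = mix_weights m z (\<theta> / (1 + \<theta>)) x"
    by (simp add: mix_weights_def transfer_mass_def add_divide_distrib diff_divide_distrib)
qed

lemma filterlim_at_right_0I:
  fixes q :: "'a \<Rightarrow> real"
  assumes "(q \<longlongrightarrow> 0) F" "eventually (\<lambda>x. 0 < q x) F"
  shows "filterlim q (at_right 0) F"
  using assms by (auto simp: filterlim_at elim: eventually_mono)

lemma mix_weights_continuous:
  assumes F: "continuous_wrt (weight_dist n) (grid_prob n) F"
    and m: "m \<in> grid_prob n" and y: "y \<in> grid n" and b: "b < 1"
  shows "continuous_on {0..b} (\<lambda>s. F (mix_weights m y s))"
  unfolding continuous_on_iff
proof (intro ballI allI impI)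
  fix s e :: real assume s: "s \<in> {0..b}" and e: "0 < e"
  have ms: "mix_weights m y s \<in> grid_prob n"
    using s b by (intro mix_weights_grid_prob m y) auto
  obtain d where d: "0 < d" "\<And>m'. m' \<in> grid_prob n \<Longrightarrow> weight_dist n (mix_weights m y s) m' < d \<Longrightarrow>
      \<bar>F (mix_weights m y s) - F m'\<bar> < e"
    using F ms e unfolding continuous_wrt_def by blast
  have "weight_dist n (mix_weights m y s) (mix_weights m y r) \<le> 2 * \<bar>s - r\<bar>" for r
  proof -
    have "weight_dist n (mix_weights m y s) (mix_weights m y r) \<le>
      (\<Sum>x\<in>grid n. \<bar>s - r\<bar> * m x + (if x = y then \<bar>s - r\<bar> else 0))"
      unfolding weight_dist_def
    proof (intro sum_mono)
      fix x
      have "mix_weights m y s x - mix_weights m y r x = - ((s - r) * m x) + (if x = y then s - r else 0)"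
        by (simp add: mix_weights_def algebra_simps)
      also have "\<bar>\<dots>\<bar> \<le> \<bar>(s - r) * m x\<bar> + \<bar>if x = y then s - r else 0\<bar>"
        by linarith
      also have "\<dots> = \<bar>s - r\<bar> * m x + (if x = y then \<bar>s - r\<bar> else 0)"
        using m by (auto simp: abs_mult grid_prob_def)
      finally show "\<bar>mix_weights m y s x - mix_weights m y r x\<bar> \<le> \<bar>s - r\<bar> * m x + (if x = y then \<bar>s - r\<bar> else 0)" .
    qed
    also have "\<dots> = 2 * \<bar>s - r\<bar>"
      using m y by (simp add: sum.distrib grid_prob_def flip: sum_distrib_left)
    finally show ?thesis .
  qed
  note wd = this
  show "\<exists>d>0. \<forall>r\<in>{0..b}. dist r s < d \<longrightarrow> dist (F (mix_weights m y r)) (F (mix_weights m y s)) < e"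
  proof (intro exI [of _ "d / 2"] conjI ballI impI)
    fix r assume r: "r \<in> {0..b}" "dist r s < d / 2"
    have "mix_weights m y r \<in> grid_prob n"
      using r b by (intro mix_weights_grid_prob m y) auto
    moreover have "weight_dist n (mix_weights m y s) (mix_weights m y r) < d"
    proof -
      have "2 * \<bar>s - r\<bar> < d"
        using r(2) by (simp add: dist_real_def abs_minus_commute)
      with wd [of r] show ?thesis by linarith
    qed
    ultimately have "\<bar>F (mix_weights m y s) - F (mix_weights m y r)\<bar> < e"
      by (rule d(2))
    then show "dist (F (mix_weights m y r)) (F (mix_weights m y s)) < e"
      by (simp add: dist_real_def abs_minus_commute)
  qed (use d(1) in simp)
qed

text \<open>Both \<open>m\<close> and its perturbation \<open>m + \<theta> (e\<^sub>z - e\<^sub>y)\<close> are joined by a mixture with a Dirac mass to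
  the normalisation of \<open>m + \<theta> e\<^sub>z\<close>; this turns the one-sided flat derivative into a derivative
  along transfers of mass.\<close>

lemma transfer_derivative:
  fixes F :: "(torus \<Rightarrow> real) \<Rightarrow> real" and D :: "(torus \<Rightarrow> real) \<Rightarrow> torus \<Rightarrow> real"
  assumes F: "continuous_wrt (weight_dist n) (grid_prob n) F"
    and flat: "\<And>m y. m \<in> grid_prob n \<Longrightarrow> y \<in> grid n \<Longrightarrow>
      ((\<lambda>\<theta>. (F (mix_weights m y \<theta>) - F m) / \<theta>) \<longlongrightarrow> D m y) (at_right 0)"
    and D: "continuous_wrt (weight_dist n) (grid_prob n) (\<lambda>m. D m y)"
    and m: "m \<in> grid_prob n" and y: "y \<in> grid n" and z: "z \<in> grid n" and pos: "0 < m y"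
  shows "((\<lambda>\<theta>. (F (transfer_mass m y z \<theta>) - F m) / \<theta>) \<longlongrightarrow> D m z - D m y) (at_right 0)"
proof -
  \<comment> \<open>The mixing parameter of both paths to the common point. As
    \<open>q \<theta> / \<theta>\<close> tends to 1, it may replace \<theta> in the
    quotients.\<close>
  define q :: "real \<Rightarrow> real" where "q = (\<lambda>\<theta>. \<theta> / (1 + \<theta>))"
  have q0: "(q \<longlongrightarrow> 0) (at_right 0)"
    unfolding q_def by (auto intro!: tendsto_eq_intros)
  have ev_pos: "eventually (\<lambda>\<theta> :: real. 0 < \<theta>) (at_right 0)"
    by (simp add: eventually_at_right_less)
  have qpos: "0 < q \<theta>" "q \<theta> \<le> \<theta>" "q \<theta> < 1" if "0 < \<theta>" for \<theta>
    using that by (auto simp: q_def field_simps)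
  have q: "filterlim q (at_right 0) (at_right 0)"
    using q0 ev_pos qpos by (intro filterlim_at_right_0I) (auto elim: eventually_mono)
  have ratio: "((\<lambda>\<theta>. q \<theta> / \<theta>) \<longlongrightarrow> 1) (at_right 0)"
  proof -
    have "((\<lambda>\<theta> :: real. 1 / (1 + \<theta>)) \<longlongrightarrow> 1) (at_right 0)"
      by (auto intro!: tendsto_eq_intros)
    then show ?thesis
      by (rule Lim_transform_eventually) (use ev_pos in \<open>auto simp: q_def elim: eventually_mono\<close>)
  qed
  have lim1: "((\<lambda>\<theta>. (F (mix_weights m z (q \<theta>)) - F m) / q \<theta>) \<longlongrightarrow> D m z) (at_right 0)"
    by (rule filterlim_compose [OF flat [OF m z] q])
  \<comment> \<open>Here the starting point of the path depends on \<theta>, so the flat derivative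
    at a fixed measure does not suffice: the one-sided mean value estimate along the path is
    combined with the continuity of \<open>D\<close> at \<open>m\<close>.\<close>
  have lim2: "((\<lambda>\<theta>. (F (mix_weights m z (q \<theta>)) - F (transfer_mass m y z \<theta>)) / q \<theta>) \<longlongrightarrow> D m y) (at_right 0)"
  proof (rule tendstoI)
    fix e :: real assume e: "0 < e"
    define c where "c = D m y"
    \<comment> \<open>The replacement of the factor 1 / (1 - s) by 1 is controlled uniformly on the
      path, where \<open>\<bar>c\<bar> + e / 2 + 1\<close> bounds \<open>D\<close>.\<close>
    have "((\<lambda>\<theta>. (\<bar>c\<bar> + e / 2 + 1) * (1 / (1 - \<theta>) - 1)) \<longlongrightarrow> 0) (at_right (0::real))"
      by (auto intro!: tendsto_eq_intros)
    then have ev1: "eventually (\<lambda>\<theta>. (\<bar>c\<bar> + e / 2 + 1) * (1 / (1 - \<theta>) - 1) < e / 4) (at_right 0)"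
      using e by (intro order_tendstoD(2)) auto
    have "0 < e / 4" using e by simp
    then obtain d where d: "0 < d" "\<And>m'. m' \<in> grid_prob n \<Longrightarrow> weight_dist n m m' < d \<Longrightarrow> \<bar>D m y - D m' y\<bar> < e / 4"
      using D m unfolding continuous_wrt_def by blast
    have ev2: "eventually (\<lambda>\<theta>. \<theta> \<in> {0<..<min (min (m y) (1/2)) (d / 4)}) (at_right 0)"
      using pos d(1) by (intro eventually_at_right_real) auto
    show "eventually (\<lambda>\<theta>. dist ((F (mix_weights m z (q \<theta>)) - F (transfer_mass m y z \<theta>)) / q \<theta>) (D m y) < e) (at_right 0)"
      using ev1 ev2
    proof eventually_elim
      case (elim \<theta>)
      then have th: "0 < \<theta>" "\<theta> < m y" "\<theta> < 1/2" "4 * \<theta> < d" by auto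
      note qt = qpos [OF th(1)]
      define p where "p = transfer_mass m y z \<theta>"
      have p: "p \<in> grid_prob n"
        unfolding p_def using th by (intro transfer_mass_grid_prob m y z) auto
      define \<phi> where "\<phi> = (\<lambda>s. F (mix_weights p y s))"
      have "\<bar>\<phi> (q \<theta>) - \<phi> 0 - c * q \<theta>\<bar> \<le> e / 2 * q \<theta>"
      proof (rule right_derivative_bound [where D = "\<lambda>s. D (mix_weights p y s) y * (1 / (1 - s))"])
        show "continuous_on {0..q \<theta>} \<phi>"
          unfolding \<phi>_def by (intro mix_weights_continuous [OF F p y]) (use qt in auto)
        fix s assume s: "0 \<le> s" "s < q \<theta>"
        then have s1: "s < 1" using qt by simp
        have ps: "mix_weights p y s \<in> grid_prob n"
          using s s1 by (intro mix_weights_grid_prob p y) auto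
        have "filterlim (\<lambda>h. h / (1 - s)) (at_right 0) (at_right 0)"
          using s1 ev_pos by (intro filterlim_at_right_0I) (auto intro!: tendsto_eq_intros elim: eventually_mono)
        then have "((\<lambda>h. (F (mix_weights (mix_weights p y s) y (h / (1 - s))) - F (mix_weights p y s)) / (h / (1 - s)))
            \<longlongrightarrow> D (mix_weights p y s) y) (at_right 0)"
          by (rule filterlim_compose [OF flat [OF ps y]])
        then have "((\<lambda>h. (F (mix_weights (mix_weights p y s) y (h / (1 - s))) - F (mix_weights p y s)) / (h / (1 - s))
             * (1 / (1 - s))) \<longlongrightarrow> D (mix_weights p y s) y * (1 / (1 - s))) (at_right 0)"
          by (intro tendsto_intros) (use s1 in auto)
        moreover have "(F (mix_weights (mix_weights p y s) y (h / (1 - s))) - F (mix_weights p y s)) / (h / (1 - s))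
             * (1 / (1 - s)) = (\<phi> (s + h) - \<phi> s) / h" for h
          using s1 unfolding \<phi>_def mix_weights_mix by simp
        ultimately show "((\<lambda>h. (\<phi> (s + h) - \<phi> s) / h) \<longlongrightarrow> D (mix_weights p y s) y * (1 / (1 - s))) (at_right 0)"
          by simp
        have "weight_dist n m (mix_weights p y s) \<le> weight_dist n m p + weight_dist n p (mix_weights p y s)"
          by (rule weight_dist_triangle)
        also have "\<dots> \<le> 2 * \<theta> + 2 * s"
          unfolding p_def using th s
          by (intro add_mono weight_dist_transfer weight_dist_mix p [unfolded p_def] y z) auto
        also have "\<dots> < d" using s qt th by simp
        finally have "\<bar>c - D (mix_weights p y s) y\<bar> < e / 4"
          unfolding c_def by (rule d(2) [OF ps])
        then have Dc: "\<bar>D (mix_weights p y s) y - c\<bar> < e / 4" by (simp add: abs_minus_commute)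
        have "s \<le> \<theta>" using s qt by simp
        then have "1 / (1 - s) \<le> 1 / (1 - \<theta>)" using th s1 by (intro divide_left_mono) auto
        moreover have one: "1 \<le> 1 / (1 - s)" using s s1 by simp
        ultimately have diff: "\<bar>1 / (1 - s) - 1\<bar> \<le> 1 / (1 - \<theta>) - 1" by simp
        have "\<bar>D (mix_weights p y s) y\<bar> \<le> \<bar>c\<bar> + e / 2 + 1" using Dc e by linarith
        then have "\<bar>D (mix_weights p y s) y\<bar> * \<bar>1 / (1 - s) - 1\<bar> \<le> (\<bar>c\<bar> + e / 2 + 1) * (1 / (1 - \<theta>) - 1)"
          using diff by (intro mult_mono) auto
        then have "\<bar>D (mix_weights p y s) y * (1 / (1 - s) - 1)\<bar> < e / 4"
          using elim(1) unfolding abs_mult by linarith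
        moreover have "D (mix_weights p y s) y * (1 / (1 - s)) - c =
            D (mix_weights p y s) y * (1 / (1 - s) - 1) + (D (mix_weights p y s) y - c)"
          by (simp add: right_diff_distrib)
        ultimately show "\<bar>D (mix_weights p y s) y * (1 / (1 - s)) - c\<bar> \<le> e / 2"
          using Dc by linarith
      qed (use qt in auto)
      moreover have "\<phi> (q \<theta>) = F (mix_weights m z (q \<theta>))"
        by (simp add: \<phi>_def p_def q_def mix_transfer [OF th(1)])
      moreover have "\<phi> 0 = F p"
        by (simp add: \<phi>_def mix_weights_def)
      ultimately have "\<bar>F (mix_weights m z (q \<theta>)) - F p - c * q \<theta>\<bar> \<le> e / 2 * q \<theta>" by simp
      then have "\<bar>(F (mix_weights m z (q \<theta>)) - F p - c * q \<theta>) / q \<theta>\<bar> \<le> e / 2"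
        using qt by (simp add: abs_divide pos_divide_le_eq)
      moreover have "(F (mix_weights m z (q \<theta>)) - F p - c * q \<theta>) / q \<theta> = (F (mix_weights m z (q \<theta>)) - F p) / q \<theta> - c"
        using qt by (simp add: diff_divide_distrib)
      ultimately have "\<bar>(F (mix_weights m z (q \<theta>)) - F p) / q \<theta> - c\<bar> \<le> e / 2"
        by (simp only:)
      then show ?case
        using e unfolding dist_real_def p_def c_def by linarith
    qed
  qed
  have "((\<lambda>\<theta>. ((F (mix_weights m z (q \<theta>)) - F m) / q \<theta> -
      (F (mix_weights m z (q \<theta>)) - F (transfer_mass m y z \<theta>)) / q \<theta>) * (q \<theta> / \<theta>)) \<longlongrightarrow> (D m z - D m y) * 1) (at_right 0)"
    by (intro tendsto_intros lim1 lim2 ratio)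
  moreover have "eventually (\<lambda>\<theta>. ((F (mix_weights m z (q \<theta>)) - F m) / q \<theta> -
      (F (mix_weights m z (q \<theta>)) - F (transfer_mass m y z \<theta>)) / q \<theta>) * (q \<theta> / \<theta>) =
      (F (transfer_mass m y z \<theta>) - F m) / \<theta>) (at_right 0)"
    using ev_pos
  proof eventually_elim
    case (elim \<theta>)
    then have "q \<theta> \<noteq> 0" using qpos by fastforce
    then show ?case by (simp add: diff_divide_distrib [symmetric])
  qed
  ultimately show ?thesis
    using Lim_transform_eventually by fastforce
qed

section \<open>The maximum principle for the error\<close>

text \<open>Weights are functions on the whole torus, so this is Tychonoff's theorem with the factor
  {0} at every point off the grid, cut by one closed linear condition.\<close>

lemma compact_grid_prob: "compact (grid_prob n)"
proof -
  have "compact (PiE UNIV (\<lambda>x. if x \<in> grid n then {0..1::real} else {0}))"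
    unfolding compactin_euclidean_iff [symmetric] euclidean_product_topology [symmetric] compactin_PiE
    by auto
  moreover have "closed {m :: torus \<Rightarrow> real. sum m (grid n) = 1}"
    by (intro closed_Collect_eq continuous_on_sum continuous_intros) auto
  ultimately have "compact (PiE UNIV (\<lambda>x. if x \<in> grid n then {0..1::real} else {0}) \<inter> {m. sum m (grid n) = 1})"
    by (rule compact_Int_closed)
  moreover have "PiE UNIV (\<lambda>x. if x \<in> grid n then {0..1::real} else {0}) \<inter> {m. sum m (grid n) = 1} = grid_prob n"
  proof (intro equalityI subsetI)
    fix m assume "m \<in> PiE UNIV (\<lambda>x. if x \<in> grid n then {0..1::real} else {0}) \<inter> {m. sum m (grid n) = 1}"
    then have m: "\<And>x. m x \<in> (if x \<in> grid n then {0..1} else {0})" "sum m (grid n) = 1"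
      by (simp_all only: Int_iff PiE_iff mem_Collect_eq UNIV_I simp_thms)
    have "0 \<le> m x \<and> (x \<notin> grid n \<longrightarrow> m x = 0)" for x
      using m(1) [of x] by (cases "x \<in> grid n") auto
    then show "m \<in> grid_prob n" using m(2) by (auto simp: grid_prob_def)
  next
    fix m assume m: "m \<in> grid_prob n"
    have "m x \<le> 1" if "x \<in> grid n" for x
      using m that member_le_sum [of x "grid n" m] by (auto simp: grid_prob_def)
    then show "m \<in> PiE UNIV (\<lambda>x. if x \<in> grid n then {0..1::real} else {0}) \<inter> {m. sum m (grid n) = 1}"
      using m by (auto simp: grid_prob_def PiE_def extensional_def)
  qed
  ultimately show ?thesis by simp
qed

text \<open>The explicit distance involves finitely many coordinates, so it is continuous in the
  product topology, in which the simplex is compact.\<close>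

lemma continuous_wrt_dist_tm:
  assumes "continuous_wrt (dist_tm n) A F"
  shows "continuous_on A F"
  unfolding continuous_on_def
proof (intro ballI tendstoI)
  fix p and e :: real assume p: "p \<in> A" and e: "0 < e"
  obtain t m where tm: "p = (t, m)" by fastforce
  obtain d where d: "0 < d" "\<And>p'. p' \<in> A \<Longrightarrow> dist_tm n p p' < d \<Longrightarrow> \<bar>F p - F p'\<bar> < e"
    using assms p e unfolding continuous_wrt_def by blast
  have "continuous_on UNIV (\<lambda>p' :: real \<times> (torus \<Rightarrow> real). snd p' y)" for y
    using continuous_on_compose2 [OF continuous_on_product_coordinates [of y] continuous_on_snd [OF continuous_on_id, of UNIV]]
    by simp
  then have "continuous_on UNIV (\<lambda>p'. \<bar>t - fst p'\<bar> + (\<Sum>y\<in>grid n. \<bar>m y - snd p' y\<bar>))"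
    by (intro continuous_intros)
  then have "((\<lambda>p'. \<bar>t - fst p'\<bar> + (\<Sum>y\<in>grid n. \<bar>m y - snd p' y\<bar>)) \<longlongrightarrow>
      \<bar>t - fst p\<bar> + (\<Sum>y\<in>grid n. \<bar>m y - snd p y\<bar>)) (at p within UNIV)"
    by (auto simp only: continuous_on_def)
  from tendsto_within_subset [OF this subset_UNIV [of A]] have "((\<lambda>p'. dist_tm n p p') \<longlongrightarrow> 0) (at p within A)"
    by (simp add: tm dist_tm_def case_prod_unfold)
  then have "eventually (\<lambda>p'. dist_tm n p p' < d) (at p within A)"
    using d(1) by (rule order_tendstoD(2))
  moreover have "eventually (\<lambda>p'. p' \<in> A) (at p within A)"
    by (simp add: eventually_at_filter)
  ultimately show "eventually (\<lambda>p'. dist (F p') (F p) < e) (at p within A)"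
  proof eventually_elim
    case (elim p')
    with d(2) [of p'] show ?case by (simp add: dist_real_def abs_minus_commute)
  qed
qed

text \<open>Information comes from time T, so the latest time at which some barrier is reached is
  the first contact. All barriers are treated together: at a contact with one of them the others
  still hold and may be used, as when the gradient barrier controls the source for the barrier on
  |w|.\<close>

lemma first_contact:
  fixes \<Phi> :: "'i \<Rightarrow> real \<Rightarrow> 'm::topological_space \<Rightarrow> real" and B :: "'i \<Rightarrow> real \<Rightarrow> real"
  assumes I: "finite I" and S: "compact S"
    and cont: "\<And>i. i \<in> I \<Longrightarrow> continuous_on ({0..T} \<times> S) (\<lambda>(t, m). \<Phi> i t m)"
    and contB: "\<And>i. i \<in> I \<Longrightarrow> continuous_on {0..T} (B i)"
    and terminal: "\<And>i m. i \<in> I \<Longrightarrow> m \<in> S \<Longrightarrow> \<Phi> i T m < B i T"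
    and contact: "\<And>i t m. i \<in> I \<Longrightarrow> t \<in> {0..<T} \<Longrightarrow> m \<in> S \<Longrightarrow> \<Phi> i t m = B i t \<Longrightarrow>
      (\<And>j r m'. j \<in> I \<Longrightarrow> r \<in> {t..T} \<Longrightarrow> m' \<in> S \<Longrightarrow> \<Phi> j r m' \<le> B j r) \<Longrightarrow> False"
    and i: "i \<in> I" and t: "t \<in> {0..T}" and m: "m \<in> S"
  shows "\<Phi> i t m < B i t"
proof (rule ccontr)
  assume neg: "\<not> \<Phi> i t m < B i t"
  define Z where "Z = (\<lambda>i. {p \<in> {0..T} \<times> S. B i (fst p) \<le> \<Phi> i (fst p) (snd p)})"
  have Z: "compact (Z i)" if i: "i \<in> I" for i
  proof -
    have cB: "continuous_on ({0..T} \<times> S) (\<lambda>p. B i (fst p))"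
      by (rule continuous_on_compose2 [OF contB [OF i] continuous_on_fst [OF continuous_on_id]]) auto
    have "continuous_on ({0..T} \<times> S) (\<lambda>p. \<Phi> i (fst p) (snd p))"
      using cont [OF i] by (simp add: case_prod_unfold)
    then have "continuous_on ({0..T} \<times> S) (\<lambda>p. B i (fst p) - \<Phi> i (fst p) (snd p))"
      using cB by (intro continuous_intros)
    then have "closedin (top_of_set ({0..T} \<times> S))
        (({0..T} \<times> S) \<inter> (\<lambda>p. B i (fst p) - \<Phi> i (fst p) (snd p)) -` {..0})"
      by (intro continuous_closedin_preimage closed_atMost)
    moreover have "({0..T} \<times> S) \<inter> (\<lambda>p. B i (fst p) - \<Phi> i (fst p) (snd p)) -` {..0} = Z i"
      by (auto simp: Z_def)
    ultimately show ?thesis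
      using closedin_compact [OF compact_Times [OF compact_Icc S]] by metis
  qed
  have "compact (\<Union>i\<in>I. Z i)"
    using I Z by (intro compact_UN) auto
  then have "compact (fst ` (\<Union>i\<in>I. Z i))"
    by (intro compact_continuous_image continuous_on_fst continuous_on_id)
  moreover have "t \<in> fst ` (\<Union>i\<in>I. Z i)"
    using i t m neg by (force simp: Z_def)
  ultimately obtain r where r: "r \<in> fst ` (\<Union>i\<in>I. Z i)" and max: "\<And>s. s \<in> fst ` (\<Union>i\<in>I. Z i) \<Longrightarrow> s \<le> r"
    using compact_attains_sup [of "fst ` (\<Union>i\<in>I. Z i)"] by blast
  then obtain k m0 where k: "k \<in> I" "r \<in> {0..T}" "m0 \<in> S" "B k r \<le> \<Phi> k r m0"
    by (auto simp: Z_def)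
  have "r \<noteq> T" using terminal [of k m0] k by auto
  then have rT: "r \<in> {0..<T}" using k by auto
  have strict: "\<Phi> j s m' < B j s" if "j \<in> I" "s \<in> {r<..T}" "m' \<in> S" for j s m'
  proof (rule ccontr)
    assume "\<not> \<Phi> j s m' < B j s"
    then have "(s, m') \<in> Z j" using that k by (auto simp: Z_def)
    then have "s \<in> fst ` (\<Union>i\<in>I. Z i)" using that by force
    then show False using max [of s] that by auto
  qed
  \<comment> \<open>At the contact time itself the inequality is the limit of the strict ones at
    later times, of which there are some because \<open>r < T\<close>.\<close>
  have le: "\<Phi> j r m' \<le> B j r" if j: "j \<in> I" and m': "m' \<in> S" for j m'
  proof -
    have c1: "continuous_on {0..T} (\<lambda>s. \<Phi> j s m')"
    proof -
      have "continuous_on {0..T} (\<lambda>s. case (s, m') of (t, m) \<Rightarrow> \<Phi> j t m)"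
        by (rule continuous_on_compose2 [OF cont [OF j]]) (use m' in \<open>auto intro!: continuous_intros\<close>)
      then show ?thesis by simp
    qed
    have lim: "((\<lambda>s. \<Phi> j s m') \<longlongrightarrow> \<Phi> j r m') (at r within {0..T})" "(B j \<longlongrightarrow> B j r) (at r within {0..T})"
      using c1 contB [OF j] k by (auto simp: continuous_on_def)
    have sub: "{r<..<T} \<subseteq> {0..T}" using rT by auto
    have "((\<lambda>s. \<Phi> j s m') \<longlongrightarrow> \<Phi> j r m') (at r within {r<..<T})" "(B j \<longlongrightarrow> B j r) (at r within {r<..<T})"
      using lim [THEN tendsto_within_subset, OF sub] .
    moreover have "eventually (\<lambda>s. \<Phi> j s m' \<le> B j s) (at r within {r<..<T})"
      using strict [OF j _ m'] by (auto simp: eventually_at_filter intro!: always_eventually less_imp_le)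
    moreover have "at r within {r<..<T} \<noteq> bot"
      using rT by (simp add: trivial_limit_within islimpt_greaterThanLessThan1)
    ultimately show ?thesis
      by (intro tendsto_le [of _ "B j" _ "\<lambda>s. \<Phi> j s m'"]) auto
  qed
  have "\<Phi> j s m' \<le> B j s" if "j \<in> I" "s \<in> {r..T}" "m' \<in> S" for j s m'
  proof (cases "s = r")
    case False
    then have "s \<in> {r<..T}" using that(2) by auto
    then show ?thesis using strict [OF that(1) _ that(3)] by (simp add: less_imp_le)
  qed (use le [OF that(1,3)] in simp)
  moreover have "\<Phi> k r m0 = B k r"
    using le [OF k(1,3)] k(4) by (rule antisym)
  ultimately show False
    by (intro contact [OF k(1) rT k(3)])
qed

text \<open>At a contact the barriers are known at later times only, so the maximum is one-sided and
  just the sign of the derivative is obtained.\<close>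

lemma right_max_derivative_nonpos:
  assumes d: "(\<phi> has_real_derivative d) (at t within {0..T})" and t: "t \<in> {0..<T}"
    and le: "\<And>r. r \<in> {t..T} \<Longrightarrow> \<phi> r \<le> \<phi> t"
  shows "d \<le> 0"
proof -
  have lim: "((\<lambda>r. (\<phi> r - \<phi> t) / (r - t)) \<longlongrightarrow> d) (at t within {0..T})"
    using d by (simp add: has_field_derivative_iff)
  have "{t<..<T} \<subseteq> {0..T}" using t by auto
  then have "((\<lambda>r. (\<phi> r - \<phi> t) / (r - t)) \<longlongrightarrow> d) (at t within {t<..<T})"
    by (rule tendsto_within_subset [OF lim])
  moreover have "eventually (\<lambda>r. (\<phi> r - \<phi> t) / (r - t) \<le> 0) (at t within {t<..<T})"
    unfolding eventually_at_filter using le by (auto intro!: always_eventually divide_nonpos_pos)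
  moreover have "at t within {t<..<T} \<noteq> bot"
    using t by (simp add: trivial_limit_within islimpt_greaterThanLessThan1)
  ultimately show ?thesis
    by (rule tendsto_upperbound)
qed

text \<open>As the grid is invariant under shifts, a bound for the forward quotients at all grid
  points also covers the backward ones.\<close>

lemma fwd_bwd_diff: "diff_bwd n u x = - diff_fwd n u (x - to_torus (mesh n))"
  by (simp add: diff_bwd_def diff_fwd_def minus_divide_left)

lemma diff_snd_eq:
  "diff_snd n u x = (diff_fwd n u x + diff_bwd n u x) / mesh n"
  by (simp add: diff_snd_def diff_fwd_def diff_bwd_def power2_eq_square flip: add_divide_distrib)

text \<open>The equation of the difference \<open>w\<close> of two solutions: \<open>a\<close> is the difference of the Hamiltonian
  terms, \<open>P\<close> and \<open>N\<close> are the jump rates to the right and to the left in the discrete solution, and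
  \<open>\<rho>\<close> collects the consistency error and the difference of the jump rates, paired with the smooth
  solution. The radius \<open>R\<close> is there because the Hamiltonians are only locally Lipschitz.\<close>

locale linearised_equation =
  fixes n :: nat and \<sigma> T :: real
    and w w_t a \<rho> :: "real \<Rightarrow> torus \<Rightarrow> (torus \<Rightarrow> real) \<Rightarrow> real"
    and w_m :: "real \<Rightarrow> torus \<Rightarrow> (torus \<Rightarrow> real) \<Rightarrow> torus \<Rightarrow> real"
    and P N :: "real \<Rightarrow> torus \<Rightarrow> (torus \<Rightarrow> real) \<Rightarrow> real"
    and K R \<epsilon>0 :: real
  assumes n: "1 \<le> n" and \<sigma>: "0 < \<sigma>" and T: "0 < T" and K: "0 \<le> K" and \<epsilon>0: "0 \<le> \<epsilon>0"
    and cont: "\<And>x. x \<in> grid n \<Longrightarrow> continuous_on ({0..T} \<times> grid_prob n) (\<lambda>(t, m). w t x m)"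
    and deriv_t: "\<And>t x m. t \<in> {0..T} \<Longrightarrow> x \<in> grid n \<Longrightarrow> m \<in> grid_prob n \<Longrightarrow>
      ((\<lambda>s. w s x m) has_real_derivative w_t t x m) (at t within {0..T})"
    and deriv_m: "\<And>t x m y z. t \<in> {0..T} \<Longrightarrow> x \<in> grid n \<Longrightarrow> m \<in> grid_prob n \<Longrightarrow> y \<in> grid n \<Longrightarrow> z \<in> grid n \<Longrightarrow>
      0 < m y \<Longrightarrow>
      ((\<lambda>\<theta>. (w t x (transfer_mass m y z \<theta>) - w t x m) / \<theta>) \<longlongrightarrow> w_m t x m z - w_m t x m y) (at_right 0)"
    and terminal: "\<And>x m. x \<in> grid n \<Longrightarrow> m \<in> grid_prob n \<Longrightarrow> w T x m = 0"
    and equation: "\<And>t x m. t \<in> {0..T} \<Longrightarrow> x \<in> grid n \<Longrightarrow> m \<in> grid_prob n \<Longrightarrow>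
      w_t t x m = a t x m - \<sigma> * diff_snd n (\<lambda>z. w t z m) x
        - (\<Sum>y\<in>grid n. m y * P t y m * (w_m t x m (y + to_torus (mesh n)) - w_m t x m y))
        - (\<Sum>y\<in>grid n. m y * N t y m * (w_m t x m (y - to_torus (mesh n)) - w_m t x m y))
        + \<rho> t x m"
    and P_nonneg: "\<And>t y m. t \<in> {0..T} \<Longrightarrow> y \<in> grid n \<Longrightarrow> m \<in> grid_prob n \<Longrightarrow> 0 \<le> P t y m"
    and N_nonneg: "\<And>t y m. t \<in> {0..T} \<Longrightarrow> y \<in> grid n \<Longrightarrow> m \<in> grid_prob n \<Longrightarrow> 0 \<le> N t y m"
    and a_nonneg: "\<And>t x m. t \<in> {0..T} \<Longrightarrow> x \<in> grid n \<Longrightarrow> m \<in> grid_prob n \<Longrightarrow>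
      diff_fwd n (\<lambda>z. w t z m) x \<le> 0 \<Longrightarrow> diff_bwd n (\<lambda>z. w t z m) x \<le> 0 \<Longrightarrow> 0 \<le> a t x m"
    and a_nonpos: "\<And>t x m. t \<in> {0..T} \<Longrightarrow> x \<in> grid n \<Longrightarrow> m \<in> grid_prob n \<Longrightarrow>
      0 \<le> diff_fwd n (\<lambda>z. w t z m) x \<Longrightarrow> 0 \<le> diff_bwd n (\<lambda>z. w t z m) x \<Longrightarrow> a t x m \<le> 0"
    and bounds: "\<And>t x m G. t \<in> {0..T} \<Longrightarrow> x \<in> grid n \<Longrightarrow> m \<in> grid_prob n \<Longrightarrow> G \<le> R \<Longrightarrow>
      (\<And>y. y \<in> grid n \<Longrightarrow> \<bar>diff_fwd n (\<lambda>z. w t z m) y\<bar> \<le> G) \<Longrightarrow>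
      \<bar>a t x m\<bar> \<le> K * G \<and> \<bar>\<rho> t x m\<bar> \<le> K * (\<epsilon>0 + G)"
begin

text \<open>The rates \<open>P\<close> and \<open>N\<close> depend on \<open>y\<close> and not on
  the point where \<open>w\<close> is evaluated, so the transport terms at \<open>x1\<close> and
  \<open>x2\<close> merge into one transport of the combination that touches the barrier, and the
  maximum over the simplex gives it a sign. The coefficients (s, 0) serve the barrier on |w|, and
  (s, -s) the doubled one.\<close>

lemma contact_inequality:
  assumes t: "t \<in> {0..<T}" and m: "m \<in> grid_prob n" and x: "x1 \<in> grid n" "x2 \<in> grid n"
    and B: "(B has_real_derivative b) (at t within {0..T})"
    and eq: "s1 * w t x1 m + s2 * w t x2 m = B t"
    and le: "\<And>r m'. r \<in> {t..T} \<Longrightarrow> m' \<in> grid_prob n \<Longrightarrow> s1 * w r x1 m' + s2 * w r x2 m' \<le> B r"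
  shows "s1 * (a t x1 m - \<sigma> * diff_snd n (\<lambda>z. w t z m) x1 + \<rho> t x1 m)
    + s2 * (a t x2 m - \<sigma> * diff_snd n (\<lambda>z. w t z m) x2 + \<rho> t x2 m) \<le> b"
proof -
  have t': "t \<in> {0..T}" using t by auto
  define W where "W = (\<lambda>y. s1 * w_m t x1 m y + s2 * w_m t x2 m y)"
  have "((\<lambda>r. s1 * w r x1 m + s2 * w r x2 m - B r) has_real_derivative
      s1 * w_t t x1 m + s2 * w_t t x2 m - b) (at t within {0..T})"
    by (intro DERIV_diff DERIV_add DERIV_cmult deriv_t t' x m B)
  then have time: "s1 * w_t t x1 m + s2 * w_t t x2 m - b \<le> 0"
    by (rule right_max_derivative_nonpos [OF _ t]) (use le m eq in auto)
  \<comment> \<open>Either the factor \<open>m y\<close> vanishes, or mass can be moved from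
    \<open>y\<close> to \<open>z\<close> inside the simplex, which cannot increase the touching
    quantity.\<close>
  have mass: "m y * c * (W z - W y) \<le> 0" if y: "y \<in> grid n" and z: "z \<in> grid n" and c: "0 \<le> c" for y z c
  proof (cases "m y = 0")
    case False
    then have my: "0 < m y" using m by (auto simp: grid_prob_def order_le_less)
    have "((\<lambda>\<theta>. s1 * ((w t x1 (transfer_mass m y z \<theta>) - w t x1 m) / \<theta>) + s2 * ((w t x2 (transfer_mass m y z \<theta>) - w t x2 m) / \<theta>))
        \<longlongrightarrow> s1 * (w_m t x1 m z - w_m t x1 m y) + s2 * (w_m t x2 m z - w_m t x2 m y)) (at_right 0)"
      by (intro tendsto_intros deriv_m t' x m y z my)
    moreover have "eventually (\<lambda>\<theta>. \<theta> \<in> {0<..<m y}) (at_right 0)"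
      using my by (rule eventually_at_right_real)
    then have "eventually (\<lambda>\<theta>. s1 * ((w t x1 (transfer_mass m y z \<theta>) - w t x1 m) / \<theta>) +
        s2 * ((w t x2 (transfer_mass m y z \<theta>) - w t x2 m) / \<theta>) \<le> 0) (at_right 0)"
    proof eventually_elim
      case (elim \<theta>)
      then have "transfer_mass m y z \<theta> \<in> grid_prob n"
        by (intro transfer_mass_grid_prob m y z) auto
      then have "s1 * w t x1 (transfer_mass m y z \<theta>) + s2 * w t x2 (transfer_mass m y z \<theta>) \<le> B t"
        using t by (intro le) auto
      then have "(s1 * (w t x1 (transfer_mass m y z \<theta>) - w t x1 m) + s2 * (w t x2 (transfer_mass m y z \<theta>) - w t x2 m)) / \<theta> \<le> 0"
        using elim eq by (intro divide_nonpos_pos) (auto simp: algebra_simps)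
      then show ?case by (simp add: add_divide_distrib)
    qed
    ultimately have "s1 * (w_m t x1 m z - w_m t x1 m y) + s2 * (w_m t x2 m z - w_m t x2 m y) \<le> 0"
      by (rule tendsto_upperbound) simp
    then have "W z - W y \<le> 0" by (simp add: W_def algebra_simps)
    then show ?thesis using my c by (simp add: mult_nonneg_nonpos)
  qed simp
  define \<Psi> where "\<Psi> = (\<lambda>x. (\<Sum>y\<in>grid n. m y * P t y m * (w_m t x m (y + to_torus (mesh n)) - w_m t x m y)))"
  define \<Xi> where "\<Xi> = (\<lambda>x. (\<Sum>y\<in>grid n. m y * N t y m * (w_m t x m (y - to_torus (mesh n)) - w_m t x m y)))"
  have "s1 * \<Psi> x1 + s2 * \<Psi> x2 = (\<Sum>y\<in>grid n. m y * P t y m * (W (y + to_torus (mesh n)) - W y))"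
    unfolding \<Psi>_def W_def sum_distrib_left sum.distrib [symmetric] by (intro sum.cong) (auto simp: algebra_simps)
  also have "\<dots> \<le> 0"
    by (intro sum_nonpos mass P_nonneg t' m grid_shift [OF n])
  finally have 1: "s1 * \<Psi> x1 + s2 * \<Psi> x2 \<le> 0" .
  have "s1 * \<Xi> x1 + s2 * \<Xi> x2 = (\<Sum>y\<in>grid n. m y * N t y m * (W (y - to_torus (mesh n)) - W y))"
    unfolding \<Xi>_def W_def sum_distrib_left sum.distrib [symmetric] by (intro sum.cong) (auto simp: algebra_simps)
  also have "\<dots> \<le> 0"
    by (intro sum_nonpos mass N_nonneg t' m grid_shift [OF n])
  finally have 2: "s1 * \<Xi> x1 + s2 * \<Xi> x2 \<le> 0" .
  have "w_t t x m = (a t x m - \<sigma> * diff_snd n (\<lambda>z. w t z m) x + \<rho> t x m) - \<Psi> x - \<Xi> x" if "x \<in> grid n" for x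
    using equation [OF t' that m] by (simp add: \<Psi>_def \<Xi>_def)
  note wt = this
  have "s1 * w_t t x1 m + s2 * w_t t x2 m =
    s1 * (a t x1 m - \<sigma> * diff_snd n (\<lambda>z. w t z m) x1 + \<rho> t x1 m)
    + s2 * (a t x2 m - \<sigma> * diff_snd n (\<lambda>z. w t z m) x2 + \<rho> t x2 m)
    - (s1 * \<Psi> x1 + s2 * \<Psi> x2) - (s1 * \<Xi> x1 + s2 * \<Xi> x2)"
    unfolding wt [OF x(1)] wt [OF x(2)] by (simp add: algebra_simps)
  with time 1 2 show ?thesis by linarith
qed

text \<open>At a spatial extremum the gradient terms and the second difference have the good sign.\<close>

lemma contact_at_extremum:
  assumes t: "t \<in> {0..<T}" and m: "m \<in> grid_prob n" and x: "x \<in> grid n" and s: "s \<in> {- 1, 1 :: real}"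
    and B: "(B has_real_derivative b) (at t within {0..T})"
    and eq: "s * w t x m = B t"
    and le: "\<And>r m' y. r \<in> {t..T} \<Longrightarrow> m' \<in> grid_prob n \<Longrightarrow> y \<in> grid n \<Longrightarrow> s * w r y m' \<le> B r"
  shows "- \<bar>\<rho> t x m\<bar> \<le> b"
proof -
  have t': "t \<in> {0..T}" using t by auto
  have nb: "s * w t (x + to_torus (mesh n)) m \<le> s * w t x m" "s * w t (x - to_torus (mesh n)) m \<le> s * w t x m"
    unfolding eq using t by (auto intro!: le m grid_shift n x)
  have h: "0 < mesh n" using n by (rule mesh_pos)
  have "s * diff_fwd n (\<lambda>z. w t z m) x = (s * w t (x + to_torus (mesh n)) m - s * w t x m) / mesh n"
    "s * diff_bwd n (\<lambda>z. w t z m) x = (s * w t (x - to_torus (mesh n)) m - s * w t x m) / mesh n"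
    by (simp_all add: diff_fwd_def diff_bwd_def right_diff_distrib)
  then have d: "s * diff_fwd n (\<lambda>z. w t z m) x \<le> 0" "s * diff_bwd n (\<lambda>z. w t z m) x \<le> 0"
    using nb h by (simp_all add: divide_nonpos_pos)
  have "s * diff_snd n (\<lambda>z. w t z m) x = (s * diff_fwd n (\<lambda>z. w t z m) x + s * diff_bwd n (\<lambda>z. w t z m) x) / mesh n"
    unfolding diff_snd_eq by (simp add: distrib_left)
  also have "\<dots> \<le> 0"
    using d h by (intro divide_nonpos_pos) auto
  finally have "\<sigma> * (s * diff_snd n (\<lambda>z. w t z m) x) \<le> 0"
    using \<sigma> by (simp add: mult_nonneg_nonpos)
  moreover have "0 \<le> s * a t x m"
    using s d a_nonneg [OF t' x m] a_nonpos [OF t' x m] by auto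
  moreover have "s * (a t x m - \<sigma> * diff_snd n (\<lambda>z. w t z m) x + \<rho> t x m) \<le> b"
    using contact_inequality [OF t m x x B, of s 0] eq le x by simp
  moreover have "- \<bar>\<rho> t x m\<bar> \<le> s * \<rho> t x m"
    using s by auto
  ultimately show ?thesis by (simp add: algebra_simps)
qed

lemma DERIV_exp_barrier:
  "((\<lambda>r. c * exp (\<mu> * (T - r))) has_real_derivative - \<mu> * (c * exp (\<mu> * (T - t)))) (at t within A)"
  by (auto intro!: derivative_eq_intros)

text \<open>The choice \<open>c = 0\<close> serves the barrier on |w|, and \<open>c = 1\<close> the
  one on increments.\<close>

lemma scaled_continuous:
  assumes "x \<in> grid n" "y \<in> grid n"
  shows "continuous_on ({0..T} \<times> grid_prob n) (\<lambda>(t, m). s * (w t x m - c * w t y m))"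
  using cont [OF assms(1)] cont [OF assms(2)] by (auto simp: case_prod_unfold intro!: continuous_intros)

text \<open>Bounding difference quotients by 2 sup |w| / h turns the source into a zero-order term,
  which the decay rate absorbs with 1 to spare. The rate blows up with \<open>n\<close>, so this
  serves a fixed \<open>n\<close> only; in exchange neither the mesh nor \<epsilon> has to be
  small.\<close>

lemma crude_error_bound:
  assumes R: "\<And>t x m. t \<in> {0..T} \<Longrightarrow> x \<in> grid n \<Longrightarrow> m \<in> grid_prob n \<Longrightarrow> \<bar>diff_fwd n (\<lambda>z. w t z m) x\<bar> \<le> R"
    and \<epsilon>: "\<epsilon>0 \<le> \<epsilon>" "0 < \<epsilon>"
    and t: "t \<in> {0..T}" and x: "x \<in> grid n" and m: "m \<in> grid_prob n"
  shows "\<bar>w t x m\<bar> < \<epsilon> * exp ((K * (1 + 2 / mesh n) + 1) * (T - t))"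
proof -
  define \<mu> where "\<mu> = K * (1 + 2 / mesh n) + 1"
  have h: "0 < mesh n" using n by (rule mesh_pos)
  have \<mu>: "0 < \<mu>" using K h by (simp add: \<mu>_def add_nonneg_pos)
  define B where "B = (\<lambda>(i :: real \<times> torus) r. \<epsilon> * exp (\<mu> * (T - r)))"
  have strict: "fst i * w t (snd i) m < B i t" if i: "i \<in> {- 1, 1} \<times> grid n" for i
  proof (rule first_contact [where \<Phi> = "\<lambda>i t m. fst i * w t (snd i) m" and B = B and I = "{- 1, 1} \<times> grid n", OF _ compact_grid_prob])
    show "continuous_on ({0..T} \<times> grid_prob n) (\<lambda>(t, m). fst i * w t (snd i) m)" if "i \<in> {- 1, 1} \<times> grid n" for i :: "real \<times> torus"
      using scaled_continuous [of "snd i" "snd i" "fst i" 0] that by auto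
    show "continuous_on {0..T} (B i)" for i
      unfolding B_def by (intro continuous_intros)
    show "fst i * w T (snd i) m < B i T" if "i \<in> {- 1, 1} \<times> grid n" "m \<in> grid_prob n" for i m
      using that terminal \<epsilon> by (auto simp: B_def)
  next
    fix i t m
    assume i: "i \<in> {- 1, 1} \<times> grid n" and t: "t \<in> {0..<T}" and m: "m \<in> grid_prob n"
      and eq: "fst i * w t (snd i) m = B i t"
      and le: "\<And>j r m'. j \<in> {- 1, 1} \<times> grid n \<Longrightarrow> r \<in> {t..T} \<Longrightarrow> m' \<in> grid_prob n \<Longrightarrow> fst j * w r (snd j) m' \<le> B j r"
    obtain s x where sx: "i = (s, x)" "s \<in> {- 1, 1}" "x \<in> grid n" using i by auto
    define b where "b = \<epsilon> * exp (\<mu> * (T - t))"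
    have b: "\<epsilon> \<le> b" using \<mu> \<epsilon> t by (simp add: b_def mult_le_cancel_left1)
    have wb: "\<bar>w t y m\<bar> \<le> b" if "y \<in> grid n" for y
      using le [of "(1, y)" t m] le [of "(- 1, y)" t m] that t m by (simp add: B_def b_def abs_le_iff)
    \<comment> \<open>The minimum with \<open>R\<close> is taken because \<open>bounds\<close> is
      available only for gradients within the radius \<open>R\<close>.\<close>
    have G: "\<bar>diff_fwd n (\<lambda>z. w t z m) y\<bar> \<le> min R (2 / mesh n * b)" if y: "y \<in> grid n" for y
    proof -
      have "\<bar>w t (y + to_torus (mesh n)) m - w t y m\<bar> \<le> 2 * b"
        using wb [OF y] wb [OF grid_shift(1) [OF n y]] by linarith
      then have "\<bar>diff_fwd n (\<lambda>z. w t z m) y\<bar> \<le> 2 * b / mesh n"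
        using h by (simp add: diff_fwd_def abs_divide divide_right_mono)
      then show ?thesis using R [of t y m] t y m by simp
    qed
    have "\<bar>\<rho> t x m\<bar> \<le> K * (\<epsilon>0 + min R (2 / mesh n * b))"
      using bounds [OF _ sx(3) m _ G] t by auto
    also have "\<dots> \<le> K * (b + 2 / mesh n * b)"
      using K b \<epsilon> by (intro mult_left_mono add_mono) auto
    also have "\<dots> = K * (1 + 2 / mesh n) * b"
      by (simp add: algebra_simps)
    finally have "\<bar>\<rho> t x m\<bar> \<le> K * (1 + 2 / mesh n) * b" .
    moreover have "- \<bar>\<rho> t x m\<bar> \<le> - \<mu> * b"
      unfolding b_def
    proof (rule contact_at_extremum [OF t m sx(3,2) DERIV_exp_barrier])
      show "s * w t x m = \<epsilon> * exp (\<mu> * (T - t))"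
        using eq by (simp add: sx(1) B_def)
      show "s * w r y m' \<le> \<epsilon> * exp (\<mu> * (T - r))" if "r \<in> {t..T}" "m' \<in> grid_prob n" "y \<in> grid n" for r m' y
        using le [of "(s, y)" r m'] that sx(2) by (simp add: B_def)
    qed
    moreover have "\<mu> * b = K * (1 + 2 / mesh n) * b + b"
      by (simp add: \<mu>_def algebra_simps)
    ultimately show False using b \<epsilon> by linarith
  qed (use i t m in auto)
  show ?thesis
    using strict [of "(1, x)"] strict [of "(- 1, x)"] x by (simp add: B_def \<mu>_def abs_less_iff)
qed

text \<open>The concave barrier in the distance of two points turns the smallness of \<open>w\<close> at the distance
  \<open>l\<close> and the ellipticity \<open>\<sigma>\<close> into a gradient bound, without any regularity of \<open>\<rho>\<close>.\<close>

lemma uniform_error_bound: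
  fixes \<epsilon> :: real
  defines "Q \<equiv> (3 * K + 1) / \<sigma>"
  defines "l \<equiv> 1 / (2 * Q)"
  defines "\<mu> \<equiv> 8 * (2 * K + 1) / l"
  assumes hl: "mesh n \<le> l" and \<epsilon>: "\<epsilon>0 \<le> \<epsilon>" "0 < \<epsilon>" and small: "\<epsilon> * exp (\<mu> * T) \<le> R"
    and t: "t \<in> {0..T}" and x: "x \<in> grid n" and m: "m \<in> grid_prob n"
  shows "\<bar>w t x m\<bar> \<le> \<epsilon> * (l / 8) * exp (\<mu> * T)" and "\<bar>diff_fwd n (\<lambda>z. w t z m) x\<bar> \<le> \<epsilon> * exp (\<mu> * T)"
proof -
  define h where "h = mesh n"
  have h: "0 < h" unfolding h_def using n by (rule mesh_pos)
  have Q: "0 < Q" using K \<sigma> by (simp add: Q_def add_nonneg_pos)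
  have l: "0 < l" using Q by (simp add: l_def)
  have \<mu>: "0 < \<mu>" using K l by (simp add: \<mu>_def add_nonneg_pos)
  \<comment> \<open>On [0, 2 l] the choice of \<open>l\<close> gives Q s \<le> 1, so \<kappa> stays
    between s / 2 and s there.\<close>
  define \<kappa> where "\<kappa> = (\<lambda>s. s - Q * s\<^sup>2 / 2)"
  have \<kappa>_half: "s / 2 \<le> \<kappa> s" if "0 \<le> s" "s \<le> 2 * l" for s
  proof -
    have "Q * s \<le> Q * (2 * l)" using that Q by (intro mult_left_mono) auto
    also have "\<dots> = 1" using Q by (simp add: l_def)
    finally have "s * (Q * s) \<le> s * 1" using that by (intro mult_left_mono)
    then show ?thesis by (simp add: \<kappa>_def power2_eq_square mult_ac)
  qed
  have \<kappa>_le: "\<kappa> s \<le> s" for s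
    using Q by (simp add: \<kappa>_def)
  \<comment> \<open>Contacts will be confined to distances below \<open>l\<close>; the range up to 2
    l leaves room for the neighbouring distance \<open>Suc d\<close>.\<close>
  define D where "D = {d :: nat. real d * h \<le> 2 * l}"
  have finD: "finite D"
  proof (rule finite_subset)
    show "D \<subseteq> {..nat \<lceil>2 * l / h\<rceil>}"
      using h by (auto simp: D_def pos_le_divide_eq [symmetric] le_nat_iff) linarith
  qed simp
  define E where "E = (\<lambda>r. exp (\<mu> * (T - r)))"
  define I where "I = {- 1, 1 :: real} \<times> D \<times> grid n"
  \<comment> \<open>The otherwise trivial increment at distance 0 is used as the index of the
    barrier on |w| itself.\<close>
  define \<Phi> where "\<Phi> = (\<lambda>(s, d, x) r m'. if d = 0 then s * w r x m' else s * (w r (x + to_torus (real d * h)) m' - w r x m'))"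
  define c where "c = (\<lambda>d :: nat. if d = 0 then l / 8 else \<kappa> (real d * h))"
  define B where "B = (\<lambda>(s :: real, d, x :: torus) r. \<epsilon> * c d * E r)"
  have cpos: "0 < c d" if "d \<in> D" for d
  proof (cases "d = 0")
    case False
    then have "0 < real d * h" using h by simp
    moreover have "real d * h / 2 \<le> \<kappa> (real d * h)"
      using that h by (intro \<kappa>_half) (auto simp: D_def)
    ultimately show ?thesis using False by (simp add: c_def)
  qed (use l in \<open>simp add: c_def\<close>)
  have xd: "x + to_torus (real d * h) \<in> grid n" if "x \<in> grid n" for x d
    using grid_shift_nat [OF n that] by (simp add: h_def)
  have strict: "\<Phi> i t m < B i t" if i: "i \<in> I" and t: "t \<in> {0..T}" and m: "m \<in> grid_prob n" for i t m
  proof (rule first_contact [where \<Phi> = \<Phi> and B = B and I = I, OF _ compact_grid_prob])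
    show "finite I" by (simp add: I_def finD)
    show "continuous_on ({0..T} \<times> grid_prob n) (\<lambda>(t, m). \<Phi> i t m)" if iI: "i \<in> I" for i
    proof -
      obtain s d x where i: "i = (s, d, x)" "x \<in> grid n" using iI by (auto simp: I_def)
      show ?thesis
        using scaled_continuous [OF i(2) i(2), of s 0] scaled_continuous [OF xd [OF i(2), of d] i(2), of s 1]
        by (cases "d = 0") (simp_all add: i(1) \<Phi>_def)
    qed
    show "continuous_on {0..T} (B i)" for i
      unfolding B_def E_def case_prod_unfold by (intro continuous_intros)
    show "\<Phi> i T m < B i T" if "i \<in> I" "m \<in> grid_prob n" for i m
      using that terminal xd cpos \<epsilon> by (auto simp: I_def \<Phi>_def B_def E_def)
  next
    fix i t m
    assume i: "i \<in> I" and t: "t \<in> {0..<T}" and m: "m \<in> grid_prob n"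
      and eq: "\<Phi> i t m = B i t"
      and le: "\<And>j r m'. j \<in> I \<Longrightarrow> r \<in> {t..T} \<Longrightarrow> m' \<in> grid_prob n \<Longrightarrow> \<Phi> j r m' \<le> B j r"
    obtain s d x where sx: "i = (s, d, x)" "s \<in> {- 1, 1}" "d \<in> D" "x \<in> grid n" using i by (auto simp: I_def)
    have t': "t \<in> {0..T}" using t by auto
    define b where "b = \<epsilon> * E t"
    have E1: "1 \<le> E t" using \<mu> t by (simp add: E_def)
    then have b: "\<epsilon> \<le> b" using \<epsilon> by (simp add: b_def mult_le_cancel_left1)
    have "E t \<le> exp (\<mu> * T)" using \<mu> t by (simp add: E_def)
    then have bR: "b \<le> R" using small \<epsilon> unfolding b_def by (meson mult_left_mono order_trans less_imp_le)
    have D01: "0 \<in> D" "1 \<in> D" using l hl h by (auto simp: D_def h_def)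
    have single: "s * w r y m' \<le> \<epsilon> * (l / 8) * E r"
      if "r \<in> {t..T}" "m' \<in> grid_prob n" "y \<in> grid n" "s \<in> {- 1, 1}" for r y m' s
      using le [of "(s, 0, y)" r m'] that D01 by (simp add: I_def \<Phi>_def B_def c_def)
    \<comment> \<open>For \<open>k = 0\<close> both sides vanish. This case is needed for
      \<open>d - 1\<close>, although the index 0 in \<open>I\<close> stands for the other
      barrier.\<close>
    have pair: "s * (w r (y + to_torus (real k * h)) m' - w r y m') \<le> \<epsilon> * \<kappa> (real k * h) * E r"
      if "r \<in> {t..T}" "m' \<in> grid_prob n" "y \<in> grid n" "s \<in> {- 1, 1}" "k \<in> D" for r y m' s k
    proof (cases "k = 0")
      case False
      then show ?thesis
        using le [of "(s, k, y)" r m'] that by (simp add: I_def \<Phi>_def B_def c_def)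
    qed (simp add: \<kappa>_def)
    \<comment> \<open>Since \<kappa> h \<le> h, the barrier at \<open>d = 1\<close> bounds all
      difference quotients by \<open>b\<close>, which lies within the radius \<open>R\<close> by the
      smallness of \<epsilon>.\<close>
    have G: "\<bar>diff_fwd n (\<lambda>z. w t z m) y\<bar> \<le> b" if y: "y \<in> grid n" for y
    proof -
      have "\<bar>w t (y + to_torus h) m - w t y m\<bar> \<le> \<epsilon> * \<kappa> h * E t"
        using pair [of t m y 1 1] pair [of t m y "- 1" 1] y t m D01 by (simp add: abs_le_iff)
      also have "\<dots> = b * \<kappa> h"
        by (simp add: b_def mult_ac)
      also have "\<dots> \<le> b * h"
        using b \<epsilon> by (intro mult_left_mono \<kappa>_le) auto
      finally show ?thesis
        using h by (simp add: diff_fwd_def h_def [symmetric] abs_divide pos_divide_le_eq)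
    qed
    have ar: "\<bar>a t y m\<bar> \<le> K * b" "\<bar>\<rho> t y m\<bar> \<le> 2 * K * b" if "y \<in> grid n" for y
    proof -
      have "\<bar>a t y m\<bar> \<le> K * b" "\<bar>\<rho> t y m\<bar> \<le> K * (\<epsilon>0 + b)"
        using bounds [OF t' that m bR G] by auto
      moreover have "K * (\<epsilon>0 + b) \<le> K * (b + b)"
        using K b \<epsilon> by (intro mult_left_mono) auto
      ultimately show "\<bar>a t y m\<bar> \<le> K * b" "\<bar>\<rho> t y m\<bar> \<le> 2 * K * b"
        by (auto simp: algebra_simps)
    qed
    have bpos: "0 < b" using b \<epsilon> by simp
    show False
    proof (cases "d = 0")
      case True
      have "- \<bar>\<rho> t x m\<bar> \<le> - \<mu> * (\<epsilon> * (l / 8) * E t)"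
        unfolding E_def
      proof (rule contact_at_extremum [OF t m sx(4,2) DERIV_exp_barrier])
        show "s * w t x m = \<epsilon> * (l / 8) * exp (\<mu> * (T - t))"
          using eq True by (simp add: sx(1) \<Phi>_def B_def c_def E_def)
        show "s * w r y m' \<le> \<epsilon> * (l / 8) * exp (\<mu> * (T - r))" if "r \<in> {t..T}" "m' \<in> grid_prob n" "y \<in> grid n" for r m' y
          using single [OF that sx(2)] by (simp add: E_def)
      qed
      \<comment> \<open>This determines \<mu>: the decay of the barrier on |w| exceeds the bound 2 K
        b for the source by \<open>b\<close>.\<close>
      moreover have "\<mu> * (\<epsilon> * (l / 8) * E t) = 2 * K * b + b"
        using l by (simp add: \<mu>_def b_def field_simps)
      ultimately show False using ar(2) [OF sx(4)] bpos by linarith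
    next
      case False
      define x' where "x' = x + to_torus (real d * h)"
      have x': "x' \<in> grid n" unfolding x'_def using xd sx(4) .
      have eq': "s * (w t x' m - w t x m) = \<epsilon> * \<kappa> (real d * h) * E t"
        using eq False by (simp add: sx(1) \<Phi>_def B_def c_def x'_def)
      have dl: "real d * h \<le> 2 * l" using sx(3) by (simp add: D_def)
      have dpos: "0 < real d * h" using False h by simp
      \<comment> \<open>At distance \<open>l\<close> or more the doubled barrier is at least b l /
        2, while the barrier on |w| allows an increment of at most twice b l / 8.\<close>
      have "real d * h < l"
      proof (rule ccontr)
        assume "\<not> real d * h < l"
        then have "l / 2 \<le> \<kappa> (real d * h)" using \<kappa>_half [of "real d * h"] dl dpos by linarith
        then have "b * (l / 2) \<le> b * \<kappa> (real d * h)"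
          using bpos by (intro mult_left_mono) auto
        also have "\<dots> = \<epsilon> * \<kappa> (real d * h) * E t"
          by (simp add: b_def mult_ac)
        finally have "b * (l / 2) \<le> \<epsilon> * \<kappa> (real d * h) * E t" .
        moreover have "s * (w t x' m - w t x m) \<le> b * (l / 4)"
        proof -
          have "s * w t x' m \<le> b * (l / 8)" "(- s) * w t x m \<le> b * (l / 8)"
            using single [of t m x' s] single [of t m x "- s"] x' sx t m by (auto simp: b_def mult_ac)
          then show ?thesis by (simp add: algebra_simps)
        qed
        moreover have "0 < b * l" using bpos l by simp
        ultimately show False using eq' by (simp add: algebra_simps)
      qed
      then have "Suc d \<in> D" "d - 1 \<in> D"
        using sx(3) hl h False by (auto simp: D_def h_def algebra_simps of_nat_diff)
      note D' = this
      have d1: "real (d - 1) = real d - 1" "real (Suc d) = real d + 1" using False by auto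
      have sh: "x' + to_torus h = x + to_torus (real (Suc d) * h)"
        "x' - to_torus h = x + to_torus (real (d - 1) * h)"
        "x - to_torus h + to_torus (real (Suc d) * h) = x'"
        "x + to_torus h + to_torus (real (d - 1) * h) = x'"
        unfolding d1 by (simp_all add: x'_def distrib_right left_diff_distrib to_torus_add to_torus_diff)
      \<comment> \<open>One endpoint stays fixed while the other moves by one mesh step, so each
        second difference is compared with the barrier at the distances \<open>d + 1\<close> and
        \<open>d - 1\<close>.\<close>
      have inc: "s * (w t (x' + to_torus h) m - w t x m) \<le> b * \<kappa> (real (Suc d) * h)"
        "s * (w t (x' - to_torus h) m - w t x m) \<le> b * \<kappa> (real (d - 1) * h)"
        "s * (w t x' m - w t (x - to_torus h) m) \<le> b * \<kappa> (real (Suc d) * h)"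
        "s * (w t x' m - w t (x + to_torus h) m) \<le> b * \<kappa> (real (d - 1) * h)"
        using pair [of t m x s "Suc d"] pair [of t m x s "d - 1"]
          pair [of t m "x - to_torus h" s "Suc d"] pair [of t m "x + to_torus h" s "d - 1"]
          sx t m D' grid_shift [OF n sx(4)]
        unfolding sh b_def h_def [symmetric] by (simp_all add: mult_ac)
      \<comment> \<open>For a quadratic barrier the second difference is exact, so no discretisation
        error arises here.\<close>
      have \<kappa>2: "\<kappa> (real (Suc d) * h) + \<kappa> (real (d - 1) * h) - 2 * \<kappa> (real d * h) = - (Q * h\<^sup>2)"
        unfolding d1 by (simp add: \<kappa>_def power2_eq_square field_simps)
      have eqb: "s * (w t x' m - w t x m) = b * \<kappa> (real d * h)"
        using eq' by (simp add: b_def mult_ac)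
      have S: "b * \<kappa> (real (Suc d) * h) + b * \<kappa> (real (d - 1) * h) - 2 * (b * \<kappa> (real d * h)) = - (b * Q) * h\<^sup>2"
        using arg_cong [OF \<kappa>2, of "\<lambda>r. b * r"] by (simp add: algebra_simps)
      have "s * (w t (x' + to_torus h) m - 2 * w t x' m + w t (x' - to_torus h) m) \<le> - (b * Q) * h\<^sup>2"
        using inc(1,2) eqb S by (simp add: algebra_simps)
      then have 1: "s * diff_snd n (\<lambda>z. w t z m) x' \<le> - (b * Q)"
        using h by (simp add: diff_snd_def h_def [symmetric] pos_divide_le_eq)
      have "- s * (w t (x + to_torus h) m - 2 * w t x m + w t (x - to_torus h) m) \<le> - (b * Q) * h\<^sup>2"
        using inc(3,4) eqb S by (simp add: algebra_simps)
      then have 2: "- s * diff_snd n (\<lambda>z. w t z m) x \<le> - (b * Q)"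
        using h by (simp add: diff_snd_def h_def [symmetric] pos_le_divide_eq)
      have "s * (a t x' m - \<sigma> * diff_snd n (\<lambda>z. w t z m) x' + \<rho> t x' m)
        + (- s) * (a t x m - \<sigma> * diff_snd n (\<lambda>z. w t z m) x + \<rho> t x m) \<le> - \<mu> * (\<epsilon> * \<kappa> (real d * h) * exp (\<mu> * (T - t)))"
      proof (rule contact_inequality [OF t m x' sx(4) DERIV_exp_barrier])
        show "s * w t x' m + - s * w t x m = \<epsilon> * \<kappa> (real d * h) * exp (\<mu> * (T - t))"
          using eq' by (simp add: E_def algebra_simps)
        show "s * w r x' m' + - s * w r x m' \<le> \<epsilon> * \<kappa> (real d * h) * exp (\<mu> * (T - r))"
          if "r \<in> {t..T}" "m' \<in> grid_prob n" for r m'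
          using pair [OF that sx(4,2,3)] by (simp add: E_def x'_def algebra_simps)
      qed
      \<comment> \<open>For the doubled barrier only the sign of the time decay is used; the strict
        gain comes from the diffusion.\<close>
      also have "\<dots> \<le> 0"
      proof -
        have "0 \<le> \<epsilon> * \<kappa> (real d * h) * exp (\<mu> * (T - t))"
          using \<epsilon> \<kappa>_half [of "real d * h"] dl dpos by simp
        then show ?thesis using \<mu> by simp
      qed
      finally have "s * a t x' m - s * a t x m + s * \<rho> t x' m - s * \<rho> t x m
          - \<sigma> * (s * diff_snd n (\<lambda>z. w t z m) x') - \<sigma> * (- s * diff_snd n (\<lambda>z. w t z m) x) \<le> 0"
        by (simp add: algebra_simps)
      moreover have "\<sigma> * (s * diff_snd n (\<lambda>z. w t z m) x') \<le> \<sigma> * - (b * Q)"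
        "\<sigma> * (- s * diff_snd n (\<lambda>z. w t z m) x) \<le> \<sigma> * - (b * Q)"
        using 1 2 \<sigma> by (intro mult_left_mono; simp)+
      \<comment> \<open>This determines Q: the diffusion gains 6 K b + 2 b at the two points,
        against 2 K b from the Hamiltonian terms and 4 K b from the source.\<close>
      moreover have "\<sigma> * - (b * Q) = - (3 * K * b + b)"
        using \<sigma> by (simp add: Q_def field_simps)
      moreover have "- (K * b) \<le> s * a t x' m" "- (K * b) \<le> - (s * a t x m)"
        "- (2 * K * b) \<le> s * \<rho> t x' m" "- (2 * K * b) \<le> - (s * \<rho> t x m)"
        using ar [OF x'] ar [OF sx(4)] sx(2) by (auto simp: abs_le_iff)
      ultimately show False using bpos by linarith
    qed
  qed (use i t m in auto)
  have D01: "0 \<in> D" "1 \<in> D" using l hl h by (auto simp: D_def h_def)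
  have E: "E t \<le> exp (\<mu> * T)" "0 < E t" using \<mu> t by (auto simp: E_def)
  have "\<bar>w t x m\<bar> \<le> \<epsilon> * (l / 8) * E t"
    using strict [of "(1, 0, x)" t m] strict [of "(- 1, 0, x)" t m] D01 t x m
    by (simp add: I_def \<Phi>_def B_def c_def abs_le_iff)
  also have "\<dots> \<le> \<epsilon> * (l / 8) * exp (\<mu> * T)"
    using E \<epsilon> l by (intro mult_left_mono) auto
  finally show "\<bar>w t x m\<bar> \<le> \<epsilon> * (l / 8) * exp (\<mu> * T)" .
  have "\<bar>w t (x + to_torus h) m - w t x m\<bar> \<le> \<epsilon> * \<kappa> h * E t"
    using strict [of "(1, 1, x)" t m] strict [of "(- 1, 1, x)" t m] D01 t x m
    by (simp add: I_def \<Phi>_def B_def c_def abs_le_iff)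
  also have "\<dots> \<le> \<epsilon> * h * exp (\<mu> * T)"
    using E \<epsilon> h \<kappa>_le [of h] \<kappa>_half [of h] hl l
    by (intro mult_mono mult_left_mono mult_nonneg_nonneg) (auto simp: h_def)
  finally show "\<bar>diff_fwd n (\<lambda>z. w t z m) x\<bar> \<le> \<epsilon> * exp (\<mu> * T)"
    using h by (simp add: diff_fwd_def h_def [symmetric] abs_divide pos_divide_le_eq mult_ac)
qed

end

section \<open>Consistency of the discrete master equation\<close>

text \<open>Used to bound the controls, which are derivatives of the Hamiltonians, by the local
  Lipschitz constant of the Hamiltonians.\<close>

lemma DERIV_abs_le_lipschitz:
  fixes F :: "real \<Rightarrow> real"
  assumes F: "(F has_real_derivative D) (at p)" and r: "0 < r"
    and lip: "\<And>q. \<bar>q - p\<bar> \<le> r \<Longrightarrow> \<bar>F q - F p\<bar> \<le> K * \<bar>q - p\<bar>"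
  shows "\<bar>D\<bar> \<le> K"
proof -
  have "((\<lambda>h. (F (p + h) - F p) / h) \<longlongrightarrow> D) (at 0)"
    using F by (simp add: DERIV_def)
  then have "((\<lambda>h. \<bar>(F (p + h) - F p) / h\<bar>) \<longlongrightarrow> \<bar>D\<bar>) (at 0)"
    by (rule tendsto_rabs)
  moreover have "eventually (\<lambda>h. \<bar>(F (p + h) - F p) / h\<bar> \<le> K) (at 0)"
    unfolding eventually_at
  proof (intro exI [of _ r] conjI ballI impI r)
    fix h :: real assume "h \<noteq> 0 \<and> dist h 0 < r"
    then show "\<bar>(F (p + h) - F p) / h\<bar> \<le> K"
      using lip [of "p + h"] by (simp add: abs_divide pos_divide_le_eq)
  qed
  ultimately show ?thesis
    by (rule tendsto_upperbound) simp
qed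

text \<open>Supplies the measurability that is needed to turn the integrals of the master equation
  into sums over the grid.\<close>

lemma modulus_continuous_on:
  fixes F :: "'a :: metric_space \<Rightarrow> real"
  assumes \<omega>: "(\<omega> \<longlongrightarrow> 0) (at_right 0)" "\<omega> 0 = 0" and F: "\<And>x y. \<bar>F x - F y\<bar> \<le> \<omega> (dist x y)"
  shows "continuous_on A F"
  unfolding continuous_on_iff
proof (intro ballI allI impI)
  fix x and e :: real assume e: "0 < e"
  have "eventually (\<lambda>d. \<omega> d < e) (at_right 0)"
    using \<omega>(1) e by (rule order_tendstoD(2))
  then obtain d where d: "0 < d" "\<And>r. 0 < r \<Longrightarrow> r < d \<Longrightarrow> \<omega> r < e"
    unfolding eventually_at_right_field by blast
  have "dist (F y) (F x) < e" if "dist y x < d" for y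
  proof (cases "y = x")
    case False
    then have "\<omega> (dist y x) < e" using that by (intro d(2)) auto
    then show ?thesis using F [of y x] by (simp add: dist_real_def)
  qed (use e in simp)
  then show "\<exists>d>0. \<forall>y\<in>A. dist y x < d \<longrightarrow> dist (F y) (F x) < e"
    using d(1) by blast
qed

lemma C1_with_derivs_time:
  assumes C1: "C1_with_derivs n T F Ft Fm" and t: "t \<in> {0..T}" and m: "m \<in> grid_prob n"
  shows "((\<lambda>s. F s m) has_real_derivative Ft t m) (at t within {0..T})"
  unfolding has_field_derivative_def has_derivative_within_alt
proof (intro conjI allI impI)
  show "bounded_linear ((*) (Ft t m))" by (rule bounded_linear_mult_right)
  fix e :: real assume e: "0 < e"
  obtain d where d: "0 < d" "\<And>t' m'. t' \<in> {0..T} \<Longrightarrow> m' \<in> grid_prob n \<Longrightarrow> dist_tm n (t, m) (t', m') < d \<Longrightarrow>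
      \<bar>F t' m' - F t m - Ft t m * (t' - t) - (\<Sum>y\<in>grid n. Fm t m y * (m' y - m y))\<bar> \<le> e * dist_tm n (t, m) (t', m')"
    using C1 t m e unfolding C1_with_derivs_def by blast
  show "\<exists>d>0. \<forall>y\<in>{0..T}. norm (y - t) < d \<longrightarrow> norm (F y m - F t m - Ft t m * (y - t)) \<le> e * norm (y - t)"
  proof (intro exI [of _ d] conjI ballI impI d(1))
    fix s assume s: "s \<in> {0..T}" "norm (s - t) < d"
    then show "norm (F s m - F t m - Ft t m * (s - t)) \<le> e * norm (s - t)"
      using d(2) [OF s(1) m] by (simp add: dist_tm_def abs_minus_commute)
  qed
qed

lemma C1_with_derivs_transfer:
  assumes C1: "C1_with_derivs n T F Ft Fm" and t: "t \<in> {0..T}" and m: "m \<in> grid_prob n"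
    and y: "y \<in> grid n" and z: "z \<in> grid n" and pos: "0 < m y"
  shows "((\<lambda>\<theta>. (F t (transfer_mass m y z \<theta>) - F t m) / \<theta>) \<longlongrightarrow> Fm t m z - Fm t m y) (at_right 0)"
proof (rule tendstoI)
  fix e :: real assume e: "0 < e"
  then have "0 < e / 4" by simp
  then obtain d where d: "0 < d" "\<And>t' m'. t' \<in> {0..T} \<Longrightarrow> m' \<in> grid_prob n \<Longrightarrow> dist_tm n (t, m) (t', m') < d \<Longrightarrow>
      \<bar>F t' m' - F t m - Ft t m * (t' - t) - (\<Sum>y\<in>grid n. Fm t m y * (m' y - m y))\<bar> \<le> e / 4 * dist_tm n (t, m) (t', m')"
    using C1 t m unfolding C1_with_derivs_def by blast
  have "eventually (\<lambda>\<theta>. \<theta> \<in> {0<..<min (m y) (d / 2)}) (at_right 0)"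
    using pos d(1) by (intro eventually_at_right_real) auto
  then show "eventually (\<lambda>\<theta>. dist ((F t (transfer_mass m y z \<theta>) - F t m) / \<theta>) (Fm t m z - Fm t m y) < e) (at_right 0)"
  proof eventually_elim
    case (elim \<theta>)
    then have \<theta>: "0 < \<theta>" "\<theta> < m y" "2 * \<theta> < d" by auto
    define m' where "m' = transfer_mass m y z \<theta>"
    have m': "m' \<in> grid_prob n"
      unfolding m'_def using \<theta> by (intro transfer_mass_grid_prob m y z) auto
    have "dist_tm n (t, m) (t, m') = weight_dist n m m'"
      by (simp add: dist_tm_def weight_dist_def)
    then have dist: "dist_tm n (t, m) (t, m') \<le> 2 * \<theta>"
      using weight_dist_transfer [OF y z, of \<theta> m] \<theta> by (simp add: m'_def)
    have "(\<Sum>x\<in>grid n. Fm t m x * (m' x - m x)) =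
        (\<Sum>x\<in>grid n. (if x = z then Fm t m x * \<theta> else 0) - (if x = y then Fm t m x * \<theta> else 0))"
      unfolding m'_def transfer_mass_def by (intro sum.cong) (auto simp: algebra_simps)
    also have "\<dots> = (Fm t m z - Fm t m y) * \<theta>"
      using y z by (simp add: sum_subtractf left_diff_distrib)
    finally have sum: "(\<Sum>x\<in>grid n. Fm t m x * (m' x - m x)) = (Fm t m z - Fm t m y) * \<theta>" .
    have "dist_tm n (t, m) (t, m') < d" using dist \<theta> by linarith
    from d(2) [OF t m' this]
    have "\<bar>F t m' - F t m - (Fm t m z - Fm t m y) * \<theta>\<bar> \<le> e / 4 * dist_tm n (t, m) (t, m')"
      by (simp add: sum)
    also have "\<dots> \<le> e / 4 * (2 * \<theta>)"
      using dist e by (intro mult_left_mono) auto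
    finally have "\<bar>F t m' - F t m - (Fm t m z - Fm t m y) * \<theta>\<bar> / \<theta> \<le> e / 2"
      using \<theta> by (simp add: pos_divide_le_eq mult.commute)
    moreover have "(F t m' - F t m) / \<theta> - (Fm t m z - Fm t m y) = (F t m' - F t m - (Fm t m z - Fm t m y) * \<theta>) / \<theta>"
      using \<theta> by (simp add: diff_divide_distrib)
    then have "\<bar>(F t m' - F t m) / \<theta> - (Fm t m z - Fm t m y)\<bar> = \<bar>F t m' - F t m - (Fm t m z - Fm t m y) * \<theta>\<bar> / \<theta>"
      using \<theta> by (simp only: abs_divide abs_of_pos)
    ultimately show ?case
      using e unfolding dist_real_def m'_def by linarith
  qed
qed

lemma C1_with_derivs_continuous:
  assumes C1: "C1_with_derivs n T F Ft Fm"
  shows "continuous_wrt (dist_tm n) ({0..T} \<times> grid_prob n) (\<lambda>(t, m). F t m)"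
  unfolding continuous_wrt_def
proof (intro ballI allI impI)
  fix p and e :: real assume p: "p \<in> {0..T} \<times> grid_prob n" and e: "0 < e"
  obtain t m where tm: "p = (t, m)" "t \<in> {0..T}" "m \<in> grid_prob n" using p by auto
  obtain d where d: "0 < d" "\<And>t' m'. t' \<in> {0..T} \<Longrightarrow> m' \<in> grid_prob n \<Longrightarrow> dist_tm n (t, m) (t', m') < d \<Longrightarrow>
      \<bar>F t' m' - F t m - Ft t m * (t' - t) - (\<Sum>y\<in>grid n. Fm t m y * (m' y - m y))\<bar> \<le> 1 * dist_tm n (t, m) (t', m')"
    using C1 tm(2,3) zero_less_one unfolding C1_with_derivs_def by blast
  \<comment> \<open>The linear part plus an error of slope 1 gives a local Lipschitz constant at the
    point.\<close>
  define k where "k = 1 + \<bar>Ft t m\<bar> + (\<Sum>y\<in>grid n. \<bar>Fm t m y\<bar>)"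
  have k: "0 < k" unfolding k_def by (intro add_pos_nonneg sum_nonneg) auto
  have "\<bar>F t m - F t' m'\<bar> < e" if t': "t' \<in> {0..T}" and m': "m' \<in> grid_prob n"
    and dist: "dist_tm n (t, m) (t', m') < min d (e / k)" for t' m'
  proof -
    define \<delta> where "\<delta> = dist_tm n (t, m) (t', m')"
    have \<delta>: "\<delta> = \<bar>t - t'\<bar> + (\<Sum>y\<in>grid n. \<bar>m y - m' y\<bar>)" by (simp add: \<delta>_def dist_tm_def)
    have S0: "0 \<le> (\<Sum>y\<in>grid n. \<bar>m y - m' y\<bar>)" by (intro sum_nonneg) auto
    have \<delta>0: "0 \<le> \<delta>" using S0 by (simp add: \<delta>)
    have "\<bar>Ft t m * (t' - t)\<bar> \<le> \<bar>Ft t m\<bar> * \<delta>"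
      unfolding abs_mult using S0 by (intro mult_left_mono) (auto simp: \<delta> abs_minus_commute)
    moreover have "\<bar>\<Sum>y\<in>grid n. Fm t m y * (m' y - m y)\<bar> \<le> (\<Sum>y\<in>grid n. \<bar>Fm t m y\<bar> * \<delta>)"
    proof (rule order_trans [OF sum_abs], intro sum_mono)
      fix y assume "y \<in> grid n"
      then have "\<bar>m y - m' y\<bar> \<le> (\<Sum>y\<in>grid n. \<bar>m y - m' y\<bar>)"
        by (intro member_le_sum) auto
      then show "\<bar>Fm t m y * (m' y - m y)\<bar> \<le> \<bar>Fm t m y\<bar> * \<delta>"
        unfolding abs_mult by (intro mult_left_mono) (auto simp: \<delta> abs_minus_commute)
    qed
    moreover have "\<bar>F t' m' - F t m - Ft t m * (t' - t) - (\<Sum>y\<in>grid n. Fm t m y * (m' y - m y))\<bar> \<le> \<delta>"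
      using d(2) [OF t' m'] dist by (simp add: \<delta>_def)
    ultimately have "\<bar>F t' m' - F t m\<bar> \<le> \<delta> + \<bar>Ft t m\<bar> * \<delta> + (\<Sum>y\<in>grid n. \<bar>Fm t m y\<bar> * \<delta>)"
      by linarith
    also have "\<dots> = k * \<delta>"
      by (simp add: k_def distrib_right sum_distrib_right)
    also have "\<dots> < e"
      using dist k by (simp add: \<delta>_def pos_less_divide_eq mult.commute)
    finally show ?thesis by (simp add: abs_minus_commute)
  qed
  moreover have "0 < min d (e / k)" using d(1) e k by simp
  ultimately show "\<exists>\<delta>>0. \<forall>b\<in>{0..T} \<times> grid_prob n. dist_tm n p b < \<delta> \<longrightarrow> \<bar>(case p of (t, m) \<Rightarrow> F t m) - (case b of (t, m) \<Rightarrow> F t m)\<bar> < e"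
    unfolding tm(1) by (intro exI [of _ "min d (e / k)"]) auto
qed

section \<open>Consistency error of a classical solution on the grid\<close>

locale master_equation =
  fixes \<sigma> T :: real and L :: "torus \<Rightarrow> real \<Rightarrow> real" and f g :: "torus measure \<Rightarrow> torus \<Rightarrow> real"
    and U U_t :: value_fun and \<omega> :: "real \<Rightarrow> real"
  assumes \<sigma>: "0 < \<sigma>" and T: "0 < T" and L: "admissible_lagrangian L"
    and regular: "\<And>t x m. t \<in> {0..T} \<Longrightarrow> m \<in> prob_measures \<Longrightarrow>
       ((\<lambda>s. U s x m) has_real_derivative U_t t x m) (at t within {0..T}) \<and>
       differentiable_torus (\<lambda>z. U t z m) \<and>
       differentiable_torus (\<lambda>z. U_x U t z m) \<and>
       flat_differentiable_at (U t x) m \<and>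
       differentiable_torus (U_m U t x m) \<and>
       differentiable_torus (U_my U t x m)"
    and cont_U: "continuous_wrt dist_txm (dom_txm T) (\<lambda>(t, x, m). U t x m)"
    and cont_Um: "continuous_wrt dist_txmy (dom_txmy T) (\<lambda>(t, x, m, y). U_m U t x m y)"
    and master: "\<And>t x m. t \<in> {0..T} \<Longrightarrow> m \<in> prob_measures \<Longrightarrow>
       - U_t t x m - \<sigma> * U_xx U t x m + hamiltonian L x (U_x U t x m)
       - \<sigma> * (\<integral>y. U_myy U t x m y \<partial>m)
       + (\<integral>y. ddp (hamiltonian L) y (U_x U t y m) * U_my U t x m y \<partial>m)
       = f m x"
    and terminal: "\<And>x m. m \<in> prob_measures \<Longrightarrow> U T x m = g m x"
    and modulus: "common_modulus T U \<omega>"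
begin

lemma \<omega>_0: "\<omega> 0 = 0" and \<omega>_tendsto: "(\<omega> \<longlongrightarrow> 0) (at_right 0)"
  and \<omega>_mono: "0 \<le> a \<Longrightarrow> a \<le> b \<Longrightarrow> \<omega> a \<le> \<omega> b"
  using modulus by (auto simp: common_modulus_def modulus_function_def mono_on_def)

lemma \<omega>_nonneg: "0 \<le> a \<Longrightarrow> 0 \<le> \<omega> a"
  using \<omega>_mono [of 0 a] by (simp add: \<omega>_0)

context
  fixes n :: nat and t :: real and m :: "torus \<Rightarrow> real" and \<mu> :: "torus measure"
  assumes n: "1 \<le> n" and t: "t \<in> {0..T}" and m: "m \<in> grid_prob n"
  defines "\<mu> \<equiv> grid_measure n m"
begin

lemma \<mu>_prob: "\<mu> \<in> prob_measures"
  unfolding \<mu>_def using m by (rule grid_measure_prob)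

lemma h_pos: "0 < mesh n"
  using n by (rule mesh_pos)

lemma W1_\<mu>: "W1 \<mu> \<mu> = 0"
  unfolding \<mu>_def using m by (rule W1_grid_self)

lemma U_x_modulus: "\<bar>U_x U t x \<mu> - U_x U t y \<mu>\<bar> \<le> \<omega> (dist x y)"
  and U_xx_modulus: "\<bar>U_xx U t x \<mu> - U_xx U t y \<mu>\<bar> \<le> \<omega> (dist x y)"
proof -
  have dom: "(t, x, \<mu>) \<in> dom_txm T" for x
    using t \<mu>_prob by (auto simp: dom_txm_def)
  have mods: "modulus_wrt dist_txm (dom_txm T) (\<lambda>(t, x, m). U_x U t x m) \<omega>"
    "modulus_wrt dist_txm (dom_txm T) (\<lambda>(t, x, m). U_xx U t x m) \<omega>"
    using modulus by (auto simp: common_modulus_def)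
  show "\<bar>U_x U t x \<mu> - U_x U t y \<mu>\<bar> \<le> \<omega> (dist x y)"
    using mods(1) [unfolded modulus_wrt_def, rule_format, OF dom dom, of x y] by (simp add: dist_txm_def W1_\<mu>)
  show "\<bar>U_xx U t x \<mu> - U_xx U t y \<mu>\<bar> \<le> \<omega> (dist x y)"
    using mods(2) [unfolded modulus_wrt_def, rule_format, OF dom dom, of x y] by (simp add: dist_txm_def W1_\<mu>)
qed

lemma U_my_modulus: "\<bar>U_my U t x \<mu> y - U_my U t x \<mu> z\<bar> \<le> \<omega> (dist y z)"
  and U_myy_modulus: "\<bar>U_myy U t x \<mu> y - U_myy U t x \<mu> z\<bar> \<le> \<omega> (dist y z)"
proof -
  have dom: "(t, x, \<mu>, y) \<in> dom_txmy T" for x y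
    using t \<mu>_prob by (auto simp: dom_txmy_def)
  have mods: "modulus_wrt dist_txmy (dom_txmy T) (\<lambda>(t, x, m, y). U_my U t x m y) \<omega>"
    "modulus_wrt dist_txmy (dom_txmy T) (\<lambda>(t, x, m, y). U_myy U t x m y) \<omega>"
    using modulus by (auto simp: common_modulus_def)
  show "\<bar>U_my U t x \<mu> y - U_my U t x \<mu> z\<bar> \<le> \<omega> (dist y z)"
    using mods(1) [unfolded modulus_wrt_def, rule_format, OF dom dom, of x y x z] by (simp add: dist_txmy_def W1_\<mu>)
  show "\<bar>U_myy U t x \<mu> y - U_myy U t x \<mu> z\<bar> \<le> \<omega> (dist y z)"
    using mods(2) [unfolded modulus_wrt_def, rule_format, OF dom dom, of x y x z] by (simp add: dist_txmy_def W1_\<mu>)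
qed

lemma modulus_shift:
  assumes F: "\<And>x y. \<bar>F x - F y\<bar> \<le> \<omega> (dist x y)" and s: "\<bar>s\<bar> \<le> r"
  shows "\<bar>F (x + to_torus s) - F x\<bar> \<le> \<omega> r"
proof -
  have "\<bar>F (x + to_torus s) - F x\<bar> \<le> \<omega> (dist (x + to_torus s) x)" by (rule F)
  also have "\<dots> \<le> \<omega> r"
    using dist_torus_shift [of x s] s by (intro \<omega>_mono) auto
  finally show ?thesis .
qed

lemma diff_U: "differentiable_torus (\<lambda>z. U t z \<mu>)" "differentiable_torus (ddx (\<lambda>z. U t z \<mu>))"
  and ddx_U: "ddx (\<lambda>z. U t z \<mu>) x = U_x U t x \<mu>" "ddx (ddx (\<lambda>z. U t z \<mu>)) x = U_xx U t x \<mu>"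
  and diff_Um: "differentiable_torus (U_m U t x \<mu>)" "differentiable_torus (ddx (U_m U t x \<mu>))"
  and ddx_Um: "ddx (U_m U t x \<mu>) y = U_my U t x \<mu> y" "ddx (ddx (U_m U t x \<mu>)) y = U_myy U t x \<mu> y"
proof -
  have e: "ddx (\<lambda>z. U t z \<mu>) = (\<lambda>z. U_x U t z \<mu>)" "ddx (U_m U t x \<mu>) = U_my U t x \<mu>"
    by (auto simp: U_x_def U_my_def)
  show "differentiable_torus (\<lambda>z. U t z \<mu>)" "differentiable_torus (ddx (\<lambda>z. U t z \<mu>))"
    "differentiable_torus (U_m U t x \<mu>)" "differentiable_torus (ddx (U_m U t x \<mu>))"
    unfolding e using regular [OF t \<mu>_prob] by auto
  show "ddx (\<lambda>z. U t z \<mu>) x = U_x U t x \<mu>" "ddx (ddx (\<lambda>z. U t z \<mu>)) x = U_xx U t x \<mu>"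
    "ddx (U_m U t x \<mu>) y = U_my U t x \<mu> y" "ddx (ddx (U_m U t x \<mu>)) y = U_myy U t x \<mu> y"
    unfolding e by (auto simp: U_xx_def U_myy_def)
qed

lemma U_x_bound: "\<bar>U_x U t x \<mu>\<bar> \<le> \<omega> 1"
  using ddx_bound [OF diff_U(1), of x "\<omega> 1"] modulus_shift [OF U_x_modulus] by (simp add: ddx_U)

lemma U_my_bound: "\<bar>U_my U t x \<mu> y\<bar> \<le> \<omega> 1"
  using ddx_bound [OF diff_Um(1), of x y "\<omega> 1"] modulus_shift [OF U_my_modulus] by (simp add: ddx_Um)

lemma diff_fwd_U: "\<bar>diff_fwd n (\<lambda>z. U t z \<mu>) x - U_x U t x \<mu>\<bar> \<le> \<omega> (mesh n)"
  using fwd_difference_error [OF diff_U(1) h_pos, of x "\<omega> (mesh n)"] modulus_shift [OF U_x_modulus]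
  by (simp add: ddx_U diff_fwd_def)

lemma diff_bwd_U: "\<bar>diff_bwd n (\<lambda>z. U t z \<mu>) x + U_x U t x \<mu>\<bar> \<le> \<omega> (mesh n)"
  using bwd_difference_error [OF diff_U(1) h_pos, of x "\<omega> (mesh n)"] modulus_shift [OF U_x_modulus]
  by (simp add: ddx_U diff_bwd_def)

lemma diff_snd_U: "\<bar>diff_snd n (\<lambda>z. U t z \<mu>) x - U_xx U t x \<mu>\<bar> \<le> \<omega> (mesh n)"
  using second_difference_error [OF diff_U(1) h_pos diff_U(2), of x "\<omega> (mesh n)"] modulus_shift [OF U_xx_modulus]
  by (simp add: ddx_U diff_snd_def)

lemma diff_fwd_Um: "\<bar>diff_fwd n (U_m U t x \<mu>) y - U_my U t x \<mu> y\<bar> \<le> \<omega> (mesh n)"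
  using fwd_difference_error [OF diff_Um(1) h_pos, of x y "\<omega> (mesh n)"] modulus_shift [OF U_my_modulus]
  by (simp add: ddx_Um diff_fwd_def)

lemma diff_bwd_Um: "\<bar>diff_bwd n (U_m U t x \<mu>) y + U_my U t x \<mu> y\<bar> \<le> \<omega> (mesh n)"
  using bwd_difference_error [OF diff_Um(1) h_pos, of x y "\<omega> (mesh n)"] modulus_shift [OF U_my_modulus]
  by (simp add: ddx_Um diff_bwd_def)

lemma diff_snd_Um: "\<bar>diff_snd n (U_m U t x \<mu>) y - U_myy U t x \<mu> y\<bar> \<le> \<omega> (mesh n)"
  using second_difference_error [OF diff_Um(1) h_pos diff_Um(2), of x y "\<omega> (mesh n)"] modulus_shift [OF U_myy_modulus]
  by (simp add: ddx_Um diff_snd_def)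

lemma diff_fwd_U_bound: "\<bar>diff_fwd n (\<lambda>z. U t z \<mu>) x\<bar> \<le> \<omega> 1"
proof -
  obtain s where "U t (x + to_torus (mesh n)) \<mu> - U t x \<mu> = mesh n * U_x U t (x + to_torus s) \<mu>"
    using torus_mvt [OF diff_U(1) h_pos] unfolding ddx_U by blast
  then show ?thesis
    using U_x_bound h_pos by (simp add: diff_fwd_def)
qed

lemma diff_fwd_Um_bound: "\<bar>diff_fwd n (U_m U t x \<mu>) y\<bar> \<le> \<omega> 1"
proof -
  obtain s where "U_m U t x \<mu> (y + to_torus (mesh n)) - U_m U t x \<mu> y = mesh n * U_my U t x \<mu> (y + to_torus s)"
    using torus_mvt [OF diff_Um(1) h_pos] unfolding ddx_Um by blast
  then show ?thesis
    using U_my_bound h_pos by (simp add: diff_fwd_def)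
qed

lemma diff_bwd_U_bound: "\<bar>diff_bwd n (\<lambda>z. U t z \<mu>) x\<bar> \<le> \<omega> 1"
  by (simp add: fwd_bwd_diff diff_fwd_U_bound)

lemma diff_bwd_Um_bound: "\<bar>diff_bwd n (U_m U t x \<mu>) y\<bar> \<le> \<omega> 1"
  by (simp add: fwd_bwd_diff diff_fwd_Um_bound)

text \<open>A grid measure is a finite combination of Dirac masses, and the integrands are
  continuous by their moduli and by the regularity of the Hamiltonian.\<close>

lemma grid_master_equation:
  "- U_t t x \<mu> - \<sigma> * U_xx U t x \<mu> + hamiltonian L x (U_x U t x \<mu>)
    - (\<Sum>y\<in>grid n. m y * (\<sigma> * U_myy U t x \<mu> y - ddp (hamiltonian L) y (U_x U t y \<mu>) * U_my U t x \<mu> y)) = f \<mu> x"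
proof -
  have m0: "0 \<le> m y" for y using m by (simp add: grid_prob_def)
  have c1: "continuous_on UNIV (\<lambda>y. U_myy U t x \<mu> y)" "continuous_on UNIV (\<lambda>y. U_my U t x \<mu> y)"
    "continuous_on UNIV (\<lambda>y. U_x U t y \<mu>)"
    by (intro modulus_continuous_on [OF \<omega>_tendsto \<omega>_0] U_myy_modulus U_my_modulus U_x_modulus)+
  have "continuous_on UNIV (\<lambda>y. case (y, U_x U t y \<mu>) of (x, p) \<Rightarrow> ddp (hamiltonian L) x p)"
    by (rule continuous_on_compose2 [OF continuous_ddp_hamiltonian [OF L]]) (auto intro!: continuous_intros c1)
  then have "continuous_on UNIV (\<lambda>y. ddp (hamiltonian L) y (U_x U t y \<mu>) * U_my U t x \<mu> y)"
    by (intro continuous_on_mult c1) simp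
  note c2 = this
  have int: "(\<integral>y. F y \<partial>\<mu>) = (\<Sum>y\<in>grid n. m y * F y)" if "continuous_on UNIV F" for F :: "torus \<Rightarrow> real"
    unfolding \<mu>_def using that by (intro integral_grid_measure borel_measurable_continuous_onI m0)
  show ?thesis
    using master [OF t \<mu>_prob, of x] unfolding int [OF c1(1)] int [OF c2]
    by (simp add: right_diff_distrib sum_subtractf sum_distrib_left mult_ac)
qed

text \<open>The consistency error: the left-hand side of the discrete master equation at the
  restriction of \<open>U\<close>, where increments of the flat derivative stand for the derivatives
  tangent to the simplex.\<close>

definition residual :: "torus \<Rightarrow> real"
  where "residual x = - U_t t x \<mu>
    + ham_up L x (diff_fwd n (\<lambda>z. U t z \<mu>) x) + ham_down L x (- diff_bwd n (\<lambda>z. U t z \<mu>) x)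
    - \<sigma> * diff_snd n (\<lambda>z. U t z \<mu>) x - f \<mu> x
    - (\<Sum>y\<in>grid n. m y * (- ddp (ham_up L) y (diff_fwd n (\<lambda>z. U t z \<mu>) y) / mesh n + \<sigma> / (mesh n)\<^sup>2) *
        (U_m U t x \<mu> (y + to_torus (mesh n)) - U_m U t x \<mu> y))
    - (\<Sum>y\<in>grid n. m y * (ddp (ham_down L) y (- diff_bwd n (\<lambda>z. U t z \<mu>) y) / mesh n + \<sigma> / (mesh n)\<^sup>2) *
        (U_m U t x \<mu> (y - to_torus (mesh n)) - U_m U t x \<mu> y))"

text \<open>Each difference quotient is off by at most \<omega>(h). The errors in the measure
  variable are averaged against the weights of \<open>m\<close>, whose sum is one, so no factor
  \<open>n\<close> appears.\<close>

lemma residual_bound: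
  assumes K: "0 \<le> K" and R: "\<omega> 1 \<le> R"
    and lip: "\<And>x p q. \<bar>p\<bar> \<le> R + 1 \<Longrightarrow> \<bar>q\<bar> \<le> R + 1 \<Longrightarrow> \<bar>ham_up L x p - ham_up L x q\<bar> \<le> K * \<bar>p - q\<bar>"
    "\<And>x p q. \<bar>p\<bar> \<le> R + 1 \<Longrightarrow> \<bar>q\<bar> \<le> R + 1 \<Longrightarrow> \<bar>ham_down L x p - ham_down L x q\<bar> \<le> K * \<bar>p - q\<bar>"
    "\<And>x p q. \<bar>p\<bar> \<le> R + 1 \<Longrightarrow> \<bar>q\<bar> \<le> R + 1 \<Longrightarrow> \<bar>ddp (ham_up L) x p - ddp (ham_up L) x q\<bar> \<le> K * \<bar>p - q\<bar>"
    "\<And>x p q. \<bar>p\<bar> \<le> R + 1 \<Longrightarrow> \<bar>q\<bar> \<le> R + 1 \<Longrightarrow> \<bar>ddp (ham_down L) x p - ddp (ham_down L) x q\<bar> \<le> K * \<bar>p - q\<bar>"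
  shows "\<bar>residual x\<bar> \<le> (4 * K + 2 * \<sigma> + 2 * K * \<omega> 1) * \<omega> (mesh n)"
proof -
  define e where "e = \<omega> (mesh n)"
  have e0: "0 \<le> e" unfolding e_def using h_pos by (intro \<omega>_nonneg) simp
  have \<omega>1: "0 \<le> \<omega> 1" by (rule \<omega>_nonneg) simp
  define Fv where "Fv = diff_fwd n (\<lambda>z. U t z \<mu>)"
  define Bv where "Bv = diff_bwd n (\<lambda>z. U t z \<mu>)"
  define G where "G = (\<lambda>y. U_x U t y \<mu>)"
  have Gy: "U_x U t y \<mu> = G y" for y by (simp add: G_def)
  have bnd: "\<bar>Fv y\<bar> \<le> R + 1" "\<bar>- Bv y\<bar> \<le> R + 1" "\<bar>G y\<bar> \<le> R + 1" for y
    using R diff_fwd_U_bound [of y] diff_bwd_U_bound [of y] U_x_bound [of y]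
    by (auto simp: Fv_def Bv_def G_def)
  have close: "\<bar>Fv y - G y\<bar> \<le> e" "\<bar>- Bv y - G y\<bar> \<le> e" for y
    using diff_fwd_U [of y] diff_bwd_U [of y] by (auto simp: Fv_def Bv_def G_def e_def)
  have Ke: "K * \<bar>p - q\<bar> \<le> K * e" if "\<bar>p - q\<bar> \<le> e" for p q
    using that K by (rule mult_left_mono)
  have up: "\<bar>ham_up L y (Fv y) - ham_up L y (G y)\<bar> \<le> K * e"
    and down: "\<bar>ham_down L y (- Bv y) - ham_down L y (G y)\<bar> \<le> K * e"
    and up': "\<bar>ddp (ham_up L) y (Fv y) - ddp (ham_up L) y (G y)\<bar> \<le> K * e"
    and down': "\<bar>ddp (ham_down L) y (- Bv y) - ddp (ham_down L) y (G y)\<bar> \<le> K * e" for y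
    using lip(1) [OF bnd(1,3), of y y y] lip(2) [OF bnd(2,3), of y y y]
      lip(3) [OF bnd(1,3), of y y y] lip(4) [OF bnd(2,3), of y y y]
      Ke [OF close(1), of y] Ke [OF close(2), of y] by linarith+
  \<comment> \<open>The quotient lies within \<open>R\<close>, so a neighbourhood of size 1 stays in
    the range \<open>R + 1\<close> of the Lipschitz bounds.\<close>
  have upK: "\<bar>ddp (ham_up L) y (Fv y)\<bar> \<le> K" for y
  proof (rule DERIV_abs_le_lipschitz [OF DERIV_ham_up [OF L] zero_less_one])
    show "\<bar>ham_up L y q - ham_up L y (Fv y)\<bar> \<le> K * \<bar>q - Fv y\<bar>" if "\<bar>q - Fv y\<bar> \<le> 1" for q
      using that R diff_fwd_U_bound [of y] bnd(1) [of y] by (intro lip) (auto simp: Fv_def)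
  qed
  have downK: "\<bar>ddp (ham_down L) y (- Bv y)\<bar> \<le> K" for y
  proof (rule DERIV_abs_le_lipschitz [OF DERIV_ham_down [OF L] zero_less_one])
    show "\<bar>ham_down L y q - ham_down L y (- Bv y)\<bar> \<le> K * \<bar>q - (- Bv y)\<bar>" if "\<bar>q - (- Bv y)\<bar> \<le> 1" for q
      using that R diff_bwd_U_bound [of y] bnd(2) [of y] by (intro lip) (auto simp: Bv_def)
  qed
  define g where "g = U_my U t x \<mu>"
  define F where "F = diff_fwd n (U_m U t x \<mu>)"
  define B where "B = diff_bwd n (U_m U t x \<mu>)"
  define S where "S = diff_snd n (U_m U t x \<mu>)"
  \<comment> \<open>The error of the measure term at a single grid point: three quotients of
    \<open>U_m\<close> against its derivatives, and the drift at the quotients of \<open>U\<close>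
    against the drift at \<open>U_x\<close>.\<close>
  define \<tau> where "\<tau> = (\<lambda>y. - ddp (ham_up L) y (Fv y) * (F y - g y) + ddp (ham_down L) y (- Bv y) * (B y + g y)
     + \<sigma> * (S y - U_myy U t x \<mu> y)
     - g y * ((ddp (ham_up L) y (Fv y) - ddp (ham_up L) y (G y)) + (ddp (ham_down L) y (- Bv y) - ddp (ham_down L) y (G y))))"
  have \<tau>_bound: "\<bar>\<tau> y\<bar> \<le> (2 * K + \<sigma> + 2 * K * \<omega> 1) * e" for y
  proof -
    have "\<bar>- ddp (ham_up L) y (Fv y) * (F y - g y)\<bar> \<le> K * e"
      unfolding abs_mult using upK [of y] diff_fwd_Um [of x y] K by (intro mult_mono) (auto simp: F_def g_def e_def)
    moreover have "\<bar>ddp (ham_down L) y (- Bv y) * (B y + g y)\<bar> \<le> K * e"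
      unfolding abs_mult using downK [of y] diff_bwd_Um [of x y] K by (intro mult_mono) (auto simp: B_def g_def e_def)
    moreover have "\<bar>\<sigma> * (S y - U_myy U t x \<mu> y)\<bar> \<le> \<sigma> * e"
      unfolding abs_mult using diff_snd_Um [of x y] \<sigma> by (intro mult_mono) (auto simp: S_def e_def)
    moreover have "\<bar>g y * ((ddp (ham_up L) y (Fv y) - ddp (ham_up L) y (G y)) + (ddp (ham_down L) y (- Bv y) - ddp (ham_down L) y (G y)))\<bar>
        \<le> \<omega> 1 * (2 * (K * e))"
      unfolding abs_mult using up' [of y] down' [of y] U_my_bound [of x y] \<omega>1 by (intro mult_mono) (auto simp: g_def)
    ultimately have "\<bar>\<tau> y\<bar> \<le> K * e + K * e + \<sigma> * e + \<omega> 1 * (2 * (K * e))"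
      unfolding \<tau>_def by linarith
    then show ?thesis by (simp add: algebra_simps)
  qed
  have m: "\<And>y. 0 \<le> m y" "sum m (grid n) = 1" using m by (auto simp: grid_prob_def)
  have "\<bar>\<Sum>y\<in>grid n. m y * \<tau> y\<bar> \<le> (\<Sum>y\<in>grid n. m y * ((2 * K + \<sigma> + 2 * K * \<omega> 1) * e))"
    using \<tau>_bound m(1) by (intro order_trans [OF sum_abs] sum_mono) (auto simp: abs_mult intro!: mult_left_mono)
  also have "\<dots> = (2 * K + \<sigma> + 2 * K * \<omega> 1) * e"
    using m(2) by (simp flip: sum_distrib_right)
  finally have sum: "\<bar>\<Sum>y\<in>grid n. m y * \<tau> y\<bar> \<le> (2 * K + \<sigma> + 2 * K * \<omega> 1) * e" .
  have term_eq: "m y * (- ddp (ham_up L) y (Fv y) / mesh n + \<sigma> / (mesh n)\<^sup>2) * (U_m U t x \<mu> (y + to_torus (mesh n)) - U_m U t x \<mu> y)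
      + m y * (ddp (ham_down L) y (- Bv y) / mesh n + \<sigma> / (mesh n)\<^sup>2) * (U_m U t x \<mu> (y - to_torus (mesh n)) - U_m U t x \<mu> y)
      - m y * (\<sigma> * U_myy U t x \<mu> y - ddp (hamiltonian L) y (U_x U t y \<mu>) * U_my U t x \<mu> y) = m y * \<tau> y" for y
  proof -
    have h: "mesh n \<noteq> 0" using h_pos by simp
    have FB: "U_m U t x \<mu> (y + to_torus (mesh n)) - U_m U t x \<mu> y = mesh n * F y"
      "U_m U t x \<mu> (y - to_torus (mesh n)) - U_m U t x \<mu> y = mesh n * B y"
      using h by (auto simp: F_def B_def diff_fwd_def diff_bwd_def)
    have S: "S y = (F y + B y) / mesh n" by (simp add: S_def F_def B_def diff_snd_eq)
    \<comment> \<open>The singular factors of the jump rates cancel: the drift meets a first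
      difference quotient, and the two diffusive jumps together form a second one.\<close>
    have "(a / mesh n + \<sigma> / (mesh n)\<^sup>2) * (mesh n * c) = a * c + \<sigma> * (c / mesh n)" for a c
      using h by (simp add: power2_eq_square distrib_right)
    note rate = this
    have rates: "m y * (- ddp (ham_up L) y (Fv y) / mesh n + \<sigma> / (mesh n)\<^sup>2) * (mesh n * F y)
      + m y * (ddp (ham_down L) y (- Bv y) / mesh n + \<sigma> / (mesh n)\<^sup>2) * (mesh n * B y)
      = m y * (- ddp (ham_up L) y (Fv y) * F y + ddp (ham_down L) y (- Bv y) * B y + \<sigma> * S y)"
      unfolding S mult.assoc rate by (simp add: algebra_simps add_divide_distrib)
    show ?thesis
      unfolding FB rates \<tau>_def ddp_hamiltonian_split [OF L] Gy g_def [symmetric]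
      by (simp add: algebra_simps)
  qed
  have "residual x = (ham_up L x (Fv x) - ham_up L x (G x)) + (ham_down L x (- Bv x) - ham_down L x (G x))
      - \<sigma> * (diff_snd n (\<lambda>z. U t z \<mu>) x - U_xx U t x \<mu>) - (\<Sum>y\<in>grid n. m y * \<tau> y)"
    using grid_master_equation [of x]
    unfolding residual_def Fv_def [symmetric] Bv_def [symmetric] term_eq [symmetric] sum.distrib sum_subtractf
      hamiltonian_split [OF L] Gy
    by (simp add: right_diff_distrib)
  moreover have "\<bar>\<sigma> * (diff_snd n (\<lambda>z. U t z \<mu>) x - U_xx U t x \<mu>)\<bar> \<le> \<sigma> * e"
    unfolding abs_mult using diff_snd_U [of x] \<sigma> by (intro mult_mono) (auto simp: e_def)
  ultimately have "\<bar>residual x\<bar> \<le> K * e + K * e + \<sigma> * e + (2 * K + \<sigma> + 2 * K * \<omega> 1) * e"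
    using up [of x] down [of x] sum by linarith
  then show ?thesis by (simp add: e_def algebra_simps)
qed

end

lemma restriction_continuous:
  "continuous_wrt (dist_tm n) ({0..T} \<times> grid_prob n) (\<lambda>(t, m). U t x (grid_measure n m))"
  unfolding continuous_wrt_def
proof (intro ballI allI impI)
  fix p and e :: real assume p: "p \<in> {0..T} \<times> grid_prob n" and e: "0 < e"
  obtain t m where tm: "p = (t, m)" "t \<in> {0..T}" "m \<in> grid_prob n" using p by auto
  have "(t, x, grid_measure n m) \<in> dom_txm T"
    using tm grid_measure_prob by (auto simp: dom_txm_def)
  then obtain d where d: "0 < d" "\<And>q. q \<in> dom_txm T \<Longrightarrow> dist_txm (t, x, grid_measure n m) q < d \<Longrightarrow>
      \<bar>(case (t, x, grid_measure n m) of (t, x, m) \<Rightarrow> U t x m) - (case q of (t, x, m) \<Rightarrow> U t x m)\<bar> < e"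
    using cont_U e unfolding continuous_wrt_def by blast
  have "\<bar>U t x (grid_measure n m) - U t' x (grid_measure n m')\<bar> < e"
    if t': "t' \<in> {0..T}" and m': "m' \<in> grid_prob n" and dist: "dist_tm n (t, m) (t', m') < d" for t' m'
  proof -
    have "(t', x, grid_measure n m') \<in> dom_txm T"
      using t' m' grid_measure_prob by (auto simp: dom_txm_def)
    moreover have "dist_txm (t, x, grid_measure n m) (t', x, grid_measure n m') < d"
      using dist W1_grid_le [OF tm(3) m'] by (simp add: dist_txm_def dist_tm_def)
    ultimately show ?thesis using d(2) [of "(t', x, grid_measure n m')"] by simp
  qed
  then show "\<exists>\<delta>>0. \<forall>b\<in>{0..T} \<times> grid_prob n. dist_tm n p b < \<delta> \<longrightarrow>
      \<bar>(case p of (t, m) \<Rightarrow> U t x (grid_measure n m)) - (case b of (t, m) \<Rightarrow> U t x (grid_measure n m))\<bar> < e"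
    unfolding tm(1) using d(1) by (intro exI [of _ d]) auto
qed

lemma restriction_transfer:
  assumes t: "t \<in> {0..T}" and m: "m \<in> grid_prob n"
    and y: "y \<in> grid n" and z: "z \<in> grid n" and pos: "0 < m y"
  shows "((\<lambda>\<theta>. (U t x (grid_measure n (transfer_mass m y z \<theta>)) - U t x (grid_measure n m)) / \<theta>)
    \<longlongrightarrow> U_m U t x (grid_measure n m) z - U_m U t x (grid_measure n m) y) (at_right 0)"
proof (rule transfer_derivative [where F = "\<lambda>m. U t x (grid_measure n m)" and D = "\<lambda>m y. U_m U t x (grid_measure n m) y", OF _ _ _ m y z pos])
  show "continuous_wrt (weight_dist n) (grid_prob n) (\<lambda>m. U t x (grid_measure n m))"
    unfolding continuous_wrt_def
  proof (intro ballI allI impI)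
    fix m and e :: real assume m: "m \<in> grid_prob n" and e: "0 < e"
    then obtain d where d: "0 < d" "\<And>q. q \<in> {0..T} \<times> grid_prob n \<Longrightarrow> dist_tm n (t, m) q < d \<Longrightarrow>
        \<bar>(case (t, m) of (t, m) \<Rightarrow> U t x (grid_measure n m)) - (case q of (t, m) \<Rightarrow> U t x (grid_measure n m))\<bar> < e"
      using restriction_continuous [of n x] t unfolding continuous_wrt_def by blast
    have "\<bar>U t x (grid_measure n m) - U t x (grid_measure n m')\<bar> < e" if "m' \<in> grid_prob n" "weight_dist n m m' < d" for m'
      using d(2) [of "(t, m')"] that t by (simp add: dist_tm_def weight_dist_def)
    then show "\<exists>\<delta>>0. \<forall>b\<in>grid_prob n. weight_dist n m b < \<delta> \<longrightarrow> \<bar>U t x (grid_measure n m) - U t x (grid_measure n b)\<bar> < e"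
      using d(1) by blast
  qed
  show "continuous_wrt (weight_dist n) (grid_prob n) (\<lambda>m. U_m U t x (grid_measure n m) y)"
    unfolding continuous_wrt_def
  proof (intro ballI allI impI)
    fix m and e :: real assume m: "m \<in> grid_prob n" and e: "0 < e"
    have "(t, x, grid_measure n m, y) \<in> dom_txmy T"
      using t m grid_measure_prob by (auto simp: dom_txmy_def)
    then obtain d where d: "0 < d" "\<And>q. q \<in> dom_txmy T \<Longrightarrow> dist_txmy (t, x, grid_measure n m, y) q < d \<Longrightarrow>
        \<bar>(case (t, x, grid_measure n m, y) of (t, x, m, y) \<Rightarrow> U_m U t x m y) - (case q of (t, x, m, y) \<Rightarrow> U_m U t x m y)\<bar> < e"
      using cont_Um e unfolding continuous_wrt_def by blast
    have "\<bar>U_m U t x (grid_measure n m) y - U_m U t x (grid_measure n m') y\<bar> < e"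
      if m': "m' \<in> grid_prob n" and dist: "weight_dist n m m' < d" for m'
    proof -
      have "(t, x, grid_measure n m', y) \<in> dom_txmy T"
        using t m' grid_measure_prob by (auto simp: dom_txmy_def)
      moreover have "dist_txmy (t, x, grid_measure n m, y) (t, x, grid_measure n m', y) < d"
        using dist W1_grid_le [OF m m'] by (simp add: dist_txmy_def weight_dist_def)
      ultimately show ?thesis using d(2) [of "(t, x, grid_measure n m', y)"] by simp
    qed
    then show "\<exists>\<delta>>0. \<forall>b\<in>grid_prob n. weight_dist n m b < \<delta> \<longrightarrow>
        \<bar>U_m U t x (grid_measure n m) y - U_m U t x (grid_measure n b) y\<bar> < e"
      using d(1) by blast
  qed
  fix m y assume m: "m \<in> grid_prob n" and y: "y \<in> grid n"
  have "(flat_quotient (U t x) (grid_measure n m) y \<longlongrightarrow> U_m U t x (grid_measure n m) y) (at_right 0)"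
    using regular [OF t grid_measure_prob [OF m]] by (auto simp: flat_differentiable_at_def U_m_def)
  moreover have "eventually (\<lambda>\<theta>. \<theta> \<in> {0<..<1}) (at_right (0 :: real))"
    by (rule eventually_at_right_real) simp
  then have "eventually (\<lambda>\<theta>. flat_quotient (U t x) (grid_measure n m) y \<theta> =
      (U t x (grid_measure n (mix_weights m y \<theta>)) - U t x (grid_measure n m)) / \<theta>) (at_right 0)"
  proof eventually_elim
    case (elim \<theta>)
    then have "mixture \<theta> (grid_measure n m) (return borel y) = grid_measure n (mix_weights m y \<theta>)"
      unfolding mix_weights_def using m y by (intro mixture_grid_measure) (auto simp: grid_prob_def)
    then show ?case by (simp add: flat_quotient_def)
  qed
  ultimately show "((\<lambda>\<theta>. (U t x (grid_measure n (mix_weights m y \<theta>)) - U t x (grid_measure n m)) / \<theta>)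
      \<longlongrightarrow> U_m U t x (grid_measure n m) y) (at_right 0)"
    by (rule Lim_transform_eventually)
qed

end

section \<open>The convergence rate\<close>

text \<open>Lets \<epsilon> decrease to \<omega>(1/n), which may itself be zero and is then not
  admissible in the barriers.\<close>

lemma le_mult_limit:
  fixes y a b c :: real
  assumes "\<And>\<epsilon>. a < \<epsilon> \<Longrightarrow> \<epsilon> < b \<Longrightarrow> y \<le> \<epsilon> * c" and "a < b"
  shows "y \<le> a * c"
proof (rule tendsto_lowerbound)
  show "((\<lambda>\<epsilon>. \<epsilon> * c) \<longlongrightarrow> a * c) (at_right a)"
    by (intro tendsto_intros)
  show "eventually (\<lambda>\<epsilon>. y \<le> \<epsilon> * c) (at_right a)"
    using eventually_at_right_real [OF assms(2)] by eventually_elim (use assms(1) in auto)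
qed simp

context master_equation
begin

text \<open>In the difference of two products of rate and increment, the rates of \<open>u\<close>
  are kept in front of the increments of \<open>w_m\<close>, and the rate differences then multiply
  increments of \<open>U_m\<close>, which are at most \<omega>(1) h. Hence \<open>K\<close> depends
  on the radius \<open>R\<close> but neither on \<open>n\<close> nor on \<open>u\<close>.\<close>

lemma error_equation:
  assumes R: "0 \<le> R"
  obtains K where "0 \<le> K" and "\<And>n u. 1 \<le> n \<Longrightarrow> discrete_master_classical_solution n \<sigma> T L f g u \<Longrightarrow>
    \<exists>w_t a \<rho> w_m P N. linearised_equation n \<sigma> T (\<lambda>t x m. u t x m - restrict_to_grid n U t x m) w_t a \<rho> w_m P N K R (\<omega> (1 / real n))"
proof -
  have \<omega>1: "0 \<le> \<omega> 1" by (rule \<omega>_nonneg) simp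
  obtain K where K: "0 \<le> K" and lip:
    "\<And>x p q. \<bar>p\<bar> \<le> \<omega> 1 + R + 1 \<Longrightarrow> \<bar>q\<bar> \<le> \<omega> 1 + R + 1 \<Longrightarrow> \<bar>ham_up L x p - ham_up L x q\<bar> \<le> K * \<bar>p - q\<bar>"
    "\<And>x p q. \<bar>p\<bar> \<le> \<omega> 1 + R + 1 \<Longrightarrow> \<bar>q\<bar> \<le> \<omega> 1 + R + 1 \<Longrightarrow> \<bar>ham_down L x p - ham_down L x q\<bar> \<le> K * \<bar>p - q\<bar>"
    "\<And>x p q. \<bar>p\<bar> \<le> \<omega> 1 + R + 1 \<Longrightarrow> \<bar>q\<bar> \<le> \<omega> 1 + R + 1 \<Longrightarrow> \<bar>ddp (ham_up L) x p - ddp (ham_up L) x q\<bar> \<le> K * \<bar>p - q\<bar>"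
    "\<And>x p q. \<bar>p\<bar> \<le> \<omega> 1 + R + 1 \<Longrightarrow> \<bar>q\<bar> \<le> \<omega> 1 + R + 1 \<Longrightarrow> \<bar>ddp (ham_down L) x p - ddp (ham_down L) x q\<bar> \<le> K * \<bar>p - q\<bar>"
    by (rule ham_lipschitz [OF L, of "\<omega> 1 + R + 1"]) (rule that; blast)
  \<comment> \<open>The constant of \<open>residual_bound\<close>; it also dominates those for the
    Hamiltonian terms and for the rate differences.\<close>
  define K' where "K' = 4 * K + 2 * \<sigma> + 2 * K * \<omega> 1"
  have K': "0 \<le> K'" "2 * K \<le> K'" "2 * K * \<omega> 1 \<le> K'"
    using K \<sigma> \<omega>1 by (auto simp: K'_def)
  have "\<exists>w_t a \<rho> w_m P N. linearised_equation n \<sigma> T (\<lambda>t x m. u t x m - restrict_to_grid n U t x m) w_t a \<rho> w_m P N K' R (\<omega> (1 / real n))"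
    if n: "1 \<le> n" and u: "discrete_master_classical_solution n \<sigma> T L f g u" for n u
  proof -
    obtain u_t u_m where
      C1: "\<And>x. x \<in> grid n \<Longrightarrow> C1_with_derivs n T (\<lambda>t m. u t x m) (\<lambda>t m. u_t t x m) (\<lambda>t m. u_m t x m)"
      and eq: "\<And>t x m. t \<in> {0..T} \<Longrightarrow> x \<in> grid n \<Longrightarrow> m \<in> grid_prob n \<Longrightarrow>
         - u_t t x m
         + ham_up L x (diff_fwd n (\<lambda>z. u t z m) x)
         + ham_down L x (- diff_bwd n (\<lambda>z. u t z m) x)
         - \<sigma> * diff_snd n (\<lambda>z. u t z m) x
         - f (grid_measure n m) x
         - (\<Sum>y\<in>grid n. m y * (control_up n L u t y m / mesh n + \<sigma> / (mesh n)\<^sup>2) *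
              (u_m t x m (y + to_torus (mesh n)) - u_m t x m y))
         - (\<Sum>y\<in>grid n. m y * (control_down n L u t y m / mesh n + \<sigma> / (mesh n)\<^sup>2) *
              (u_m t x m (y - to_torus (mesh n)) - u_m t x m y)) = 0"
      and final: "\<And>x m. x \<in> grid n \<Longrightarrow> m \<in> grid_prob n \<Longrightarrow> u T x m = g (grid_measure n m) x"
      using u unfolding discrete_master_classical_solution_def by blast
    define h where "h = mesh n"
    have h: "0 < h" unfolding h_def using n by (rule mesh_pos)
    define \<mu> where "\<mu> = grid_measure n"
    define v where "v = (\<lambda>t x m. U t x (\<mu> m))"
    define v_m where "v_m = (\<lambda>t x m. U_m U t x (\<mu> m))"
    define w where "w = (\<lambda>t x m. u t x m - v t x m)"
    define w_m where "w_m = (\<lambda>t x m y. u_m t x m y - v_m t x m y)"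
    define a where "a = (\<lambda>t x m. (ham_up L x (diff_fwd n (\<lambda>z. u t z m) x) - ham_up L x (diff_fwd n (\<lambda>z. v t z m) x))
      + (ham_down L x (- diff_bwd n (\<lambda>z. u t z m) x) - ham_down L x (- diff_bwd n (\<lambda>z. v t z m) x)))"
    define P where "P = (\<lambda>t y m. control_up n L u t y m / h + \<sigma> / h\<^sup>2)"
    define N where "N = (\<lambda>t y m. control_down n L u t y m / h + \<sigma> / h\<^sup>2)"
    define Pv where "Pv = (\<lambda>t y m. control_up n L v t y m / h + \<sigma> / h\<^sup>2)"
    define Nv where "Nv = (\<lambda>t y m. control_down n L v t y m / h + \<sigma> / h\<^sup>2)"
    define \<rho> where "\<rho> = (\<lambda>t x m. residual n t m x
      - (\<Sum>y\<in>grid n. m y * (P t y m - Pv t y m) * (v_m t x m (y + to_torus h) - v_m t x m y))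
      - (\<Sum>y\<in>grid n. m y * (N t y m - Nv t y m) * (v_m t x m (y - to_torus h) - v_m t x m y)))"
    have fwd_w: "diff_fwd n (\<lambda>z. w t z m) x = diff_fwd n (\<lambda>z. u t z m) x - diff_fwd n (\<lambda>z. v t z m) x"
      and bwd_w: "diff_bwd n (\<lambda>z. w t z m) x = diff_bwd n (\<lambda>z. u t z m) x - diff_bwd n (\<lambda>z. v t z m) x"
      and snd_w: "diff_snd n (\<lambda>z. w t z m) x = diff_snd n (\<lambda>z. u t z m) x - diff_snd n (\<lambda>z. v t z m) x" for t x m
      by (simp_all add: diff_fwd_def diff_bwd_def diff_snd_def w_def diff_divide_distrib [symmetric] algebra_simps)
    have "linearised_equation n \<sigma> T w (\<lambda>t x m. u_t t x m - U_t t x (\<mu> m)) a \<rho> w_m P N K' R (\<omega> (1 / real n))"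
    proof (rule linearised_equation.intro)
      show "1 \<le> n" "0 < \<sigma>" "0 < T" "0 \<le> K'" "0 \<le> \<omega> (1 / real n)"
        using n \<sigma> T K' by (auto intro: \<omega>_nonneg)
    next
      fix x assume x: "x \<in> grid n"
      have "continuous_on ({0..T} \<times> grid_prob n) (\<lambda>(t, m). u t x m)"
        by (rule continuous_wrt_dist_tm [OF C1_with_derivs_continuous [OF C1 [OF x]]])
      moreover have "continuous_on ({0..T} \<times> grid_prob n) (\<lambda>(t, m). v t x m)"
        unfolding v_def \<mu>_def by (rule continuous_wrt_dist_tm [OF restriction_continuous])
      ultimately show "continuous_on ({0..T} \<times> grid_prob n) (\<lambda>(t, m). w t x m)"
        unfolding w_def case_prod_unfold by (rule continuous_on_diff)
    next
      fix t x m assume t: "t \<in> {0..T}" and x: "x \<in> grid n" and m: "m \<in> grid_prob n"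
      show "((\<lambda>s. w s x m) has_real_derivative u_t t x m - U_t t x (\<mu> m)) (at t within {0..T})"
        unfolding w_def v_def using C1_with_derivs_time [OF C1 [OF x] t m] regular [OF t grid_measure_prob [OF m]]
        by (auto simp: \<mu>_def intro!: DERIV_diff)
    next
      fix t x m y z assume t: "t \<in> {0..T}" and x: "x \<in> grid n" and m: "m \<in> grid_prob n"
        and y: "y \<in> grid n" and z: "z \<in> grid n" and pos: "0 < m y"
      have "((\<lambda>\<theta>. (u t x (transfer_mass m y z \<theta>) - u t x m) / \<theta> - (v t x (transfer_mass m y z \<theta>) - v t x m) / \<theta>)
          \<longlongrightarrow> (u_m t x m z - u_m t x m y) - (v_m t x m z - v_m t x m y)) (at_right 0)"
        unfolding v_def v_m_def \<mu>_def
        by (intro tendsto_diff C1_with_derivs_transfer [OF C1 [OF x]] restriction_transfer t m y z pos)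
      then show "((\<lambda>\<theta>. (w t x (transfer_mass m y z \<theta>) - w t x m) / \<theta>) \<longlongrightarrow> w_m t x m z - w_m t x m y) (at_right 0)"
        by (simp add: w_def w_m_def diff_divide_distrib [symmetric] algebra_simps)
    next
      fix x m assume "x \<in> grid n" "m \<in> grid_prob n"
      then show "w T x m = 0"
        using final terminal grid_measure_prob by (simp add: w_def v_def \<mu>_def)
    next
      fix t x m assume t: "t \<in> {0..T}" and x: "x \<in> grid n" and m: "m \<in> grid_prob n"
      define X where "X = (\<lambda>(q :: real \<Rightarrow> torus \<Rightarrow> (torus \<Rightarrow> real) \<Rightarrow> real) (F :: torus \<Rightarrow> real). \<Sum>y\<in>grid n. m y * q t y m * (F (y + to_torus h) - F y))"
      define Y where "Y = (\<lambda>(q :: real \<Rightarrow> torus \<Rightarrow> (torus \<Rightarrow> real) \<Rightarrow> real) (F :: torus \<Rightarrow> real). \<Sum>y\<in>grid n. m y * q t y m * (F (y - to_torus h) - F y))"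
      have X: "X P (w_m t x m) = X P (u_m t x m) - X P (v_m t x m)"
        "X (\<lambda>t y m. P t y m - Pv t y m) (v_m t x m) = X P (v_m t x m) - X Pv (v_m t x m)"
        unfolding X_def w_m_def sum_subtractf [symmetric] by (auto intro!: sum.cong simp: algebra_simps)
      have Y: "Y N (w_m t x m) = Y N (u_m t x m) - Y N (v_m t x m)"
        "Y (\<lambda>t y m. N t y m - Nv t y m) (v_m t x m) = Y N (v_m t x m) - Y Nv (v_m t x m)"
        unfolding Y_def w_m_def sum_subtractf [symmetric] by (auto intro!: sum.cong simp: algebra_simps)
      have "u_t t x m = ham_up L x (diff_fwd n (\<lambda>z. u t z m) x) + ham_down L x (- diff_bwd n (\<lambda>z. u t z m) x)
         - \<sigma> * diff_snd n (\<lambda>z. u t z m) x - f (\<mu> m) x - X P (u_m t x m) - Y N (u_m t x m)"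
        using eq [OF t x m] by (simp add: X_def Y_def P_def N_def h_def \<mu>_def)
      moreover have "U_t t x (\<mu> m) = ham_up L x (diff_fwd n (\<lambda>z. v t z m) x) + ham_down L x (- diff_bwd n (\<lambda>z. v t z m) x)
         - \<sigma> * diff_snd n (\<lambda>z. v t z m) x - f (\<mu> m) x - X Pv (v_m t x m) - Y Nv (v_m t x m) - residual n t m x"
        unfolding residual_def [OF n t m]
        by (simp add: X_def Y_def Pv_def Nv_def h_def \<mu>_def control_up_def control_down_def v_def v_m_def)
      ultimately have "u_t t x m - U_t t x (\<mu> m) = a t x m - \<sigma> * diff_snd n (\<lambda>z. w t z m) x
        - X P (w_m t x m) - Y N (w_m t x m)
        + (residual n t m x - X (\<lambda>t y m. P t y m - Pv t y m) (v_m t x m) - Y (\<lambda>t y m. N t y m - Nv t y m) (v_m t x m))"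
        unfolding X Y snd_w a_def by (simp add: algebra_simps)
      then show "u_t t x m - U_t t x (\<mu> m) = a t x m - \<sigma> * diff_snd n (\<lambda>z. w t z m) x
        - (\<Sum>y\<in>grid n. m y * P t y m * (w_m t x m (y + to_torus (mesh n)) - w_m t x m y))
        - (\<Sum>y\<in>grid n. m y * N t y m * (w_m t x m (y - to_torus (mesh n)) - w_m t x m y))
        + \<rho> t x m"
        by (simp add: X_def Y_def \<rho>_def h_def)
    next
      fix t y m
      show "0 \<le> P t y m"
        unfolding P_def control_up_def using h \<sigma> ddp_ham_up_nonpos [OF L]
        by (intro add_nonneg_nonneg divide_nonneg_pos) auto
      show "0 \<le> N t y m"
        unfolding N_def control_down_def using h \<sigma> ddp_ham_down_nonneg [OF L]
        by (intro add_nonneg_nonneg divide_nonneg_pos) auto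
    next
      fix t x m assume "diff_fwd n (\<lambda>z. w t z m) x \<le> 0" "diff_bwd n (\<lambda>z. w t z m) x \<le> 0"
      then show "0 \<le> a t x m"
        unfolding a_def fwd_w bwd_w
        by (intro add_nonneg_nonneg) (auto intro: ham_up_antimono [OF L] ham_down_mono [OF L])
    next
      fix t x m assume "0 \<le> diff_fwd n (\<lambda>z. w t z m) x" "0 \<le> diff_bwd n (\<lambda>z. w t z m) x"
      then show "a t x m \<le> 0"
        unfolding a_def fwd_w bwd_w
        by (intro add_nonpos_nonpos) (auto intro: ham_up_antimono [OF L] ham_down_mono [OF L])
    next
      fix t x m G assume t: "t \<in> {0..T}" and x: "x \<in> grid n" and m: "m \<in> grid_prob n" and GR: "G \<le> R"
        and G: "\<And>y. y \<in> grid n \<Longrightarrow> \<bar>diff_fwd n (\<lambda>z. w t z m) y\<bar> \<le> G"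
      have G0: "0 \<le> G" using G [OF x] by linarith
      have Gb: "\<bar>diff_bwd n (\<lambda>z. w t z m) y\<bar> \<le> G" if "y \<in> grid n" for y
        using G [OF grid_shift(2) [OF n that]] by (simp add: fwd_bwd_diff)
      have vb: "\<bar>diff_fwd n (\<lambda>z. v t z m) y\<bar> \<le> \<omega> 1" "\<bar>diff_bwd n (\<lambda>z. v t z m) y\<bar> \<le> \<omega> 1" for y
        unfolding v_def \<mu>_def using diff_fwd_U_bound [OF n t m] diff_bwd_U_bound [OF n t m] by auto
      \<comment> \<open>The gradient of \<open>u\<close> is that of the restriction of
        \<open>U\<close>, at most \<omega>(1), plus that of the error, at most
        \<open>G \<le> R\<close>.\<close>
      have radius: "\<bar>diff_fwd n (\<lambda>z. u t z m) y\<bar> \<le> \<omega> 1 + R + 1" "\<bar>diff_fwd n (\<lambda>z. v t z m) y\<bar> \<le> \<omega> 1 + R + 1"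
        "\<bar>- diff_bwd n (\<lambda>z. u t z m) y\<bar> \<le> \<omega> 1 + R + 1" "\<bar>- diff_bwd n (\<lambda>z. v t z m) y\<bar> \<le> \<omega> 1 + R + 1"
        if "y \<in> grid n" for y
        using G [OF that] Gb [OF that] vb [of y] GR R unfolding fwd_w bwd_w by linarith+
      have KG: "k \<le> K * G" if "k \<le> K * \<bar>r\<bar>" "\<bar>r\<bar> \<le> G" for k r
        using that(1) mult_left_mono [OF that(2) K] by linarith
      have fw: "\<bar>diff_fwd n (\<lambda>z. u t z m) y - diff_fwd n (\<lambda>z. v t z m) y\<bar> \<le> G"
        "\<bar>- diff_bwd n (\<lambda>z. u t z m) y - - diff_bwd n (\<lambda>z. v t z m) y\<bar> \<le> G" if "y \<in> grid n" for y
        using G [OF that] Gb [OF that] unfolding fwd_w bwd_w by linarith+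
      have "\<bar>a t x m\<bar> \<le> K * G + K * G"
        unfolding a_def
        using KG [OF lip(1) [OF radius(1,2) [OF x], of x] fw(1) [OF x]] KG [OF lip(2) [OF radius(3,4) [OF x], of x] fw(2) [OF x]]
        by linarith
      also have "\<dots> \<le> K' * G" using mult_right_mono [OF K'(2) G0] by (simp add: algebra_simps)
      finally have 1: "\<bar>a t x m\<bar> \<le> K' * G" .
      have m0: "0 \<le> m y" and m1: "sum m (grid n) = 1" for y using m by (auto simp: grid_prob_def)
      have "\<bar>\<Sum>y\<in>grid n. m y * (P t y m - Pv t y m) * (v_m t x m (y + to_torus h) - v_m t x m y)\<bar>
          \<le> (\<Sum>y\<in>grid n. m y * (K * G * \<omega> 1))"
      proof (intro order_trans [OF sum_abs] sum_mono)
        fix y assume y: "y \<in> grid n"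
        have "(P t y m - Pv t y m) * (v_m t x m (y + to_torus h) - v_m t x m y) =
          - (ddp (ham_up L) y (diff_fwd n (\<lambda>z. u t z m) y) - ddp (ham_up L) y (diff_fwd n (\<lambda>z. v t z m) y))
            * diff_fwd n (v_m t x m) y"
          by (simp add: P_def Pv_def control_up_def diff_fwd_def h_def [symmetric] diff_divide_distrib [symmetric])
        also have "\<bar>\<dots>\<bar> \<le> K * G * \<omega> 1"
          unfolding abs_mult abs_minus_cancel
          using KG [OF lip(3) [OF radius(1,2) [OF y], of y] fw(1) [OF y]] diff_fwd_Um_bound [OF n t m, of x y] K G0
          by (intro mult_mono) (auto simp: v_m_def \<mu>_def)
        finally show "\<bar>m y * (P t y m - Pv t y m) * (v_m t x m (y + to_torus h) - v_m t x m y)\<bar> \<le> m y * (K * G * \<omega> 1)"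
          using m0 [of y] unfolding mult.assoc [of "m y"] abs_mult [of "m y"] by (simp add: mult_left_mono)
      qed
      also have "\<dots> = K * G * \<omega> 1" using m1 by (simp flip: sum_distrib_right)
      finally have 2: "\<bar>\<Sum>y\<in>grid n. m y * (P t y m - Pv t y m) * (v_m t x m (y + to_torus h) - v_m t x m y)\<bar> \<le> K * G * \<omega> 1" .
      have "\<bar>\<Sum>y\<in>grid n. m y * (N t y m - Nv t y m) * (v_m t x m (y - to_torus h) - v_m t x m y)\<bar>
          \<le> (\<Sum>y\<in>grid n. m y * (K * G * \<omega> 1))"
      proof (intro order_trans [OF sum_abs] sum_mono)
        fix y assume y: "y \<in> grid n"
        have "(N t y m - Nv t y m) * (v_m t x m (y - to_torus h) - v_m t x m y) =
          (ddp (ham_down L) y (- diff_bwd n (\<lambda>z. u t z m) y) - ddp (ham_down L) y (- diff_bwd n (\<lambda>z. v t z m) y))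
            * diff_bwd n (v_m t x m) y"
          by (simp add: N_def Nv_def control_down_def diff_bwd_def h_def [symmetric] diff_divide_distrib [symmetric])
        also have "\<bar>\<dots>\<bar> \<le> K * G * \<omega> 1"
          unfolding abs_mult
          using KG [OF lip(4) [OF radius(3,4) [OF y], of y] fw(2) [OF y]] diff_bwd_Um_bound [OF n t m, of x y] K G0
          by (intro mult_mono) (auto simp: v_m_def \<mu>_def)
        finally show "\<bar>m y * (N t y m - Nv t y m) * (v_m t x m (y - to_torus h) - v_m t x m y)\<bar> \<le> m y * (K * G * \<omega> 1)"
          using m0 [of y] unfolding mult.assoc [of "m y"] abs_mult [of "m y"] by (simp add: mult_left_mono)
      qed
      also have "\<dots> = K * G * \<omega> 1" using m1 by (simp flip: sum_distrib_right)
      finally have 3: "\<bar>\<Sum>y\<in>grid n. m y * (N t y m - Nv t y m) * (v_m t x m (y - to_torus h) - v_m t x m y)\<bar> \<le> K * G * \<omega> 1" .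
      have "\<bar>residual n t m x\<bar> \<le> K' * \<omega> (mesh n)"
        unfolding K'_def by (rule residual_bound [OF n t m K, of "\<omega> 1 + R"]) (use R lip in auto)
      then have "\<bar>\<rho> t x m\<bar> \<le> K' * \<omega> (mesh n) + K * G * \<omega> 1 + K * G * \<omega> 1"
        using 2 3 unfolding \<rho>_def by linarith
      also have "\<dots> \<le> K' * (\<omega> (mesh n) + G)"
        using mult_right_mono [OF K'(3) G0] by (simp add: algebra_simps)
      finally show "\<bar>a t x m\<bar> \<le> K' * G \<and> \<bar>\<rho> t x m\<bar> \<le> K' * (\<omega> (1 / real n) + G)"
        using 1 by (simp add: mesh_def)
    qed
    then show ?thesis
      unfolding w_def v_def \<mu>_def restrict_to_grid_def by blast
  qed
  with K'(1) show thesis by (rule that)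
qed

text \<open>The radius 1 is fixed beforehand, which determines \<open>K\<close> and with it
  \<open>l\<close> and the exponent \<open>c\<close>. For large \<open>n\<close> the mesh is below
  \<open>l\<close> and \<omega>(1/n) exp c is below 1, so the barrier never leaves that
  radius.\<close>

lemma convergence_rate_large:
  obtains C n0 where "0 \<le> C"
    "\<And>n u t x m. 1 \<le> n \<Longrightarrow> n0 \<le> n \<Longrightarrow> discrete_master_classical_solution n \<sigma> T L f g u \<Longrightarrow>
      t \<in> {0..T} \<Longrightarrow> x \<in> grid n \<Longrightarrow> m \<in> grid_prob n \<Longrightarrow>
      \<bar>u t x m - restrict_to_grid n U t x m\<bar> \<le> C * \<omega> (1 / real n) \<and>
      \<bar>diff_fwd n (\<lambda>z. u t z m - restrict_to_grid n U t z m) x\<bar> \<le> C * \<omega> (1 / real n)"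
proof -
  obtain K where K: "0 \<le> K" and lin: "\<And>n u. 1 \<le> n \<Longrightarrow> discrete_master_classical_solution n \<sigma> T L f g u \<Longrightarrow>
    \<exists>w_t a \<rho> w_m P N. linearised_equation n \<sigma> T (\<lambda>t x m. u t x m - restrict_to_grid n U t x m) w_t a \<rho> w_m P N K 1 (\<omega> (1 / real n))"
    by (rule error_equation [of 1]) (simp, rule that, blast+)
  define l where "l = 1 / (2 * ((3 * K + 1) / \<sigma>))"
  define c where "c = 8 * (2 * K + 1) / l * T"
  have l: "0 < l" using K \<sigma> by (simp add: l_def)
  have lim: "filterlim (\<lambda>n. 1 / real n) (at_right 0) sequentially"
    by (intro filterlim_at_right_0I lim_1_over_n) (auto intro: eventually_mono [OF eventually_gt_at_top [of 0]])
  have "eventually (\<lambda>r. \<omega> r < exp (- c)) (at_right 0)"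
    using \<omega>_tendsto by (rule order_tendstoD(2)) simp
  then have "eventually (\<lambda>r. \<omega> r < exp (- c) \<and> r < l) (at_right 0)"
    using eventually_at_right_real [OF l] by eventually_elim auto
  then have "eventually (\<lambda>n. \<omega> (1 / real n) < exp (- c) \<and> 1 / real n < l) sequentially"
    using lim by (rule eventually_compose_filterlim)
  then obtain n0 where n0: "\<And>n. n0 \<le> n \<Longrightarrow> \<omega> (1 / real n) < exp (- c) \<and> 1 / real n < l"
    unfolding eventually_sequentially by blast
  show thesis
  proof (rule that [of "(l / 8 + 1) * exp c" n0])
    show "0 \<le> (l / 8 + 1) * exp c" using l by simp
    fix n u t x m
    assume n: "1 \<le> n" "n0 \<le> n" and u: "discrete_master_classical_solution n \<sigma> T L f g u"
      and t: "t \<in> {0..T}" and x: "x \<in> grid n" and m: "m \<in> grid_prob n"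
    obtain w_t a \<rho> w_m P N where
      "linearised_equation n \<sigma> T (\<lambda>t x m. u t x m - restrict_to_grid n U t x m) w_t a \<rho> w_m P N K 1 (\<omega> (1 / real n))"
      using lin [OF n(1) u] by blast
    then interpret E: linearised_equation n \<sigma> T "\<lambda>t x m. u t x m - restrict_to_grid n U t x m" w_t a \<rho> w_m P N K 1 "\<omega> (1 / real n)" .
    have \<omega>0: "0 \<le> \<omega> (1 / real n)" by (rule \<omega>_nonneg) simp
    \<comment> \<open>The admissible range of \<epsilon> is nonempty by the choice of
      \<open>n0\<close>; its upper end is the smallness condition for the radius 1.\<close>
    have est: "\<bar>u t x m - restrict_to_grid n U t x m\<bar> \<le> \<epsilon> * (l / 8 * exp c)"
      "\<bar>diff_fwd n (\<lambda>z. u t z m - restrict_to_grid n U t z m) x\<bar> \<le> \<epsilon> * exp c"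
      if \<epsilon>: "\<omega> (1 / real n) < \<epsilon>" "\<epsilon> < exp (- c)" for \<epsilon>
    proof -
      have "mesh n \<le> l" using n0 [OF n(2)] by (simp add: mesh_def)
      moreover have "0 < \<epsilon>" using \<epsilon> \<omega>0 by simp
      moreover have "\<epsilon> * exp c \<le> 1" using \<epsilon>(2) by (simp add: exp_minus field_simps)
      ultimately show "\<bar>u t x m - restrict_to_grid n U t x m\<bar> \<le> \<epsilon> * (l / 8 * exp c)"
        "\<bar>diff_fwd n (\<lambda>z. u t z m - restrict_to_grid n U t z m) x\<bar> \<le> \<epsilon> * exp c"
        using E.uniform_error_bound [of \<epsilon> t x m, folded l_def, folded c_def] \<epsilon>(1) t x m by (auto simp: mult.assoc)
    qed
    have "\<bar>u t x m - restrict_to_grid n U t x m\<bar> \<le> \<omega> (1 / real n) * (l / 8 * exp c)"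
      by (rule le_mult_limit [OF est(1) conjunct1 [OF n0 [OF n(2)]]])
    moreover have "\<bar>diff_fwd n (\<lambda>z. u t z m - restrict_to_grid n U t z m) x\<bar> \<le> \<omega> (1 / real n) * exp c"
      by (rule le_mult_limit [OF est(2) conjunct1 [OF n0 [OF n(2)]]])
    moreover have "0 \<le> \<omega> (1 / real n) * exp c" "0 \<le> \<omega> (1 / real n) * (l / 8 * exp c)"
      using \<omega>0 l by auto
    ultimately show "\<bar>u t x m - restrict_to_grid n U t x m\<bar> \<le> (l / 8 + 1) * exp c * \<omega> (1 / real n) \<and>
      \<bar>diff_fwd n (\<lambda>z. u t z m - restrict_to_grid n U t z m) x\<bar> \<le> (l / 8 + 1) * exp c * \<omega> (1 / real n)"
      by (simp add: distrib_right distrib_left mult_ac)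
  qed
qed

text \<open>Only finitely many \<open>n\<close> are left for this bound, in which the constant may depend on \<open>n\<close>.\<close>

lemma convergence_rate_fixed:
  assumes n: "1 \<le> n" and u: "discrete_master_classical_solution n \<sigma> T L f g u"
  obtains C where "0 \<le> C"
    "\<And>t x m. t \<in> {0..T} \<Longrightarrow> x \<in> grid n \<Longrightarrow> m \<in> grid_prob n \<Longrightarrow>
      \<bar>u t x m - restrict_to_grid n U t x m\<bar> \<le> C * \<omega> (1 / real n) \<and>
      \<bar>diff_fwd n (\<lambda>z. u t z m - restrict_to_grid n U t z m) x\<bar> \<le> C * \<omega> (1 / real n)"
proof -
  define w where "w = (\<lambda>t x m. u t x m - restrict_to_grid n U t x m)"
  have lin: "\<exists>K w_t a \<rho> w_m P N. 0 \<le> K \<and> linearised_equation n \<sigma> T w w_t a \<rho> w_m P N K R (\<omega> (1 / real n))"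
    if "0 \<le> R" for R
    unfolding w_def by (rule error_equation [OF that]) (use n u in blast)
  have h: "0 < mesh n" using n by (rule mesh_pos)
  have "\<exists>M. \<forall>p\<in>{0..T} \<times> grid_prob n. \<bar>w (fst p) x (snd p)\<bar> \<le> M" if x: "x \<in> grid n" for x
  proof -
    \<comment> \<open>Any radius would do here, as only the continuity of \<open>w\<close> is
      extracted.\<close>
    obtain K w_t a \<rho> w_m P N where "linearised_equation n \<sigma> T w w_t a \<rho> w_m P N K 0 (\<omega> (1 / real n))"
      using lin [of 0] by auto
    then have "continuous_on ({0..T} \<times> grid_prob n) (\<lambda>(t, m). w t x m)"
      using linearised_equation.cont x by blast
    then have "compact ((\<lambda>p. w (fst p) x (snd p)) ` ({0..T} \<times> grid_prob n))"
      by (intro compact_continuous_image compact_Times compact_grid_prob) (auto simp: case_prod_unfold)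
    then have "bounded ((\<lambda>p. w (fst p) x (snd p)) ` ({0..T} \<times> grid_prob n))"
      by (rule compact_imp_bounded)
    then show ?thesis by (auto simp: bounded_iff)
  qed
  then obtain M where M: "\<And>x p. x \<in> grid n \<Longrightarrow> p \<in> {0..T} \<times> grid_prob n \<Longrightarrow> \<bar>w (fst p) x (snd p)\<bar> \<le> M x"
    by metis
  define M' where "M' = (\<Sum>x\<in>grid n. \<bar>M x\<bar>)"
  have wM: "\<bar>w t x m\<bar> \<le> M'" if "t \<in> {0..T}" "x \<in> grid n" "m \<in> grid_prob n" for t x m
  proof -
    have "\<bar>w t x m\<bar> \<le> \<bar>M x\<bar>" using M [of x "(t, m)"] that by simp
    also have "\<dots> \<le> M'" unfolding M'_def using that by (intro member_le_sum) auto
    finally show ?thesis .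
  qed
  have diff: "\<bar>diff_fwd n (\<lambda>z. w t z m) x\<bar> \<le> 2 / mesh n * B"
    if "\<And>x. x \<in> grid n \<Longrightarrow> \<bar>w t x m\<bar> \<le> B" "x \<in> grid n" for t x m B
  proof -
    have "\<bar>w t (x + to_torus (mesh n)) m - w t x m\<bar> \<le> 2 * B"
      using that(1) [OF that(2)] that(1) [OF grid_shift(1) [OF n that(2)]] by linarith
    then show ?thesis using h by (simp add: diff_fwd_def abs_divide divide_right_mono)
  qed
  have M'0: "0 \<le> M'" by (simp add: M'_def sum_nonneg)
  then have R: "0 \<le> 2 / mesh n * M'" using h by simp
  \<comment> \<open>The radius is an a priori bound for the quotients of \<open>w\<close>, obtained
    by compactness; \<open>K\<close> may now depend on \<open>n\<close> and on the solution.\<close>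
  obtain K w_t a \<rho> w_m P N where K: "0 \<le> K"
    and "linearised_equation n \<sigma> T w w_t a \<rho> w_m P N K (2 / mesh n * M') (\<omega> (1 / real n))"
    using lin [OF R] by auto
  then interpret E: linearised_equation n \<sigma> T w w_t a \<rho> w_m P N K "2 / mesh n * M'" "\<omega> (1 / real n)" by simp
  define c where "c = K * (1 + 2 / mesh n) + 1"
  have c: "0 \<le> c" using K h by (simp add: c_def)
  have \<omega>0: "0 \<le> \<omega> (1 / real n)" by (rule \<omega>_nonneg) simp
  have bound: "\<bar>w t x m\<bar> \<le> \<omega> (1 / real n) * exp (c * T)" if t: "t \<in> {0..T}" and x: "x \<in> grid n" and m: "m \<in> grid_prob n" for t x m
  proof (rule le_mult_limit [where b = "\<omega> (1 / real n) + 1"])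
    fix \<epsilon> assume \<epsilon>: "\<omega> (1 / real n) < \<epsilon>" "\<epsilon> < \<omega> (1 / real n) + 1"
    have "\<bar>w t x m\<bar> < \<epsilon> * exp (c * (T - t))"
      unfolding c_def using \<epsilon> \<omega>0 t x m diff wM by (intro E.crude_error_bound) auto
    also have "\<dots> \<le> \<epsilon> * exp (c * T)"
      using \<epsilon> \<omega>0 c t by (intro mult_left_mono) (auto intro: mult_left_mono)
    finally show "\<bar>w t x m\<bar> \<le> \<epsilon> * exp (c * T)" by simp
  qed simp
  show thesis
  proof (rule that [of "(1 + 2 / mesh n) * exp (c * T)"])
    show "0 \<le> (1 + 2 / mesh n) * exp (c * T)" using h by simp
    fix t x m assume t: "t \<in> {0..T}" and x: "x \<in> grid n" and m: "m \<in> grid_prob n"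
    have "\<bar>w t x m\<bar> \<le> \<omega> (1 / real n) * exp (c * T)"
      by (rule bound [OF t x m])
    moreover have "\<bar>diff_fwd n (\<lambda>z. w t z m) x\<bar> \<le> 2 / mesh n * (\<omega> (1 / real n) * exp (c * T))"
      by (rule diff [OF bound [OF t _ m] x])
    moreover have "0 \<le> \<omega> (1 / real n) * exp (c * T)" "0 \<le> 2 / mesh n * (\<omega> (1 / real n) * exp (c * T))"
      using \<omega>0 h by auto
    moreover have "(1 + 2 / mesh n) * exp (c * T) * \<omega> (1 / real n) =
        \<omega> (1 / real n) * exp (c * T) + 2 / mesh n * (\<omega> (1 / real n) * exp (c * T))"
      by (simp add: algebra_simps)
    ultimately have "\<bar>w t x m\<bar> \<le> (1 + 2 / mesh n) * exp (c * T) * \<omega> (1 / real n) \<and>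
        \<bar>diff_fwd n (\<lambda>z. w t z m) x\<bar> \<le> (1 + 2 / mesh n) * exp (c * T) * \<omega> (1 / real n)"
      by linarith
    then show "\<bar>u t x m - restrict_to_grid n U t x m\<bar> \<le> (1 + 2 / mesh n) * exp (c * T) * \<omega> (1 / real n) \<and>
        \<bar>diff_fwd n (\<lambda>z. u t z m - restrict_to_grid n U t z m) x\<bar> \<le> (1 + 2 / mesh n) * exp (c * T) * \<omega> (1 / real n)"
      by (simp add: w_def)
  qed
qed

lemma convergence_rate:
  assumes u: "\<And>n. 1 \<le> n \<Longrightarrow> discrete_master_classical_solution n \<sigma> T L f g (u n)"
  obtains C where "0 \<le> C"
    "\<And>n t x m. 1 \<le> n \<Longrightarrow> t \<in> {0..T} \<Longrightarrow> x \<in> grid n \<Longrightarrow> m \<in> grid_prob n \<Longrightarrow>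
      \<bar>u n t x m - restrict_to_grid n U t x m\<bar> \<le> C * \<omega> (1 / real n) \<and>
      \<bar>diff_fwd n (\<lambda>z. u n t z m - restrict_to_grid n U t z m) x\<bar> \<le> C * \<omega> (1 / real n)"
proof -
  define good where "good = (\<lambda>n C. \<forall>t\<in>{0..T}. \<forall>x\<in>grid n. \<forall>m\<in>grid_prob n.
      \<bar>u n t x m - restrict_to_grid n U t x m\<bar> \<le> C * \<omega> (1 / real n) \<and>
      \<bar>diff_fwd n (\<lambda>z. u n t z m - restrict_to_grid n U t z m) x\<bar> \<le> C * \<omega> (1 / real n))"
  have mono: "good n D" if "good n C" "C \<le> D" for n C D
  proof -
    have "C * \<omega> (1 / real n) \<le> D * \<omega> (1 / real n)"
      using that(2) \<omega>_nonneg [of "1 / real n"] by (intro mult_right_mono) auto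
    then show ?thesis using that(1) unfolding good_def by (meson order_trans)
  qed
  obtain C0 n0 where C0: "0 \<le> C0" "\<And>n. 1 \<le> n \<Longrightarrow> n0 \<le> n \<Longrightarrow> good n C0"
  proof (rule convergence_rate_large)
    fix C n0 assume "0 \<le> C" and *: "\<And>n u t x m. 1 \<le> n \<Longrightarrow> n0 \<le> n \<Longrightarrow> discrete_master_classical_solution n \<sigma> T L f g u \<Longrightarrow>
      t \<in> {0..T} \<Longrightarrow> x \<in> grid n \<Longrightarrow> m \<in> grid_prob n \<Longrightarrow>
      \<bar>u t x m - restrict_to_grid n U t x m\<bar> \<le> C * \<omega> (1 / real n) \<and>
      \<bar>diff_fwd n (\<lambda>z. u t z m - restrict_to_grid n U t z m) x\<bar> \<le> C * \<omega> (1 / real n)"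
    then show thesis
      unfolding good_def by (intro that [of C n0, unfolded good_def] ballI * u)
  qed
  have "\<exists>C. 0 \<le> C \<and> good n C" if "1 \<le> n" for n
    by (rule convergence_rate_fixed [OF that u [OF that]]) (auto simp: good_def)
  then obtain C1 where C1: "\<And>n. 1 \<le> n \<Longrightarrow> 0 \<le> C1 n \<and> good n (C1 n)"
    by metis
  \<comment> \<open>A sum of nonnegative constants in place of a maximum.\<close>
  have "good n (C0 + (\<Sum>k=1..n0. C1 k))" if n: "1 \<le> n" for n
  proof (cases "n0 \<le> n")
    case True
    have "0 \<le> (\<Sum>k=1..n0. C1 k)" using C1 by (intro sum_nonneg) auto
    then show ?thesis using mono [OF C0(2) [OF n True]] by simp
  next
    case False
    have "C1 n \<le> (\<Sum>k=1..n0. C1 k)" using C1 n False by (intro member_le_sum) auto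
    then show ?thesis using mono [of n "C1 n"] C1 [OF n] C0(1) by simp
  qed
  moreover have "0 \<le> C0 + (\<Sum>k=1..n0. C1 k)" using C0 C1 by (auto intro!: add_nonneg_nonneg sum_nonneg)
  ultimately show thesis by (intro that [of "C0 + (\<Sum>k=1..n0. C1 k)"]) (auto simp: good_def)
qed

end

section \<open>From the pointwise rate to the optimal process\<close>

lemma law_grid_prob:
  assumes X: "markov_jump_process \<Omega> X T (grid n) q" and t: "t \<in> {0..T}"
  shows "law \<Omega> (X t) \<in> grid_prob n"
proof -
  have Xt: "X t \<in> measurable \<Omega> (count_space (grid n))" and "prob_space \<Omega>"
    using X t by (auto simp: markov_jump_process_def)
  interpret prob_space \<Omega> by fact
  define A where "A = (\<lambda>x. {w \<in> space \<Omega>. X t w = x})"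
  have grid: "X t w \<in> grid n" if "w \<in> space \<Omega>" for w
    using measurable_space [OF Xt that] by simp
  have "A x = X t -` {x} \<inter> space \<Omega>" for x by (auto simp: A_def)
  then have A: "A x \<in> sets \<Omega>" if "x \<in> grid n" for x
    using measurable_sets [OF Xt, of "{x}"] that by simp
  have "(\<Sum>x\<in>grid n. measure \<Omega> (A x)) = measure \<Omega> (\<Union>x\<in>grid n. A x)"
    using A by (intro finite_measure_finite_Union [symmetric]) (auto simp: disjoint_family_on_def A_def)
  also have "(\<Union>x\<in>grid n. A x) = space \<Omega>" using grid by (auto simp: A_def)
  finally have "(\<Sum>x\<in>grid n. measure \<Omega> (A x)) = 1" by (simp add: prob_space)
  moreover have "A x = {}" if "x \<notin> grid n" for x using grid that by (auto simp: A_def)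
  moreover have "law \<Omega> (X t) = (\<lambda>x. measure \<Omega> (A x))"
    by (simp add: law_def A_def fun_eq_iff)
  ultimately show ?thesis
    by (auto simp: grid_prob_def)
qed

theorem theorem3p3:
  fixes \<sigma> T \<gamma> :: real
    and L :: "torus \<Rightarrow> real \<Rightarrow> real"
    and f g :: "torus measure \<Rightarrow> torus \<Rightarrow> real"
    and U :: "real \<Rightarrow> torus \<Rightarrow> torus measure \<Rightarrow> real"
    and u :: "nat \<Rightarrow> real \<Rightarrow> torus \<Rightarrow> (torus \<Rightarrow> real) \<Rightarrow> real"
    and \<omega> :: "real \<Rightarrow> real"
  assumes "0 < \<sigma>" and "0 < T" and "0 < \<gamma>" and "\<gamma> < 1"
    and "admissible_lagrangian L"
    and "admissible_running_cost \<gamma> f"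
    and "admissible_terminal_cost \<gamma> g"
    and "master_classical_solution \<sigma> T L f g U"
    and "\<And>n. 1 \<le> n \<Longrightarrow> discrete_master_classical_solution n \<sigma> T L f g (u n)"
    and "common_modulus T U \<omega>"
  shows "\<exists>C\<ge>0. \<forall>n\<ge>1.
    (\<forall>t\<in>{0..T}. \<forall>x\<in>grid n. \<forall>m\<in>grid_prob n.
       \<bar>u n t x m - restrict_to_grid n U t x m\<bar> \<le> C * \<omega> (1 / real n)) \<and>
    (\<forall>\<mu>0\<in>grid_prob n. \<forall>(\<Omega> :: 'w measure) X.
       optimal_process n \<sigma> T L (u n) \<mu>0 \<Omega> X \<longrightarrow>
       (\<integral>\<^sup>+w. (\<integral>\<^sup>+t\<in>{0..T}. ennreal
          (\<bar>diff_fwd n (\<lambda>z. u n t z (law \<Omega> (X t)) - restrict_to_grid n U t z (law \<Omega> (X t))) (X t w)\<bar>\<^sup>2 +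
           \<bar>diff_bwd n (\<lambda>z. u n t z (law \<Omega> (X t)) - restrict_to_grid n U t z (law \<Omega> (X t))) (X t w)\<bar>\<^sup>2)
          \<partial>lborel) \<partial>\<Omega>) \<le> ennreal (C * (\<omega> (1 / real n))\<^sup>2))"
proof -
  obtain U_t where "master_equation \<sigma> T L f g U U_t \<omega>"
    using assms(1,2,5,8,10) unfolding master_classical_solution_def master_equation_def by blast
  then interpret master_equation \<sigma> T L f g U U_t \<omega> .
  obtain C where C: "0 \<le> C" and rate: "\<And>n t x m. 1 \<le> n \<Longrightarrow> t \<in> {0..T} \<Longrightarrow> x \<in> grid n \<Longrightarrow> m \<in> grid_prob n \<Longrightarrow>
      \<bar>u n t x m - restrict_to_grid n U t x m\<bar> \<le> C * \<omega> (1 / real n) \<and>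
      \<bar>diff_fwd n (\<lambda>z. u n t z m - restrict_to_grid n U t z m) x\<bar> \<le> C * \<omega> (1 / real n)"
    by (rule convergence_rate [OF assms(9)]) (simp, rule that, blast+)
  show ?thesis
  \<comment> \<open>One constant for both estimates: two squares of at most (C \<omega>(1/n))^2
    each, integrated over a time interval of length T.\<close>
  proof (intro exI [of _ "C + 2 * C\<^sup>2 * T"] conjI allI impI ballI)
    show "0 \<le> C + 2 * C\<^sup>2 * T" using C assms(2) by simp
  next
    fix n :: nat and t x m assume n: "1 \<le> n" and t: "t \<in> {0..T}" and x: "x \<in> grid n" and m: "m \<in> grid_prob n"
    have "C * \<omega> (1 / real n) \<le> (C + 2 * C\<^sup>2 * T) * \<omega> (1 / real n)"
      using assms(2) \<omega>_nonneg [of "1 / real n"] by (intro mult_right_mono) auto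
    then show "\<bar>u n t x m - restrict_to_grid n U t x m\<bar> \<le> (C + 2 * C\<^sup>2 * T) * \<omega> (1 / real n)"
      using rate [OF n t x m] by linarith
  next
    fix n :: nat and \<mu>0 and \<Omega> :: "'w measure" and X
    assume n: "1 \<le> n" and "optimal_process n \<sigma> T L (u n) \<mu>0 \<Omega> X"
    then have X: "markov_jump_process \<Omega> X T (grid n) (optimal_rate n \<sigma> L (u n) (\<lambda>t. law \<Omega> (X t)))"
      by (simp add: optimal_process_def)
    then interpret P: prob_space \<Omega> by (simp add: markov_jump_process_def)
    define w where "w = (\<lambda>t z. u n t z (law \<Omega> (X t)) - restrict_to_grid n U t z (law \<Omega> (X t)))"
    define b where "b = 2 * (C * \<omega> (1 / real n))\<^sup>2"
    have inner: "(\<integral>\<^sup>+t\<in>{0..T}. ennreal (\<bar>diff_fwd n (w t) (X t \<xi>)\<bar>\<^sup>2 + \<bar>diff_bwd n (w t) (X t \<xi>)\<bar>\<^sup>2) \<partial>lborel) \<le> ennreal (b * T)"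
      if \<xi>: "\<xi> \<in> space \<Omega>" for \<xi>
    proof -
      have "(\<integral>\<^sup>+t\<in>{0..T}. ennreal (\<bar>diff_fwd n (w t) (X t \<xi>)\<bar>\<^sup>2 + \<bar>diff_bwd n (w t) (X t \<xi>)\<bar>\<^sup>2) \<partial>lborel)
        \<le> (\<integral>\<^sup>+t\<in>{0..T}. ennreal b \<partial>lborel)"
      proof (intro nn_integral_mono)
        fix t :: real
        show "ennreal (\<bar>diff_fwd n (w t) (X t \<xi>)\<bar>\<^sup>2 + \<bar>diff_bwd n (w t) (X t \<xi>)\<bar>\<^sup>2) * indicator {0..T} t
          \<le> ennreal b * indicator {0..T} t"
        proof (cases "t \<in> {0..T}")
          case True
          have Xt: "X t \<in> measurable \<Omega> (count_space (grid n))"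
            using X True by (simp add: markov_jump_process_def)
          have x: "X t \<xi> \<in> grid n"
            using measurable_space [OF Xt \<xi>] by simp
          have "\<bar>diff_fwd n (w t) y\<bar> \<le> C * \<omega> (1 / real n)" if "y \<in> grid n" for y
            using rate [OF n True that law_grid_prob [OF X True]] by (simp add: w_def)
          then have "\<bar>diff_fwd n (w t) (X t \<xi>)\<bar> \<le> C * \<omega> (1 / real n)" "\<bar>diff_bwd n (w t) (X t \<xi>)\<bar> \<le> C * \<omega> (1 / real n)"
            using x grid_shift(2) [OF n x] by (auto simp: fwd_bwd_diff)
          then have "\<bar>diff_fwd n (w t) (X t \<xi>)\<bar>\<^sup>2 + \<bar>diff_bwd n (w t) (X t \<xi>)\<bar>\<^sup>2 \<le> (C * \<omega> (1 / real n))\<^sup>2 + (C * \<omega> (1 / real n))\<^sup>2"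
            by (intro add_mono power_mono) auto
          then have "ennreal (\<bar>diff_fwd n (w t) (X t \<xi>)\<bar>\<^sup>2 + \<bar>diff_bwd n (w t) (X t \<xi>)\<bar>\<^sup>2) \<le> ennreal b"
            by (intro ennreal_leI) (simp add: b_def)
          then show ?thesis using True by (simp del: ennreal_plus)
        qed simp
      qed
      also have "\<dots> = ennreal (b * T)"
        using assms(2) by (simp add: nn_integral_cmult_indicator b_def ennreal_mult)
      finally show ?thesis .
    qed
    have "(\<integral>\<^sup>+\<xi>. (\<integral>\<^sup>+t\<in>{0..T}. ennreal (\<bar>diff_fwd n (w t) (X t \<xi>)\<bar>\<^sup>2 + \<bar>diff_bwd n (w t) (X t \<xi>)\<bar>\<^sup>2) \<partial>lborel) \<partial>\<Omega>)
      \<le> (\<integral>\<^sup>+\<xi>. ennreal (b * T) \<partial>\<Omega>)"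
      using inner by (intro nn_integral_mono)
    also have "\<dots> = ennreal (b * T)"
      by (simp add: P.emeasure_space_1)
    also have "\<dots> \<le> ennreal ((C + 2 * C\<^sup>2 * T) * (\<omega> (1 / real n))\<^sup>2)"
      using C by (intro ennreal_leI) (simp add: b_def power_mult_distrib algebra_simps)
    finally show "(\<integral>\<^sup>+w. (\<integral>\<^sup>+t\<in>{0..T}. ennreal
          (\<bar>diff_fwd n (\<lambda>z. u n t z (law \<Omega> (X t)) - restrict_to_grid n U t z (law \<Omega> (X t))) (X t w)\<bar>\<^sup>2 +
           \<bar>diff_bwd n (\<lambda>z. u n t z (law \<Omega> (X t)) - restrict_to_grid n U t z (law \<Omega> (X t))) (X t w)\<bar>\<^sup>2)
          \<partial>lborel) \<partial>\<Omega>) \<le> ennreal ((C + 2 * C\<^sup>2 * T) * (\<omega> (1 / real n))\<^sup>2)"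
      unfolding w_def .
  qed
qed

end
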